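(* For $\vec{x}=(a,b,c,d,e,f,g)^T\in V$, $$S(a)\,A(1+a-f,1+b-f,1+c-f,1+d-f)\,A(1+a-g,1+b-g,1+c-g,1+d-g)\,A(1-a,e-a,f-a,g-a)\,K_{p_0}(\vec{x})$$ $$-\,A(a,1+a-e,1+a-f,1+a-g)\,B_4(\vec{x})\,K_{n_4}(\vec{x})-A(a,b,c,d)\,B_2(\vec{x})\,L_{\overline{6}}(\vec{x})=0.$$
   Context: $V=\{(a,b,c,d,e,f,g)^T\in\mathbb{C}^7: e+f+g-a-b-c-d=1\}$. ${}_4F_3\left[\begin{smallmatrix}a,b,c,d\\ e,f,g\end{smallmatrix};1\right]=\sum_{n\ge0}\frac{(a)_n(b)_n(c)_n(d)_n}{n!(e)_n(f)_n(g)_n}$, with $(a)_n$ the rising factorial. For $(a,b,c,d,e,f,g)^T\in V$, $$K(a;b,c,d;e,f,g)=\frac{{}_4F_3\left[\begin{smallmatrix}a,b,c,d\\ e,f,g\end{smallmatrix};1\right]}{\sin\pi a\,\Gamma(a)\Gamma(1+a-e)\Gamma(1+a-f)\Gamma(1+a-g)\Gamma(e)\Gamma(f)\Gamma(g)}+\frac{{}_4F_3\left[\begin{smallmatrix}a,1+a-e,1+a-f,1+a-g\\ 1+a-b,1+a-c,1+a-d\end{smallmatrix};1\right]}{\sin\pi a\,\Gamma(a)\Gamma(b)\Gamma(c)\Gamma(d)\Gamma(1+a-b)\Gamma(1+a-c)\Gamma(1+a-d)},$$ $$L(a,b,c,d;e;f,g)=\frac{{}_4F_3\left[\begin{smallmatrix}a,b,c,d\\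 e,f,g\end{smallmatrix};1\right]}{\sin\pi e\,\Gamma(1+a-e)\Gamma(1+b-e)\Gamma(1+c-e)\Gamma(1+d-e)\Gamma(e)\Gamma(f)\Gamma(g)}-\frac{{}_4F_3\left[\begin{smallmatrix}1+a-e,1+b-e,1+c-e,1+d-e\\ 2-e,1+f-e,1+g-e\end{smallmatrix};1\right]}{\sin\pi e\,\Gamma(a)\Gamma(b)\Gamma(c)\Gamma(d)\Gamma(2-e)\Gamma(1+f-e)\Gamma(1+g-e)}.$$ Notation: $S(a_1,\dots,a_n)=\sin\pi a_1\cdots\sin\pi a_n$; $A(x,y,z,w)=\frac{1}{\Gamma(x)\Gamma(y)\Gamma(z)\Gamma(w)}$ (with $1/\Gamma=0$ at nonpositive integers). The relation is asserted for those $\vec{x}\in V$ at which the $K$ and $L$ functions occurring are defined (no lower parameter of an occurring series is a nonpositive integer, no sine in an occurring denominator vanishes). Here $K_{p_0}(\vec{x})=K(a;b,c,d;e,f,g)$, $K_{n_4}(\vec{x})=K(e-a;e-b,e-c,e-d;1+e-f,1+e-g,e)$, $L_{\overline{6}}(\vec{x})=L(1-a,1-b,1-c,1-d;2-e;2-f,2-g)$, and $B_2(\vec{x})=\pi^{-4}S(f-a,g-a)\,[S(b-a,c-a,d-a)+S(e-2a,f-a,g-a)]$, $B_4(\vec{x})=\pi^{-4}S(f-a,g-a)\,[S(b,c,d)+S(e-a,f,g)]$. *)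

theory Defs
  imports "HOL-Analysis.Analysis"
begin

text \<open>
  Coordinates of \<open>\<complex>\<^sup>7\<close> are written as tuples \<open>(a, b, c, d, e, f, g)\<close>.
\<close>

definition V ::
  "(complex \<times> complex \<times> complex \<times> complex \<times> complex \<times> complex \<times> complex) set" where
  "V = {(a, b, c, d, e, f, g). e + f + g - a - b - c - d = 1}"

text \<open>
  The value at 1 of the generalised hypergeometric series with upper parameters
  \<open>a, b, c, d\<close> and lower parameters \<open>e, f, g\<close>. It is only meaningful if no lower parameter is
  a nonpositive integer. On \<open>V\<close>, every series used below has lower minus upper parameter sum
  equal to 1 and hence converges absolutely.
\<close>

definition hyp4F3 ::
  "complex \<Rightarrow> complex \<Rightarrow> complex \<Rightarrow> complex \<Rightarrow> complex \<Rightarrow> complex \<Rightarrow> complex \<Rightarrow> complex" where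
  "hyp4F3 a b c d e f g =
     (\<Sum>n. (pochhammer a n * pochhammer b n * pochhammer c n * pochhammer d n) /
           (fact n * pochhammer e n * pochhammer f n * pochhammer g n))"

text \<open>
  Reciprocals of Gamma values are rendered by the entire function \<^const>\<open>rGamma\<close>, which
  vanishes at the nonpositive integers.
\<close>

definition K_fun ::
  "complex \<Rightarrow> complex \<Rightarrow> complex \<Rightarrow> complex \<Rightarrow> complex \<Rightarrow> complex \<Rightarrow> complex \<Rightarrow> complex" where
  "K_fun a b c d e f g =
     hyp4F3 a b c d e f g / sin (of_real pi * a) *
       (rGamma a * rGamma (1 + a - e) * rGamma (1 + a - f) * rGamma (1 + a - g) *
        rGamma e * rGamma f * rGamma g) +
     hyp4F3 a (1 + a - e) (1 + a - f) (1 + a - g) (1 + a - b) (1 + a - c) (1 + a - d) /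
         sin (of_real pi * a) *
       (rGamma a * rGamma b * rGamma c * rGamma d *
        rGamma (1 + a - b) * rGamma (1 + a - c) * rGamma (1 + a - d))"

definition L_fun ::
  "complex \<Rightarrow> complex \<Rightarrow> complex \<Rightarrow> complex \<Rightarrow> complex \<Rightarrow> complex \<Rightarrow> complex \<Rightarrow> complex" where
  "L_fun a b c d e f g =
     hyp4F3 a b c d e f g / sin (of_real pi * e) *
       (rGamma (1 + a - e) * rGamma (1 + b - e) * rGamma (1 + c - e) * rGamma (1 + d - e) *
        rGamma e * rGamma f * rGamma g) -
     hyp4F3 (1 + a - e) (1 + b - e) (1 + c - e) (1 + d - e) (2 - e) (1 + f - e) (1 + g - e) /
         sin (of_real pi * e) *
       (rGamma a * rGamma b * rGamma c * rGamma d *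
        rGamma (2 - e) * rGamma (1 + f - e) * rGamma (1 + g - e))"

text \<open>
  \<open>K_fun\<close> and \<open>L_fun\<close> are defined at a point if the sine in the denominators does not vanish
  there and no lower parameter of the two series is a nonpositive integer.
\<close>

definition K_defined ::
  "complex \<Rightarrow> complex \<Rightarrow> complex \<Rightarrow> complex \<Rightarrow> complex \<Rightarrow> complex \<Rightarrow> complex \<Rightarrow> bool" where
  "K_defined a b c d e f g \<longleftrightarrow>
     sin (of_real pi * a) \<noteq> 0 \<and>
     e \<notin> \<int>\<^sub>\<le>\<^sub>0 \<and> f \<notin> \<int>\<^sub>\<le>\<^sub>0 \<and> g \<notin> \<int>\<^sub>\<le>\<^sub>0 \<and>
     1 + a - b \<notin> \<int>\<^sub>\<le>\<^sub>0 \<and> 1 + a - c \<notin> \<int>\<^sub>\<le>\<^sub>0 \<and> 1 + a - d \<notin> \<int>\<^sub>\<le>\<^sub>0"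

definition L_defined ::
  "complex \<Rightarrow> complex \<Rightarrow> complex \<Rightarrow> complex \<Rightarrow> complex \<Rightarrow> complex \<Rightarrow> complex \<Rightarrow> bool" where
  "L_defined a b c d e f g \<longleftrightarrow>
     sin (of_real pi * e) \<noteq> 0 \<and>
     e \<notin> \<int>\<^sub>\<le>\<^sub>0 \<and> f \<notin> \<int>\<^sub>\<le>\<^sub>0 \<and> g \<notin> \<int>\<^sub>\<le>\<^sub>0 \<and>
     2 - e \<notin> \<int>\<^sub>\<le>\<^sub>0 \<and> 1 + f - e \<notin> \<int>\<^sub>\<le>\<^sub>0 \<and> 1 + g - e \<notin> \<int>\<^sub>\<le>\<^sub>0"

definition S_fun :: "complex list \<Rightarrow> complex" where
  "S_fun xs = (\<Prod>x\<leftarrow>xs. sin (of_real pi * x))"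

definition A_fun :: "complex \<Rightarrow> complex \<Rightarrow> complex \<Rightarrow> complex \<Rightarrow> complex" where
  "A_fun x y z w = rGamma x * rGamma y * rGamma z * rGamma w"

definition K_p0 ::
  "complex \<Rightarrow> complex \<Rightarrow> complex \<Rightarrow> complex \<Rightarrow> complex \<Rightarrow> complex \<Rightarrow> complex \<Rightarrow> complex" where
  "K_p0 a b c d e f g = K_fun a b c d e f g"

definition K_n4 ::
  "complex \<Rightarrow> complex \<Rightarrow> complex \<Rightarrow> complex \<Rightarrow> complex \<Rightarrow> complex \<Rightarrow> complex \<Rightarrow> complex" where
  "K_n4 a b c d e f g = K_fun (e - a) (e - b) (e - c) (e - d) (1 + e - f) (1 + e - g) e"

definition L_bar6 ::
  "complex \<Rightarrow> complex \<Rightarrow> complex \<Rightarrow> complex \<Rightarrow> complex \<Rightarrow> complex \<Rightarrow> complex \<Rightarrow> complex" where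
  "L_bar6 a b c d e f g = L_fun (1 - a) (1 - b) (1 - c) (1 - d) (2 - e) (2 - f) (2 - g)"

definition B2 ::
  "complex \<Rightarrow> complex \<Rightarrow> complex \<Rightarrow> complex \<Rightarrow> complex \<Rightarrow> complex \<Rightarrow> complex \<Rightarrow> complex" where
  "B2 a b c d e f g =
     1 / of_real pi ^ 4 * S_fun [f - a, g - a] *
       (S_fun [b - a, c - a, d - a] + S_fun [e - 2 * a, f - a, g - a])"

definition B4 ::
  "complex \<Rightarrow> complex \<Rightarrow> complex \<Rightarrow> complex \<Rightarrow> complex \<Rightarrow> complex \<Rightarrow> complex \<Rightarrow> complex" where
  "B4 a b c d e f g =
     1 / of_real pi ^ 4 * S_fun [f - a, g - a] * (S_fun [b, c, d] + S_fun [e - a, f, g])"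

end

theory Submission
  imports Defs "HOL-Complex_Analysis.Complex_Analysis"
begin

text \<open>
  Up to Gamma factors, the relation involves two solutions at 1 of one hypergeometric equation
  and three solutions at 1 of the equation with the dual parameters \<open>1 - a, \<dots>, 2 - e, \<dots>\<close>.
  Two kinds of relations connect such values.
  A balanced series at infinity is a linear combination of three series at zero: this is the limit
  of the vanishing of the sum of the residues of a rational function. It expresses each \<open>K\<close>
  through two \<open>L\<close>'s belonging to the same equation.
  A passage between the two equations comes from Bailey's transformation of terminating
  very-well-poised \<open>9F8\<close> series with parameters tending to infinity: the sum is then concentrated at
  both ends, each of which contributes one of the two series of an \<open>L\<close>. This gives
  \<open>L(a,b,c,d;e;f,g) = L(f-a,f-b,c,d;e+f-a-b;f,f+g-a-b)\<close>, and applying it twice leads to the dual equation.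
  Eliminating the second \<open>L\<close> proves the relation for generic parameters. After clearing the sines in
  the denominators both sides are entire on \<open>V\<close>, so the relation extends to all parameters.
\<close>

section \<open>Terminating very-well-poised sums\<close>

text \<open>Duality carries the two \<open>L\<close>'s of one equation to those of the other in
  exchanged order. Eliminating the \<open>L\<close> absent from the statement leaves, in front of
  the remaining one, a difference of two products of sines. That this difference contains the common
  factor \<open>kappa\<close> of both \<open>K\<close>'s, with the sine sum of \<open>B2\<close> as
  cofactor, is a quadratic sine identity and explains the shape of \<open>B2\<close>. The
  elimination thus yields only \<open>kappa\<close> times the relation, and \<open>kappa\<close> has
  to be cancelled by a second continuation. The passage from infinity to zero is classically a
  Barnes contour integral. Here the Gamma quotient under the integral is truncated to a rational
  function with finitely many simple poles, so that the residue theorem becomes Lagrange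
  interpolation. The price is that the truncated sums are dominated by a convergent series only if
  certain differences of parameters have real part between 0 and 2. These bounds and all conditions
  of non-integrality hold together on a nonempty open part of \<open>V\<close>, from which the
  continuation starts.\<close>

type_synonym complex_fun7 =
  "complex \<Rightarrow> complex \<Rightarrow> complex \<Rightarrow> complex \<Rightarrow> complex \<Rightarrow> complex \<Rightarrow> complex \<Rightarrow> complex"

section \<open>Well-poised quotients and Dougall's summation theorem\<close>

lemma not_Ints_shift:
  fixes z w :: complex
  assumes "z \<notin> \<int>" "w = z + of_int k"
  shows "w \<notin> \<int>"
  using assms by (metis Ints_of_int Ints_diff add_diff_cancel_right')

lemma pochhammer_nonzero:
  fixes z :: complex
  assumes "z \<notin> \<int>"
  shows "pochhammer z k \<noteq> 0"
  using assms pochhammer_eq_0_imp_nonpos_Int nonpos_Ints_Int by blast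

lemma add_of_nat_nonzero:
  fixes z :: complex
  assumes "z \<notin> \<int>"
  shows "z + of_nat k \<noteq> 0"
  using assms by (metis Ints_0 Ints_diff Ints_of_nat add_diff_cancel_right')

text \<open>In a well-poised series an upper parameter \<open>x\<close> and its lower partner add up
  to \<open>1 + a\<close>; both are kept together here. For \<open>x = a\<close> the partner is 1,
  so that this quotient contributes the \<open>1 / k!\<close> of the series.\<close>

definition wp_quot :: "complex \<Rightarrow> complex \<Rightarrow> nat \<Rightarrow> complex" where
  "wp_quot a x k = pochhammer x k / pochhammer (1 + a - x) k"

lemma wp_quot_0 [simp]: "wp_quot a x 0 = 1"
  by (simp add: wp_quot_def)

lemma wp_quot_Suc: "wp_quot a x (Suc k) = wp_quot a x k * ((x + of_nat k) / (1 + a - x + of_nat k))"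
  by (simp add: wp_quot_def pochhammer_Suc)

text \<open>A shift of the index by \<open>j\<close> preserves well-poisedness, with
  \<open>a\<close> moving by \<open>2 * j\<close> and each parameter by \<open>j\<close>. This opens
  the inner sums of Bailey's transformation to Dougall's theorem.\<close>

lemma wp_quot_add: "wp_quot a x (j + i) = wp_quot a x j * wp_quot (a + 2 * of_nat j) (x + of_nat j) i"
proof -
  have "1 + (a + 2 * of_nat j) - (x + of_nat j) = 1 + a - x + of_nat j"
    by simp
  then show ?thesis
    by (simp only: wp_quot_def pochhammer_product' times_divide_times_eq)
qed

text \<open>Raising \<open>x\<close> lowers its partner, so contiguous quotients differ by a factor
  quadratic in \<open>k\<close>. In the induction for Dougall's theorem both \<open>e\<close> and
  \<open>-(n + 1)\<close> are raised in this way.\<close>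

lemma wp_quot_plus1:
  assumes "x \<noteq> 0" "a - x \<notin> \<int>"
  shows "wp_quot a (x + 1) k = wp_quot a x k * ((x + of_nat k) * (a - x + of_nat k) / (x * (a - x)))"
proof -
  have nz: "a - x + of_nat k \<noteq> 0" "a - x \<noteq> 0"
    using add_of_nat_nonzero[OF assms(2), of k] assms(2) by auto
  have 1: "x * pochhammer (x + 1) k = (x + of_nat k) * pochhammer x k"
    using pochhammer_rec[of x k] pochhammer_rec'[of x k] by simp
  have 2: "(a - x) * pochhammer (1 + a - x) k = (a - x + of_nat k) * pochhammer (a - x) k"
    using pochhammer_rec[of "a - x" k] pochhammer_rec'[of "a - x" k] by (simp add: algebra_simps)
  have 3: "pochhammer (x + 1) k = (x + of_nat k) * pochhammer x k / x"
    using 1 assms(1) by (simp add: field_simps)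
  have 4: "pochhammer (1 + a - x) k = (a - x + of_nat k) * pochhammer (a - x) k / (a - x)"
    using 2 nz by (simp add: field_simps)
  have 5: "1 + a - (x + 1) = a - x" by simp
  show ?thesis
    unfolding wp_quot_def 5 3 4 using nz assms(1) pochhammer_nonzero[OF assms(2), of k]
    by (simp add: mult.commute)
qed

text \<open>The telescoping equation of \<open>dougall_7F6\<close> after the common hypergeometric
  factor has been cancelled. In the induction step \<open>N\<close> is \<open>1 + a + n\<close>; the
  two assumptions are the balance condition solved for \<open>N\<close> and for
  \<open>n\<close>.\<close>

lemma dougall_step_poly:
  fixes a b c d n k e N :: complex
  assumes "N = b + c + d - a + e" "n = b + c + d - 2 * a + e - 1"
  shows "(a + 2 * k) * ((N - b) * (N - c) * (N - d) * ((n + 1) * (e + k) * (a - e + k)) +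
      (N - b - c) * (N - b - d) * (N - c - d) * (e * ((n + 1 - k) * (N + k)))) =
    (1 + n + e) * ((a + k) * (b + k) * (c + k) * (d + k) * (e + k) * (n + 1 - k) +
       k * (k + a - b) * (k + a - c) * (k + a - d) * (k + a - e) * (N + k))"
  unfolding assms by algebra

text \<open>The classical very-well-poised factor is \<open>(a + 2 k) / a\<close>, produced by the
  parameter pair \<open>1 + a / 2\<close>, \<open>a / 2\<close>. Here \<open>a\<close> is not
  divided out, so the sums are \<open>a\<close> times the classical series.\<close>

definition vwp_term :: "complex \<Rightarrow> complex list \<Rightarrow> nat \<Rightarrow> complex" where
  "vwp_term a xs k = (a + 2 * of_nat k) * wp_quot a a k * (\<Prod>x\<leftarrow>xs. wp_quot a x k)"

text \<open>The condition on \<open>e\<close> is Dougall's balance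
  \<open>1 + 2 a = b + c + d + e - n\<close>. It forces \<open>e\<close> to grow by one together
  with \<open>n\<close>, so an induction step changes two parameters at once. With denominators
  cleared, the step is a proportionality between two consecutive sums, which a telescoping
  certificate proves.\<close>

lemma dougall_7F6:
  fixes a b c d :: complex and n :: nat
  assumes a: "a \<notin> \<int>" and ab: "a - b \<notin> \<int>" and ac: "a - c \<notin> \<int>" and ad: "a - d \<notin> \<int>"
    and abcd: "a - b - c - d \<notin> \<int>" and e0: "2 * a - b - c - d \<notin> \<int>"
    and e: "e = 1 + 2 * a - b - c - d + of_nat n"
  shows "(\<Sum>k\<le>n. vwp_term a [b, c, d, e, - of_nat n] k) *
      (pochhammer (1 + a - b) n * pochhammer (1 + a - c) n * pochhammer (1 + a - d) n *
       pochhammer (1 + a - b - c - d) n) =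
    a * pochhammer (1 + a) n * pochhammer (1 + a - b - c) n * pochhammer (1 + a - b - d) n *
      pochhammer (1 + a - c - d) n"
  unfolding e
proof (induction n)
  case 0
  show ?case by (simp add: vwp_term_def)
next
  case (Suc n)
  define e where "e = 1 + 2 * a - b - c - d + of_nat n"
  define N where "N = 1 + a + of_nat n"
  define m :: complex where "m = of_nat n"
  have e_eq: "1 + 2 * a - b - c - d + of_nat (Suc n) = e + 1"
    by (simp add: e_def)
  have eI: "e \<notin> \<int>" unfolding e_def
    by (rule not_Ints_shift[OF e0, of _ "1 + int n"]) simp
  have aeI: "a - e \<notin> \<int>"
  proof -
    have "- (a - e) \<notin> \<int>" unfolding e_def
      by (rule not_Ints_shift[OF abcd, of _ "1 + int n"]) simp
    then show ?thesis by (metis minus_in_Ints_iff)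
  qed
  have NI: "N \<notin> \<int>" unfolding N_def
    by (rule not_Ints_shift[OF a, of _ "1 + int n"]) simp
  have nz: "e \<noteq> 0" "a - e \<noteq> 0" "N \<noteq> 0" "m + 1 \<noteq> 0"
    using eI aeI NI unfolding m_def by (auto simp flip: of_nat_Suc simp: add.commute)
  \<comment> \<open>\<open>q\<close> takes \<open>e\<close> from the sum of length \<open>n\<close>
    and \<open>-(n + 1)\<close> from the sum of length \<open>n + 1\<close>. By contiguity the terms
    of both sums are \<open>(a + 2 k) q\<close> times a factor quadratic in
    \<open>k\<close>.\<close>
  define q where "q k = wp_quot a a k * wp_quot a b k * wp_quot a c k * wp_quot a d k * wp_quot a e k * wp_quot a (- of_nat (Suc n)) k" for k
  define num where "num = (N - b) * (N - c) * (N - d) * (N - b - c - d)"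
  define den where "den = N * (N - b - c) * (N - b - d) * (N - c - d)"
  \<comment> \<open>Gosper certificate: the difference of the two sums, each multiplied by its own quotient of right-hand sides, telescopes to zero\<close>
  define G where "G k = (1 + m + e) / (e * (m + 1)) * (of_nat k * (of_nat k + a - b) * (of_nat k + a - c) *
     (of_nat k + a - d) * (of_nat k + a - e) * (N + of_nat k) * q k)" for k
  have N_eq: "N = b + c + d - a + e" and m_eq: "m = b + c + d - 2 * a + e - 1"
    by (simp_all add: N_def e_def m_def)
  have t1: "vwp_term a [b, c, d, e + 1, - of_nat (Suc n)] k =
      (a + 2 * of_nat k) * q k * ((e + of_nat k) * (a - e + of_nat k) / (e * (a - e)))" for k
    unfolding vwp_term_def q_def by (simp add: wp_quot_plus1[OF nz(1) aeI])
  have wpn: "wp_quot a (- of_nat n) k = wp_quot a (- of_nat (Suc n)) k *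
      ((m + 1 - of_nat k) * (N + of_nat k) / ((m + 1) * N))" for k
  proof -
    have "wp_quot a (- of_nat (Suc n) + 1) k = wp_quot a (- of_nat (Suc n)) k *
      ((- of_nat (Suc n) + of_nat k) * (a + of_nat (Suc n) + of_nat k) / (- of_nat (Suc n) * (a + of_nat (Suc n))))"
    proof -
      have "- of_nat (Suc n) \<noteq> (0 :: complex)"
        by (simp del: of_nat_Suc)
      moreover have "a - (- of_nat (Suc n)) \<notin> \<int>"
        by (rule not_Ints_shift[OF a, of _ "1 + int n"]) simp
      ultimately show ?thesis
        using wp_quot_plus1[of "- of_nat (Suc n)" a k] unfolding diff_minus_eq_add by blast
    qed
    also have "- of_nat (Suc n) + 1 = - (of_nat n :: complex)" by simp
    also have "(- of_nat (Suc n) + of_nat k) * (a + of_nat (Suc n) + of_nat k) / (- of_nat (Suc n) * (a + of_nat (Suc n)))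
       = (m + 1 - of_nat k) * (N + of_nat k) / ((m + 1) * N)"
    proof -
      have *: "(- of_nat (Suc n) + of_nat k) = - (m + 1 - of_nat k)" "a + of_nat (Suc n) = N"
         "of_nat (Suc n) = m + 1"
        by (simp_all add: m_def N_def)
      show ?thesis unfolding *(1) unfolding *(2) unfolding *(3) by (simp only: mult_minus_left minus_divide_divide)
    qed
    finally show ?thesis .
  qed
  have t0: "vwp_term a [b, c, d, e, - of_nat n] k =
      (a + 2 * of_nat k) * q k * ((m + 1 - of_nat k) * (N + of_nat k) / ((m + 1) * N))" for k
    unfolding vwp_term_def q_def by (simp add: wpn)
  have G_Suc: "G (Suc k) = (1 + m + e) / (e * (m + 1)) * (- ((a + of_nat k) * (b + of_nat k) * (c + of_nat k) *
     (d + of_nat k) * (e + of_nat k) * (m + 1 - of_nat k)) * q k)" for k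
  proof -
    have nzs: "1 + a - b + of_nat k \<noteq> 0" "1 + a - c + of_nat k \<noteq> 0" "1 + a - d + of_nat k \<noteq> 0"
       "1 + a - e + of_nat k \<noteq> 0" "1 + N + of_nat k \<noteq> 0" "1 + (of_nat k :: complex) \<noteq> 0"
      using add_of_nat_nonzero[OF ab, of "Suc k"] add_of_nat_nonzero[OF ac, of "Suc k"]
         add_of_nat_nonzero[OF ad, of "Suc k"] add_of_nat_nonzero[OF aeI, of "Suc k"]
         add_of_nat_nonzero[OF NI, of "Suc k"] of_nat_neq_0[of k, where ?'a = complex]
      by (simp_all add: algebra_simps)
    define s where "s = (of_nat k :: complex)"
    have q_Suc: "q (Suc k) = q k * ((a + s) * (b + s) * (c + s) * (d + s) * (e + s) * (s - (m + 1)) /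
       ((1 + s) * (1 + a - b + s) * (1 + a - c + s) * (1 + a - d + s) * (1 + a - e + s) * (1 + N + s)))"
    proof -
      have *: "1 + a - - of_nat (Suc n) + s = 1 + N + s" "- of_nat (Suc n) + s = s - (m + 1)" "1 + a - a + s = 1 + s"
        by (simp_all add: N_def m_def)
      show ?thesis unfolding q_def wp_quot_Suc s_def[symmetric] * by simp
    qed
    have pf: "of_nat (Suc k) * (of_nat (Suc k) + a - b) * (of_nat (Suc k) + a - c) *
     (of_nat (Suc k) + a - d) * (of_nat (Suc k) + a - e) * (N + of_nat (Suc k)) =
      (1 + s) * (1 + a - b + s) * (1 + a - c + s) * (1 + a - d + s) * (1 + a - e + s) * (1 + N + s)"
    proof -
      have 1: "of_nat (Suc k) + a - x = 1 + a - x + s" for x by (simp add: s_def)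
      have 2: "N + of_nat (Suc k) = 1 + N + s" "of_nat (Suc k) = 1 + s" by (simp_all add: s_def)
      show ?thesis unfolding 1 2(1) unfolding 2(2) ..
    qed
    have gen: "P * (q k * (Q / P)) = q k * Q" if "P \<noteq> 0" for P Q :: complex
      using that by simp
    have nzP: "(1 + s) * (1 + a - b + s) * (1 + a - c + s) * (1 + a - d + s) * (1 + a - e + s) * (1 + N + s) \<noteq> 0"
      using nzs unfolding s_def by simp
    have prod: "of_nat (Suc k) * (of_nat (Suc k) + a - b) * (of_nat (Suc k) + a - c) *
     (of_nat (Suc k) + a - d) * (of_nat (Suc k) + a - e) * (N + of_nat (Suc k)) * q (Suc k) =
       q k * ((a + s) * (b + s) * (c + s) * (d + s) * (e + s) * (s - (m + 1)))"
      unfolding q_Suc pf by (rule gen[OF nzP])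
    have neg: "K * (Q * (P * Z)) = K * (- (P * W) * Q)" if "Z = - W" for K Q P Z W :: complex
      unfolding that by simp
    show ?thesis unfolding G_def prod unfolding s_def[symmetric] by (rule neg) simp
  qed
  have step: "num * vwp_term a [b, c, d, e + 1, - of_nat (Suc n)] k - den * vwp_term a [b, c, d, e, - of_nat n] k =
      G (Suc k) - G k" for k
  proof -
    define s where "s = (of_nat k :: complex)"
    have num': "num = - ((N - b) * (N - c) * (N - d) * (a - e))"
    proof -
      have "N - b - c - d = - (a - e)" using N_eq by simp
      then show ?thesis unfolding num_def by (simp only: mult_minus_right)
    qed
    have *: "num * ((e + s) * (a - e + s) / (e * (a - e))) - den * ((m + 1 - s) * (N + s) / ((m + 1) * N)) =
       - ((N - b) * (N - c) * (N - d) * ((m + 1) * (e + s) * (a - e + s)) +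
      (N - b - c) * (N - b - d) * (N - c - d) * (e * ((m + 1 - s) * (N + s)))) / (e * (m + 1))"
    proof -
      have A: "num * ((e + s) * (a - e + s) / (e * (a - e))) = - ((N - b) * (N - c) * (N - d) * ((e + s) * (a - e + s))) / e"
        unfolding num' using nz by simp
      have B: "den * ((m + 1 - s) * (N + s) / ((m + 1) * N)) =
        (N - b - c) * (N - b - d) * (N - c - d) * ((m + 1 - s) * (N + s)) / (m + 1)"
        unfolding den_def using nz by simp
      have C: "- (X * Y) / e - Z / (m + 1) = - (X * ((m + 1) * Y) + e * Z) / (e * (m + 1))" for X Y Z
        using nz by (simp add: divide_simps)
      show ?thesis unfolding A B using C[of "(N - b) * (N - c) * (N - d)" "(e + s) * (a - e + s)"]
        by (simp add: mult_ac)
    qed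
    have "(a + 2 * s) * (num * ((e + s) * (a - e + s) / (e * (a - e))) - den * ((m + 1 - s) * (N + s) / ((m + 1) * N)))
      = - ((1 + m + e) * ((a + s) * (b + s) * (c + s) * (d + s) * (e + s) * (m + 1 - s) +
       s * (s + a - b) * (s + a - c) * (s + a - d) * (s + a - e) * (N + s))) / (e * (m + 1))"
    proof -
      have "c * L = - Y / D" if "L = - X / D" "c * X = Y" for c L X Y D :: complex
        using that by (metis mult_minus_right times_divide_eq_right)
      from this[OF * dougall_step_poly[OF N_eq m_eq, of s]] show ?thesis .
    qed
    then have "q k * ((a + 2 * s) * (num * ((e + s) * (a - e + s) / (e * (a - e))) - den * ((m + 1 - s) * (N + s) / ((m + 1) * N))))
      = q k * (- ((1 + m + e) * ((a + s) * (b + s) * (c + s) * (d + s) * (e + s) * (m + 1 - s) +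
       s * (s + a - b) * (s + a - c) * (s + a - d) * (s + a - e) * (N + s))) / (e * (m + 1)))"
      by simp
    moreover have "num * (X * Q * T1) - den * (X * Q * T0) = Q * (X * (num * T1 - den * T0))" for X Q T1 T0
      by (simp add: algebra_simps)
    moreover have "E / D * (- P1 * Q) - E / D * (P2 * Q) = Q * (- (E * (P1 + P2)) / D)" for E D P1 P2 Q :: complex
      by (simp add: algebra_simps add_divide_distrib diff_divide_distrib)
    ultimately show ?thesis
      unfolding t0 t1 G_Suc unfolding G_def s_def[symmetric] by (simp only:)
  qed
  have G0: "G 0 = 0" by (simp add: G_def)
  \<comment> \<open>The upper parameter \<open>-(n + 1)\<close> makes \<open>q\<close> vanish at
    \<open>k = n + 2\<close>, just beyond the common range of summation.\<close>
  have GN: "G (Suc (Suc n)) = 0"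
    using pochhammer_of_nat_eq_0_lemma[of "Suc n" "Suc (Suc n)", where ?'a = complex]
    by (simp add: G_def q_def wp_quot_def del: of_nat_Suc)
  have last0: "vwp_term a [b, c, d, e, - of_nat n] (Suc n) = 0"
    using pochhammer_of_nat_eq_0_lemma[of "n" "Suc n", where ?'a = complex]
    by (simp add: vwp_term_def wp_quot_def del: of_nat_Suc)
  have "num * (\<Sum>k\<le>Suc n. vwp_term a [b, c, d, e + 1, - of_nat (Suc n)] k) -
      den * (\<Sum>k\<le>Suc n. vwp_term a [b, c, d, e, - of_nat n] k) = (\<Sum>k\<le>Suc n. G (Suc k) - G k)"
    by (simp only: step[symmetric] sum_subtractf sum_distrib_left)
  also have "\<dots> = 0"
    using sum_lessThan_telescope[of G "Suc (Suc n)"] G0 GN by (simp add: lessThan_Suc_atMost)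
  finally have main: "num * (\<Sum>k\<le>Suc n. vwp_term a [b, c, d, e + 1, - of_nat (Suc n)] k) =
      den * (\<Sum>k\<le>n. vwp_term a [b, c, d, e, - of_nat n] k)"
    using last0 by simp
  have IH: "(\<Sum>k\<le>n. vwp_term a [b, c, d, e, - of_nat n] k) *
      (pochhammer (1 + a - b) n * pochhammer (1 + a - c) n * pochhammer (1 + a - d) n *
       pochhammer (1 + a - b - c - d) n) =
    a * pochhammer (1 + a) n * pochhammer (1 + a - b - c) n * pochhammer (1 + a - b - d) n *
      pochhammer (1 + a - c - d) n"
    using Suc.IH unfolding e_def .
  have P: "pochhammer (1 + a - x) (Suc n) = (N - x) * pochhammer (1 + a - x) n" for x
    by (simp add: pochhammer_Suc N_def algebra_simps)
  have P0: "pochhammer (1 + a) (Suc n) = N * pochhammer (1 + a) n"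
    by (simp add: pochhammer_Suc N_def algebra_simps)
  have P1: "pochhammer (1 + a - x - y) (Suc n) = (N - x - y) * pochhammer (1 + a - x - y) n" for x y
    by (simp add: pochhammer_Suc N_def algebra_simps)
  have P2: "pochhammer (1 + a - x - y - z) (Suc n) = (N - x - y - z) * pochhammer (1 + a - x - y - z) n" for x y z
    by (simp add: pochhammer_Suc N_def algebra_simps)
  have "(\<Sum>k\<le>Suc n. vwp_term a [b, c, d, e + 1, - of_nat (Suc n)] k) *
      (pochhammer (1 + a - b) (Suc n) * pochhammer (1 + a - c) (Suc n) * pochhammer (1 + a - d) (Suc n) *
       pochhammer (1 + a - b - c - d) (Suc n)) =
     (num * (\<Sum>k\<le>Suc n. vwp_term a [b, c, d, e + 1, - of_nat (Suc n)] k)) *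
      (pochhammer (1 + a - b) n * pochhammer (1 + a - c) n * pochhammer (1 + a - d) n *
       pochhammer (1 + a - b - c - d) n)"
    unfolding P P2 num_def by (simp only: mult_ac)
  also have "\<dots> = den * ((\<Sum>k\<le>n. vwp_term a [b, c, d, e, - of_nat n] k) *
      (pochhammer (1 + a - b) n * pochhammer (1 + a - c) n * pochhammer (1 + a - d) n *
       pochhammer (1 + a - b - c - d) n))"
    unfolding main by (simp only: mult.assoc)
  also have "\<dots> = a * pochhammer (1 + a) (Suc n) * pochhammer (1 + a - b - c) (Suc n) *
      pochhammer (1 + a - b - d) (Suc n) * pochhammer (1 + a - c - d) (Suc n)"
    unfolding IH P0 P1 den_def by (simp only: mult_ac)
  finally show ?case
    unfolding e_eq by (simp only: mult.assoc)
qed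


text \<open>Reversing \<open>(-k)_j\<close> and \<open>(1 + l - A - k)_j\<close> turns the factors
  that couple the two indices into a function of \<open>k + j\<close> and \<open>k - j\<close>. With
  \<open>k = j + i\<close> these are Pochhammer symbols in \<open>i\<close> whose parameters are
  shifted by \<open>2 * j\<close> or not at all, as needed for a well-poised sum over
  \<open>i\<close>.\<close>

lemma bailey_matrix:
  assumes k: "j \<le> k" and A: "A \<notin> \<int>" and l: "l \<notin> \<int>" and Al: "A - l \<notin> \<int>"
  shows "wp_quot A A k * (pochhammer (A - l) k / pochhammer (1 + l) k) * (wp_quot l (A + of_nat k) j * wp_quot l (- of_nat k) j) =
    pochhammer A (k + j) * pochhammer (A - l) (k - j) / (fact (k - j) * pochhammer (1 + l) (k + j))"
proof -
  obtain i where i: "k = j + i" using k le_Suc_ex by blast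
  have f: "fact k = fact i * pochhammer (1 + of_nat i :: complex) j"
    using pochhammer_product'[of "1 :: complex" i j] by (simp add: pochhammer_fact i add.commute)
  have neg: "pochhammer (- of_nat k :: complex) j = (-1) ^ j * pochhammer (1 + of_nat i) j"
    using pochhammer_minus[of "of_nat k :: complex" j] by (simp add: i add_ac)
  have neg2: "pochhammer (1 + l - (A + of_nat k)) j = (-1) ^ j * pochhammer (A - l + of_nat i) j"
  proof -
    have "1 + l - (A + of_nat k) = - (A - l + of_nat k - 1)" by simp
    moreover have "A - l + of_nat k - 1 - of_nat j + 1 = A - l + of_nat i" by (simp add: i)
    ultimately show ?thesis using pochhammer_minus[of "A - l + of_nat k - 1" j] by metis
  qed
  have Al_split: "pochhammer (A - l) k = pochhammer (A - l) i * pochhammer (A - l + of_nat i) j"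
    using pochhammer_product'[of "A - l" i j] by (simp add: i add.commute)
  have AlI: "A - l + of_nat i \<notin> \<int>"
    by (rule not_Ints_shift[OF Al, of _ "int i"]) simp
  have nz: "pochhammer (1 + of_nat i :: complex) j \<noteq> 0" "pochhammer (A - l + of_nat i) j \<noteq> 0"
    using pochhammer_nonzero[OF AlI] f by (auto dest: arg_cong[where f = "\<lambda>x. x = (0::complex)"])
  have c1: "1 + l - - of_nat k = 1 + l + of_nat k" "1 + A - A = 1" by simp_all
  show ?thesis
    unfolding wp_quot_def neg neg2 Al_split c1 pochhammer_product'[of A k j] pochhammer_product'[of "1 + l" k j]
       pochhammer_fact[symmetric] f
    using nz by (simp add: i)
qed

text \<open>
  Dougall's theorem writes the factors belonging to \<open>b, c, d\<close> as a finite sum over \<open>j\<close>; after exchanging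
  the summations the sum over \<open>k\<close> is again an instance of Dougall's theorem.
\<close>

lemma bailey_9F8:
  fixes A b c d e f g :: complex and n :: nat
  defines "l \<equiv> 1 + 2 * A - b - c - d"
  assumes bal: "2 + 3 * A = b + c + d + e + f + g - of_nat n"
    and A: "A \<notin> \<int>" and l: "l \<notin> \<int>" and Al: "A - l \<notin> \<int>"
    and Ab: "A - b \<notin> \<int>" and Ac: "A - c \<notin> \<int>" and Ad: "A - d \<notin> \<int>"
    and Ae: "A - e \<notin> \<int>" and Af: "A - f \<notin> \<int>" and Ag: "A - g \<notin> \<int>"
    and le: "l - e \<notin> \<int>" and lf: "l - f \<notin> \<int>" and lg: "l - g \<notin> \<int>"
  shows "(\<Sum>k\<le>n. vwp_term A [b, c, d, e, f, g, - of_nat n] k) / A =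
    pochhammer (1 + A) n * pochhammer (1 + l - e) n * pochhammer (1 + l - f) n * pochhammer (1 + l - g) n /
    (pochhammer (1 + l) n * pochhammer (1 + A - e) n * pochhammer (1 + A - f) n * pochhammer (1 + A - g) n) *
    ((\<Sum>k\<le>n. vwp_term l [l + b - A, l + c - A, l + d - A, e, f, g, - of_nat n] k) / l)"
proof -
  have shift1: "1 + x \<notin> \<int>" if "x \<notin> \<int>" for x :: complex
    by (rule not_Ints_shift[OF that, of _ 1]) simp
  have shift1': "1 + x - y \<notin> \<int>" if "x - y \<notin> \<int>" for x y :: complex
    by (rule not_Ints_shift[OF that, of _ 1]) simp
  have nz: "A \<noteq> 0" "l \<noteq> 0" using A l by auto
  define \<alpha> where "\<alpha> j = vwp_term l [l + b - A, l + c - A, l + d - A] j" for j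
  define E where "E k = wp_quot A e k * wp_quot A f k * wp_quot A g k * wp_quot A (- of_nat n) k" for k
  define M where "M k j = pochhammer A (k + j) * pochhammer (A - l) (k - j) / (fact (k - j) * pochhammer (1 + l) (k + j))" for k j

  \<comment> \<open>Dougall's theorem for base \<open>l\<close> with \<open>A + k\<close> in the
    place of \<open>e\<close>. The value of \<open>l\<close> is chosen such that the balance
    condition holds; up to factors in \<open>A\<close> and \<open>l\<close>, the closed form is then
    the product of the three quotients belonging to \<open>b\<close>, \<open>c\<close> and
    \<open>d\<close>.\<close>
  have expand: "wp_quot A A k * wp_quot A b k * wp_quot A c k * wp_quot A d k = (\<Sum>j\<le>k. \<alpha> j * M k j) / l" for k
  proof -
    have c1: "1 + l - (l + x - A) = 1 + A - x" for x by simp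
    have c2: "1 + l - (l + b - A) - (l + c - A) = d" "1 + l - (l + b - A) - (l + d - A) = c"
       "1 + l - (l + c - A) - (l + d - A) = b" "1 + l - (l + b - A) - (l + c - A) - (l + d - A) = A - l"
      by (simp_all add: l_def algebra_simps)
    have "l - (l + b - A) - (l + c - A) - (l + d - A) \<notin> \<int>"
      by (rule not_Ints_shift[OF Al, of _ "-1"]) (simp add: l_def)
    moreover have "2 * l - (l + b - A) - (l + c - A) - (l + d - A) \<notin> \<int>"
      by (rule not_Ints_shift[OF A, of _ "-1"]) (simp add: l_def)
    moreover have "A + of_nat k = 1 + 2 * l - (l + b - A) - (l + c - A) - (l + d - A) + of_nat k"
      by (simp add: l_def)
    ultimately have *: "l - (l + b - A) - (l + c - A) - (l + d - A) \<notin> \<int>"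
      "2 * l - (l + b - A) - (l + c - A) - (l + d - A) \<notin> \<int>"
      "A + of_nat k = 1 + 2 * l - (l + b - A) - (l + c - A) - (l + d - A) + of_nat k"
      by blast+
    have D: "(\<Sum>j\<le>k. vwp_term l [l + b - A, l + c - A, l + d - A, A + of_nat k, - of_nat k] j) *
        (pochhammer (1 + A - b) k * pochhammer (1 + A - c) k * pochhammer (1 + A - d) k * pochhammer (A - l) k) =
        l * pochhammer (1 + l) k * pochhammer d k * pochhammer c k * pochhammer b k"
      using dougall_7F6[of l "l + b - A" "l + c - A" "l + d - A" "A + of_nat k" k, OF l _ _ _ *] Ab Ac Ad
      unfolding c2 unfolding c1 by simp
    have "\<alpha> j * M k j = wp_quot A A k * (pochhammer (A - l) k / pochhammer (1 + l) k) *
        vwp_term l [l + b - A, l + c - A, l + d - A, A + of_nat k, - of_nat k] j" if "j \<le> k" for j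
      unfolding M_def bailey_matrix[OF that A l Al, symmetric] \<alpha>_def by (simp add: vwp_term_def)
    then have "(\<Sum>j\<le>k. \<alpha> j * M k j) = wp_quot A A k * (pochhammer (A - l) k / pochhammer (1 + l) k) *
        (\<Sum>j\<le>k. vwp_term l [l + b - A, l + c - A, l + d - A, A + of_nat k, - of_nat k] j)"
      by (simp add: sum_distrib_left)
    also have "(\<Sum>j\<le>k. vwp_term l [l + b - A, l + c - A, l + d - A, A + of_nat k, - of_nat k] j) =
       l * pochhammer (1 + l) k * pochhammer d k * pochhammer c k * pochhammer b k /
        (pochhammer (1 + A - b) k * pochhammer (1 + A - c) k * pochhammer (1 + A - d) k * pochhammer (A - l) k)"
      using D pochhammer_nonzero[OF shift1'[OF Ab], of k] pochhammer_nonzero[OF shift1'[OF Ac], of k]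
        pochhammer_nonzero[OF shift1'[OF Ad], of k] pochhammer_nonzero[OF Al, of k] by (simp add: field_simps)
    finally show ?thesis
      using nz pochhammer_nonzero[OF shift1[OF l], of k] pochhammer_nonzero[OF Al, of k]
      by (simp add: wp_quot_def mult_ac)
  qed

  define C where "C = A * pochhammer (1 + A) n * pochhammer (1 + l - e) n * pochhammer (1 + l - f) n * pochhammer (1 + l - g) n /
    (pochhammer (1 + l) n * pochhammer (1 + A - e) n * pochhammer (1 + A - f) n * pochhammer (1 + A - g) n)"
  have inner: "(\<Sum>k\<in>{j..n}. (A + 2 * of_nat k) * E k * M k j) =
      C * (wp_quot l e j * wp_quot l f j * wp_quot l g j * wp_quot l (- of_nat n) j)" if j: "j \<le> n" for j
  proof -
    define m where "m = n - j"
    define A' where "A' = A + 2 * of_nat j"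
    have n: "n = j + m" using j by (simp add: m_def)
    have bal': "e + f + g = 1 + A + l + of_nat n"
      using bal unfolding l_def by algebra
    have A'I: "A' \<notin> \<int>" unfolding A'_def by (rule not_Ints_shift[OF A, of _ "2 * int j"]) simp
    have A'x: "A' - (x + of_nat j) \<notin> \<int>" if "A - x \<notin> \<int>" for x
      unfolding A'_def by (rule not_Ints_shift[OF that, of _ "int j"]) simp
    have "- (A' - (e + of_nat j) - (f + of_nat j) - (g + of_nat j)) \<notin> \<int>"
      by (rule not_Ints_shift[OF l, of _ "1 + int n + int j"]) (use bal' in \<open>simp add: A'_def algebra_simps\<close>)
    then have D1: "A' - (e + of_nat j) - (f + of_nat j) - (g + of_nat j) \<notin> \<int>"
      using minus_in_Ints_iff by blast
    have D2: "2 * A' - (e + of_nat j) - (f + of_nat j) - (g + of_nat j) \<notin> \<int>"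
    proof (rule not_Ints_shift[OF Al, of _ "-1 - int n + int j"])
      have "2 * A' - (e + of_nat j) - (f + of_nat j) - (g + of_nat j) = 2 * A + of_nat j - (e + f + g)"
        by (simp add: A'_def)
      then show "2 * A' - (e + of_nat j) - (f + of_nat j) - (g + of_nat j) = A - l + of_int (-1 - int n + int j)"
        unfolding bal' by simp
    qed
    \<comment> \<open>Dougall's balance condition for the inner sum, with \<open>A - l\<close> in
      the place of \<open>e\<close>. The balance of the whole series makes it hold for every
      \<open>j\<close>.\<close>
    have D3: "A - l = 1 + 2 * A' - (e + of_nat j) - (f + of_nat j) - (g + of_nat j) + of_nat m"
    proof -
      have "1 + 2 * A' - (e + of_nat j) - (f + of_nat j) - (g + of_nat j) + of_nat m =
         1 + 2 * A + of_nat j + of_nat m - (e + f + g)" by (simp add: A'_def)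
      then show ?thesis unfolding bal' by (simp add: n)
    qed
    have c1: "1 + A' - (x + of_nat j) = 1 + A - x + of_nat j" for x by (simp add: A'_def)
    \<comment> \<open>The closed form of the inner sum contains symbols in
      \<open>1 + A' - x - y\<close>. By the balance they are reversed symbols in
      \<open>1 + l - z\<close>, which is how the parameters relative to \<open>l\<close> enter the
      prefactor.\<close>
    have rfl: "pochhammer (1 + A' - (x + of_nat j) - (y + of_nat j)) m = (-1) ^ m * pochhammer (1 + l - z + of_nat j) m"
      if "x + y + z = e + f + g" for x y z
    proof -
      have 1: "1 + A' - (x + of_nat j) - (y + of_nat j) = - (l - z + of_nat n)"
        using that bal' by (simp add: A'_def algebra_simps)
      have 2: "l - z + of_nat n - of_nat m + 1 = 1 + l - z + of_nat j" by (simp add: n)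
      show ?thesis unfolding 1 pochhammer_minus 2 ..
    qed
    have rfl2: "pochhammer (1 + A' - (e + of_nat j) - (f + of_nat j) - (g + of_nat j)) m =
        (-1) ^ m * pochhammer (1 + l + of_nat (2 * j)) m"
    proof -
      have 1: "1 + A' - (e + of_nat j) - (f + of_nat j) - (g + of_nat j) = - (l + of_nat n + of_nat j)"
        using bal' by (simp add: A'_def algebra_simps)
      have 2: "l + of_nat n + of_nat j - of_nat m + 1 = 1 + l + of_nat (2 * j)" by (simp add: n)
      show ?thesis unfolding 1 pochhammer_minus 2 ..
    qed
    have rfl_f: "pochhammer (1 + A' - (e + of_nat j) - (g + of_nat j)) m = (-1) ^ m * pochhammer (1 + l - f + of_nat j) m"
      by (rule rfl) simp
    have rfl_e: "pochhammer (1 + A' - (f + of_nat j) - (g + of_nat j)) m = (-1) ^ m * pochhammer (1 + l - e + of_nat j) m"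
      by (rule rfl) simp
    have D: "(\<Sum>i\<le>m. vwp_term A' [e + of_nat j, f + of_nat j, g + of_nat j, A - l, - of_nat m] i) *
      (pochhammer (1 + A - e + of_nat j) m * pochhammer (1 + A - f + of_nat j) m * pochhammer (1 + A - g + of_nat j) m *
       ((-1) ^ m * pochhammer (1 + l + of_nat (2 * j)) m)) =
      A' * pochhammer (1 + A') m * ((-1) ^ m * pochhammer (1 + l - g + of_nat j) m) *
       ((-1) ^ m * pochhammer (1 + l - f + of_nat j) m) * ((-1) ^ m * pochhammer (1 + l - e + of_nat j) m)"
      using dougall_7F6[OF A'I A'x[OF Ae] A'x[OF Af] A'x[OF Ag] D1 D2 D3]
      unfolding rfl2 rfl[of e f g, OF HOL.refl] rfl_f rfl_e
      unfolding c1 by (simp only: mult.assoc)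
    have split: "pochhammer z n = pochhammer z j * pochhammer (z + of_nat j) m" for z :: complex
      unfolding n by (rule pochhammer_product')
    have ll: "pochhammer (1 + l) n * pochhammer (1 + l + of_nat n) j =
        pochhammer (1 + l) (2 * j) * pochhammer (1 + l + of_nat (2 * j)) m"
      unfolding pochhammer_product'[symmetric] by (rule arg_cong) (simp add: n)
    have AA: "A * pochhammer (1 + A) n * pochhammer (1 + A + of_nat n) j =
        pochhammer A (2 * j) * (A' * pochhammer (1 + A') m)"
    proof -
      have "A * pochhammer (1 + A) n * pochhammer (1 + A + of_nat n) j = A * pochhammer (A + 1) (n + j)"
        unfolding pochhammer_product' by (simp add: add_ac)
      also have "\<dots> = pochhammer A (2 * j + Suc m)"
        unfolding pochhammer_rec[symmetric] by (rule arg_cong) (simp add: n)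
      also have "\<dots> = pochhammer A (2 * j) * (A' * pochhammer (A' + 1) m)"
        unfolding pochhammer_product' pochhammer_rec by (simp add: A'_def)
      finally show ?thesis by (simp add: add.commute)
    qed
    have trm: "(A + 2 * of_nat (i + j)) * E (i + j) * M (i + j) j =
        E j * (pochhammer A (2 * j) / pochhammer (1 + l) (2 * j)) *
        vwp_term A' [e + of_nat j, f + of_nat j, g + of_nat j, A - l, - of_nat m] i" for i
    proof -
      have 1: "- of_nat n + of_nat j = (- of_nat m :: complex)" by (simp add: n)
      have 2: "E (i + j) = E j * (wp_quot A' (e + of_nat j) i * wp_quot A' (f + of_nat j) i * wp_quot A' (g + of_nat j) i *
          wp_quot A' (- of_nat m) i)"
        unfolding E_def add.commute[of i j] wp_quot_add 1 A'_def by (simp only: mult_ac)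
      have 3: "i + j + j = 2 * j + i" "i + j - j = i" by simp_all
      have 4: "1 + l + of_nat (2 * j) = 1 + A' - (A - l)" "1 = 1 + A' - A'"
        by (simp_all add: A'_def)
      have 5: "M (i + j) j = pochhammer A (2 * j) / pochhammer (1 + l) (2 * j) * (wp_quot A' A' i * wp_quot A' (A - l) i)"
        unfolding M_def 3 pochhammer_product' wp_quot_def pochhammer_fact 4(1)
        using 4(2) by (simp add: A'_def mult_ac)
      have 6: "A + 2 * of_nat (i + j) = A' + 2 * of_nat i" by (simp add: A'_def)
      show ?thesis unfolding 2 5 6 vwp_term_def by simp
    qed
    define P where "P = pochhammer (1 + A - e + of_nat j) m * pochhammer (1 + A - f + of_nat j) m * pochhammer (1 + A - g + of_nat j) m"
    define Q where "Q = pochhammer (1 + l - e + of_nat j) m * pochhammer (1 + l - f + of_nat j) m * pochhammer (1 + l - g + of_nat j) m"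
    have nzj: "pochhammer (x + of_nat j) m \<noteq> 0" if "x \<notin> \<int>" for x :: complex
      by (rule pochhammer_nonzero, rule not_Ints_shift[OF that, of _ "int j"]) simp
    have P0: "P \<noteq> 0" unfolding P_def
      using nzj[OF shift1'[OF Ae]] nzj[OF shift1'[OF Af]] nzj[OF shift1'[OF Ag]] by simp
    have Q0: "Q \<noteq> 0" unfolding Q_def
      using nzj[OF shift1'[OF le]] nzj[OF shift1'[OF lf]] nzj[OF shift1'[OF lg]] by simp
    have L0: "pochhammer (1 + l + of_nat (2 * j)) m \<noteq> 0"
      by (rule pochhammer_nonzero, rule not_Ints_shift[OF shift1[OF l], of _ "2 * int j"]) simp
    have AN0: "pochhammer (1 + A + of_nat n) j \<noteq> 0"
      by (rule pochhammer_nonzero, rule not_Ints_shift[OF shift1[OF A], of _ "int n"]) simp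
    have LN0: "pochhammer (1 + l + of_nat n) j \<noteq> 0"
      by (rule pochhammer_nonzero, rule not_Ints_shift[OF shift1[OF l], of _ "int n"]) simp
    have lj0: "pochhammer (1 + l) (2 * j) \<noteq> 0" "pochhammer (1 + l) n \<noteq> 0"
      by (rule pochhammer_nonzero[OF shift1[OF l]])+
    have sgn: "(-1 :: complex) ^ m * ((-1) ^ m * ((-1) ^ m)) = (-1) ^ m"
      by (metis left_minus_one_mult_self mult.commute)
    have "(\<Sum>i\<le>m. vwp_term A' [e + of_nat j, f + of_nat j, g + of_nat j, A - l, - of_nat m] i) *
       (P * pochhammer (1 + l + of_nat (2 * j)) m) * (-1) ^ m = A' * pochhammer (1 + A') m * Q * (-1) ^ m"
      using D unfolding P_def Q_def by (subst (2) sgn[symmetric]) (simp only: mult_ac)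
    then have Dm: "(\<Sum>i\<le>m. vwp_term A' [e + of_nat j, f + of_nat j, g + of_nat j, A - l, - of_nat m] i) =
       A' * pochhammer (1 + A') m * Q / (P * pochhammer (1 + l + of_nat (2 * j)) m)"
      using P0 L0 by (simp add: field_simps)
    define ej where "ej = pochhammer e j * pochhammer f j * pochhammer g j"
    define Pj where "Pj = pochhammer (1 + A - e) j * pochhammer (1 + A - f) j * pochhammer (1 + A - g) j"
    define Qj where "Qj = pochhammer (1 + l - e) j * pochhammer (1 + l - f) j * pochhammer (1 + l - g) j"
    have Pj0: "Pj \<noteq> 0" and Qj0: "Qj \<noteq> 0" unfolding Pj_def Qj_def
      using pochhammer_nonzero[OF shift1'[OF Ae], of j] pochhammer_nonzero[OF shift1'[OF Af], of j]
        pochhammer_nonzero[OF shift1'[OF Ag], of j] pochhammer_nonzero[OF shift1'[OF le], of j]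
        pochhammer_nonzero[OF shift1'[OF lf], of j] pochhammer_nonzero[OF shift1'[OF lg], of j] by simp_all
    have E1: "E j = ej / Pj * (pochhammer (- of_nat n) j / pochhammer (1 + A + of_nat n) j)"
      by (simp add: E_def ej_def Pj_def wp_quot_def)
    have E2: "wp_quot l e j * wp_quot l f j * wp_quot l g j * wp_quot l (- of_nat n) j =
        ej / Qj * (pochhammer (- of_nat n) j / pochhammer (1 + l + of_nat n) j)"
      by (simp add: ej_def Qj_def wp_quot_def)
    have C1: "C = A * pochhammer (1 + A) n * (Qj * Q) / (pochhammer (1 + l) n * (Pj * P))"
      unfolding C_def P_def Q_def Pj_def Qj_def split[of "1 + A - e"] split[of "1 + A - f"] split[of "1 + A - g"]
        split[of "1 + l - e"] split[of "1 + l - f"] split[of "1 + l - g"] by (simp only: mult_ac)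
    have C2: "C * pochhammer (1 + A + of_nat n) j / pochhammer (1 + l + of_nat n) j =
       pochhammer A (2 * j) * (A' * pochhammer (1 + A') m) * (Qj * Q) /
        (pochhammer (1 + l) (2 * j) * pochhammer (1 + l + of_nat (2 * j)) m * (Pj * P))"
      unfolding C1 AA[symmetric] ll[symmetric] by (simp add: mult_ac)
    have "(\<Sum>k\<in>{j..n}. (A + 2 * of_nat k) * E k * M k j) =
       (\<Sum>i\<le>m. (A + 2 * of_nat (i + j)) * E (i + j) * M (i + j) j)"
      using sum.shift_bounds_cl_nat_ivl[of "\<lambda>k. (A + 2 * of_nat k) * E k * M k j" 0 j m]
      by (simp add: n atMost_atLeast0 add.commute)
    also have "\<dots> = E j * (pochhammer A (2 * j) / pochhammer (1 + l) (2 * j)) *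
        (A' * pochhammer (1 + A') m * Q / (P * pochhammer (1 + l + of_nat (2 * j)) m))"
      unfolding trm sum_distrib_left[symmetric] Dm ..
    also have "\<dots> = ej / Qj * (pochhammer (- of_nat n) j / pochhammer (1 + A + of_nat n) j) *
        (pochhammer A (2 * j) * (A' * pochhammer (1 + A') m) * (Qj * Q) /
        (pochhammer (1 + l) (2 * j) * pochhammer (1 + l + of_nat (2 * j)) m * (Pj * P)))"
      unfolding E1 using Qj0 by (simp add: mult_ac)
    also have "\<dots> = C * (ej / Qj * (pochhammer (- of_nat n) j / pochhammer (1 + l + of_nat n) j))"
      unfolding C2[symmetric] using AN0 by (simp add: mult_ac)
    finally show ?thesis unfolding E2 .
  qed
  have "(\<Sum>k\<le>n. vwp_term A [b, c, d, e, f, g, - of_nat n] k) =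
     (\<Sum>k\<le>n. (A + 2 * of_nat k) * E k * (wp_quot A A k * wp_quot A b k * wp_quot A c k * wp_quot A d k))"
    by (rule sum.cong) (simp_all add: vwp_term_def E_def)
  also have "\<dots> = (\<Sum>k\<le>n. \<Sum>j\<le>k. \<alpha> j * ((A + 2 * of_nat k) * E k * M k j)) / l"
    unfolding expand by (simp add: sum_distrib_left sum_divide_distrib mult_ac)
  also have "(\<Sum>k\<le>n. \<Sum>j\<le>k. \<alpha> j * ((A + 2 * of_nat k) * E k * M k j)) =
     (\<Sum>k\<le>n. \<Sum>j | j \<in> {..n} \<and> j \<le> k. \<alpha> j * ((A + 2 * of_nat k) * E k * M k j))"
    by (intro sum.cong) auto
  also have "\<dots> = (\<Sum>j\<le>n. \<Sum>k | k \<in> {..n} \<and> j \<le> k. \<alpha> j * ((A + 2 * of_nat k) * E k * M k j))"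
    by (rule sum.swap_restrict) auto
  also have "\<dots> = (\<Sum>j\<le>n. \<alpha> j * (\<Sum>k\<in>{j..n}. (A + 2 * of_nat k) * E k * M k j))"
    unfolding sum_distrib_left by (intro sum.cong) auto
  also have "\<dots> = (\<Sum>j\<le>n. C * vwp_term l [l + b - A, l + c - A, l + d - A, e, f, g, - of_nat n] j)"
    by (intro sum.cong) (simp_all add: inner \<alpha>_def vwp_term_def)
  finally show ?thesis
    unfolding sum_distrib_left[symmetric] C_def using nz by (simp add: mult_ac)
qed

section \<open>Asymptotics of Gamma quotients\<close>

text \<open>\<open>\<Gamma>(z + n)\<close> divided by its leading behaviour. The base of the power
  is \<open>n + 1\<close> and not \<open>n\<close>, so that it is nonzero for every
  \<open>n\<close>.\<close>

definition Gamma_normal :: "complex \<Rightarrow> nat \<Rightarrow> complex" where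
  "Gamma_normal z n = Gamma (z + of_nat n) / (fact n * of_nat (Suc n) powr (z - 1))"

lemma Gamma_eq_Gamma_normal: "Gamma (z + of_nat n) = fact n * of_nat (Suc n) powr (z - 1) * Gamma_normal z n"
  by (simp add: Gamma_normal_def del: of_nat_Suc)

lemma tendsto_Suc_over_add:
  fixes z :: complex
  shows "(\<lambda>n. of_nat (Suc n) / (z + of_nat n)) \<longlonglongrightarrow> 1"
proof -
  have "(\<lambda>n. (z - 1) * inverse (of_nat (Suc n))) \<longlonglongrightarrow> (z - 1) * 0"
    by (rule tendsto_mult[OF tendsto_const LIMSEQ_Suc[OF lim_inverse_n]])
  then have "(\<lambda>n. inverse (1 + (z - 1) * inverse (of_nat (Suc n)))) \<longlonglongrightarrow> inverse (1 + (z - 1) * 0)"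
    by (rule tendsto_inverse[OF tendsto_add[OF tendsto_const]]) simp_all
  moreover have "inverse (1 + (z - 1) * inverse (of_nat (Suc n))) = of_nat (Suc n) / (z + of_nat n)" for n
  proof -
    have "1 + (z - 1) * inverse (of_nat (Suc n)) = (z + of_nat n) / of_nat (Suc n)"
      using of_nat_neq_0[of n, where ?'a = complex] by (simp add: field_simps)
    then show ?thesis by simp
  qed
  ultimately show ?thesis by simp
qed

lemma add_of_nat_not_nonpos_Ints:
  fixes z :: complex
  assumes "z \<notin> \<int>\<^sub>\<le>\<^sub>0"
  shows "z + of_nat n \<notin> \<int>\<^sub>\<le>\<^sub>0" "z + of_nat n \<noteq> 0"
proof -
  show "z + of_nat n \<notin> \<int>\<^sub>\<le>\<^sub>0"
    using assms nonpos_Ints_diff_Nats[of "z + of_nat n" "of_nat n"] by auto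
  then show "z + of_nat n \<noteq> 0" by auto
qed

text \<open>Euler's limit formula for \<open>1 / \<Gamma>(z)\<close> at index \<open>n + 1\<close>,
  together with two surplus quotients \<open>(n + 1) / (z + n)\<close> and
  \<open>(n + 1) / (z + 1 + n)\<close> that tend to 1.\<close>

lemma Gamma_normal_tendsto_1:
  assumes z: "z \<notin> \<int>\<^sub>\<le>\<^sub>0"
  shows "Gamma_normal z \<longlonglongrightarrow> 1"
proof -
  have G: "Gamma z \<noteq> 0" using assms by (simp add: Gamma_eq_zero_iff)
  have "(\<lambda>n. rGamma_series z (Suc n) * Gamma z) \<longlonglongrightarrow> rGamma z * Gamma z"
    by (intro tendsto_mult tendsto_const LIMSEQ_Suc[OF rGamma_series_LIMSEQ])
  then have "(\<lambda>n. rGamma_series z (Suc n) * Gamma z) \<longlonglongrightarrow> 1"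
    using G by (simp add: rGamma_inverse_Gamma)
  then have lim: "(\<lambda>n. rGamma_series z (Suc n) * Gamma z * (of_nat (Suc n) / (z + of_nat n)) *
       (of_nat (Suc n) / (z + 1 + of_nat n))) \<longlonglongrightarrow> 1 * 1 * 1"
    by (intro tendsto_mult tendsto_Suc_over_add)
  have "rGamma_series z (Suc n) * Gamma z * (of_nat (Suc n) / (z + of_nat n)) *
       (of_nat (Suc n) / (z + 1 + of_nat n)) = Gamma_normal z n" for n
  proof -
    define u where "u = (of_nat (Suc n) :: complex)"
    have u: "u \<noteq> 0" unfolding u_def by (rule of_nat_neq_0)
    have nz: "z + of_nat n \<noteq> 0" "z + 1 + of_nat n \<noteq> 0"
      using add_of_nat_not_nonpos_Ints(2)[OF z, of n] add_of_nat_not_nonpos_Ints(2)[OF z, of "Suc n"]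
      by (simp_all add: algebra_simps)
    have "pochhammer z (Suc n + 1) * Gamma z = Gamma (z + of_nat n) * (z + of_nat n) * (z + 1 + of_nat n)"
    proof -
      have "pochhammer z n * Gamma z = Gamma (z + of_nat n)"
        using pochhammer_Gamma[OF z, of n] G by simp
      moreover have "pochhammer z (Suc n + 1) * Gamma z = pochhammer z n * Gamma z * (z + of_nat n) * (z + 1 + of_nat n)"
        by (simp add: pochhammer_Suc algebra_simps)
      ultimately show ?thesis by simp
    qed
    moreover have "exp (z * of_real (ln (of_nat (Suc n)))) = u * u powr (z - 1)"
    proof -
      have "u powr z = u powr 1 * u powr (z - 1)" by (subst powr_add[symmetric]) simp
      moreover have "u powr z = exp (z * of_real (ln (of_nat (Suc n))))"
        using u unfolding powr_def u_def by (subst Ln_of_nat) simp_all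
      ultimately show ?thesis using u by simp
    qed
    ultimately have "rGamma_series z (Suc n) * Gamma z =
       Gamma (z + of_nat n) * (z + of_nat n) * (z + 1 + of_nat n) / (u * fact n * (u * u powr (z - 1)))"
      unfolding rGamma_series_def u_def by (simp add: del: of_nat_Suc)
    then show ?thesis unfolding Gamma_normal_def u_def[symmetric] using u nz by simp
  qed
  then show ?thesis using lim by simp
qed

text \<open>The term of the 4F3 series multiplied by \<open>\<Gamma>(a) \<Gamma>(b) \<Gamma>(c)
  \<Gamma>(d) / (\<Gamma>(e) \<Gamma>(f) \<Gamma>(g))\<close>. In this normalisation the constant in
  the asymptotics of the terms is 1 for all parameters.\<close>

definition Phi_term :: "complex \<Rightarrow> complex \<Rightarrow> complex \<Rightarrow> complex \<Rightarrow> complex \<Rightarrow> complex \<Rightarrow> complex \<Rightarrow> nat \<Rightarrow> complex" where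
  "Phi_term a b c d e f g n = Gamma (a + of_nat n) * Gamma (b + of_nat n) * Gamma (c + of_nat n) * Gamma (d + of_nat n) /
     (fact n * Gamma (e + of_nat n) * Gamma (f + of_nat n) * Gamma (g + of_nat n))"

lemma Gamma_ratio_eq:
  fixes a1 a2 a3 a4 b1 b2 b3 b4 :: complex
  shows "Gamma (a1 + of_nat n) * Gamma (a2 + of_nat n) * Gamma (a3 + of_nat n) * Gamma (a4 + of_nat n) /
     (Gamma (b1 + of_nat n) * Gamma (b2 + of_nat n) * Gamma (b3 + of_nat n) * Gamma (b4 + of_nat n)) =
    of_nat (Suc n) powr (a1 + a2 + a3 + a4 - b1 - b2 - b3 - b4) *
     (Gamma_normal a1 n * Gamma_normal a2 n * Gamma_normal a3 n * Gamma_normal a4 n / (Gamma_normal b1 n * Gamma_normal b2 n * Gamma_normal b3 n * Gamma_normal b4 n))"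
proof -
  define u where "u = (of_nat (Suc n) :: complex)"
  have u: "u \<noteq> 0" unfolding u_def by (rule of_nat_neq_0)
  define F where "F = (fact n :: complex)"
  have F: "F \<noteq> 0" by (simp add: F_def)
  have powers: "u powr (a1 - 1) * u powr (a2 - 1) * u powr (a3 - 1) * u powr (a4 - 1) =
      u powr (a1 + a2 + a3 + a4 - b1 - b2 - b3 - b4) *
      (u powr (b1 - 1) * u powr (b2 - 1) * u powr (b3 - 1) * u powr (b4 - 1))"
    unfolding powr_add[symmetric] by (rule arg_cong) simp
  have "(F * p1 * g1) * (F * p2 * g2) * (F * p3 * g3) * (F * p4 * g4) / ((F * q1 * h1) * (F * q2 * h2) * (F * q3 * h3) * (F * q4 * h4)) =
     S * (g1 * g2 * g3 * g4 / (h1 * h2 * h3 * h4))"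
    if "p1 * p2 * p3 * p4 = S * (q1 * q2 * q3 * q4)" "q1 \<noteq> 0" "q2 \<noteq> 0" "q3 \<noteq> 0" "q4 \<noteq> 0"
    for p1 p2 p3 p4 q1 q2 q3 q4 g1 g2 g3 g4 h1 h2 h3 h4 S
  proof -
    have 1: "(F * p1 * g1) * (F * p2 * g2) * (F * p3 * g3) * (F * p4 * g4) = (F ^ 4 * (p1 * p2 * p3 * p4)) * (g1 * g2 * g3 * g4)"
      by (simp add: power4_eq_xxxx mult_ac)
    have 2: "(F * q1 * h1) * (F * q2 * h2) * (F * q3 * h3) * (F * q4 * h4) = (F ^ 4 * (q1 * q2 * q3 * q4)) * (h1 * h2 * h3 * h4)"
      by (simp add: power4_eq_xxxx mult_ac)
    show ?thesis unfolding 1 2 that(1) using that(2-5) F by (simp add: mult_ac)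
  qed
  from this[OF powers] u show ?thesis
    unfolding Gamma_eq_Gamma_normal u_def[symmetric] F_def[symmetric] by simp
qed

lemma Gamma_ratio_tendsto_1:
  fixes a1 a2 a3 a4 b1 b2 b3 b4 :: complex
  assumes sum: "a1 + a2 + a3 + a4 = b1 + b2 + b3 + b4"
    and "a1 \<notin> \<int>\<^sub>\<le>\<^sub>0" "a2 \<notin> \<int>\<^sub>\<le>\<^sub>0" "a3 \<notin> \<int>\<^sub>\<le>\<^sub>0" "a4 \<notin> \<int>\<^sub>\<le>\<^sub>0"
      "b1 \<notin> \<int>\<^sub>\<le>\<^sub>0" "b2 \<notin> \<int>\<^sub>\<le>\<^sub>0" "b3 \<notin> \<int>\<^sub>\<le>\<^sub>0" "b4 \<notin> \<int>\<^sub>\<le>\<^sub>0"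
  shows "(\<lambda>n. Gamma (a1 + of_nat n) * Gamma (a2 + of_nat n) * Gamma (a3 + of_nat n) * Gamma (a4 + of_nat n) /
     (Gamma (b1 + of_nat n) * Gamma (b2 + of_nat n) * Gamma (b3 + of_nat n) * Gamma (b4 + of_nat n))) \<longlonglongrightarrow> 1"
proof -
  have s: "a1 + a2 + a3 + a4 - b1 - b2 - b3 - b4 = 0" using sum by simp
  have "(\<lambda>n. Gamma_normal a1 n * Gamma_normal a2 n * Gamma_normal a3 n * Gamma_normal a4 n / (Gamma_normal b1 n * Gamma_normal b2 n * Gamma_normal b3 n * Gamma_normal b4 n)) \<longlonglongrightarrow>
     1 * 1 * 1 * 1 / (1 * 1 * 1 * 1)"
    by (intro tendsto_divide tendsto_mult Gamma_normal_tendsto_1 assms) simp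
  then show ?thesis unfolding Gamma_ratio_eq s using of_nat_neq_0[where ?'a = complex] by (simp del: of_nat_Suc)
qed

text \<open>The balance makes the total exponent of \<open>n + 1\<close> equal to
  \<open>-2\<close>.\<close>

lemma Phi_term_asymp:
  assumes bal: "e + f + g - a - b - c - d = 1"
    and "a \<notin> \<int>\<^sub>\<le>\<^sub>0" "b \<notin> \<int>\<^sub>\<le>\<^sub>0" "c \<notin> \<int>\<^sub>\<le>\<^sub>0" "d \<notin> \<int>\<^sub>\<le>\<^sub>0" "e \<notin> \<int>\<^sub>\<le>\<^sub>0" "f \<notin> \<int>\<^sub>\<le>\<^sub>0" "g \<notin> \<int>\<^sub>\<le>\<^sub>0"
  shows "(\<lambda>n. of_nat (Suc n) ^ 2 * Phi_term a b c d e f g n) \<longlonglongrightarrow> 1"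
proof -
  have "of_nat (Suc n) ^ 2 * Phi_term a b c d e f g n =
    Gamma_normal a n * Gamma_normal b n * Gamma_normal c n * Gamma_normal d n / (Gamma_normal 1 n * Gamma_normal e n * Gamma_normal f n * Gamma_normal g n)" for n
  proof -
    have s: "a + b + c + d - 1 - e - f - g = - 2" using bal by (simp add: algebra_simps)
    have p: "of_nat (Suc n) ^ 2 * (of_nat (Suc n) powr (- 2) * x) = x" for x :: complex
      using of_nat_neq_0[of n, where ?'a = complex] by (simp add: powr_minus powr_numeral del: of_nat_Suc)
    have F: "fact n = (Gamma (1 + of_nat n) :: complex)" by (simp add: Gamma_fact)
    show ?thesis unfolding Phi_term_def F Gamma_ratio_eq s p ..
  qed
  moreover have "(\<lambda>n. Gamma_normal a n * Gamma_normal b n * Gamma_normal c n * Gamma_normal d n / (Gamma_normal 1 n * Gamma_normal e n * Gamma_normal f n * Gamma_normal g n)) \<longlonglongrightarrow>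
     1 * 1 * 1 * 1 / (1 * 1 * 1 * 1)"
    by (intro tendsto_divide tendsto_mult Gamma_normal_tendsto_1 assms) simp_all
  ultimately show ?thesis by simp
qed

section \<open>Sequences of quadratic decay and their convolutions\<close>

lemma inverse_Suc_squares_summable: "summable (\<lambda>k. C / real (Suc k) ^ 2)"
proof -
  have "summable (\<lambda>k. inverse (real k ^ 2))"
    using inverse_power_summable[of 2, where ?'a = real] by simp
  then have "summable (\<lambda>k. inverse (real (Suc k) ^ 2))"
    by (subst summable_Suc_iff)
  then show ?thesis using summable_mult[of _ C] by (simp add: divide_inverse)
qed

lemma square_decay_bound:
  fixes x :: "nat \<Rightarrow> complex"
  assumes "(\<lambda>n. of_nat (Suc n) ^ 2 * x n) \<longlonglongrightarrow> L"
  obtains C where "C > 0" "\<And>n. norm (x n) \<le> C / real (Suc n) ^ 2"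
proof -
  obtain C where C: "C > 0" "\<And>n. norm (of_nat (Suc n) ^ 2 * x n) \<le> C"
    using BseqE[OF convergent_imp_Bseq[OF convergentI[OF assms]]] by blast
  have "norm (x n) \<le> C / real (Suc n) ^ 2" for n
    using C(2)[of n] by (simp add: norm_mult norm_power field_simps del: of_nat_Suc)
  then show ?thesis using that C(1) by blast
qed

lemma square_decay_summable:
  fixes x :: "nat \<Rightarrow> complex"
  assumes "(\<lambda>n. of_nat (Suc n) ^ 2 * x n) \<longlonglongrightarrow> L"
  shows "summable x"
proof -
  obtain C where "\<And>n. norm (x n) \<le> C / real (Suc n) ^ 2" using square_decay_bound[OF assms] by blast
  then show ?thesis using summable_comparison_test[OF _ inverse_Suc_squares_summable[of C], of x] by blast
qed

text \<open>For \<open>2 * k \<le> n\<close> the factor \<open>y (n - k)\<close> is of the exact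
  order \<open>(n + 1) ^ -2\<close>, uniformly up to a constant:
  \<open>n + 1 \<le> 2 * (n - k + 1)\<close>. After multiplication by \<open>(n + 1) ^ 2\<close> it
  is bounded and tends to 1 for fixed \<open>k\<close>, so Tannery's theorem leaves the sum of
  \<open>x\<close>, weighted by the limit \<open>w\<close>.\<close>

lemma half_convolution_limit:
  fixes x y :: "nat \<Rightarrow> complex" and v :: "nat \<Rightarrow> nat \<Rightarrow> complex"
  assumes x: "(\<lambda>n. of_nat (Suc n) ^ 2 * x n) \<longlonglongrightarrow> L"
    and y: "(\<lambda>n. of_nat (Suc n) ^ 2 * y n) \<longlonglongrightarrow> 1"
    and v: "\<And>k. (\<lambda>n. v n k) \<longlonglongrightarrow> w" and W: "\<And>n k. 2 * k \<le> n \<Longrightarrow> norm (v n k) \<le> W"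
  shows "(\<lambda>n. of_nat (Suc n) ^ 2 * (\<Sum>k | 2 * k \<le> n. v n k * x k * y (n - k))) \<longlonglongrightarrow> w * suminf x"
proof -
  obtain C where C: "C > 0" "\<And>n. norm (x n) \<le> C / real (Suc n) ^ 2" using square_decay_bound[OF x] by blast
  obtain D where D: "D > 0" "\<And>n. norm (y n) \<le> D / real (Suc n) ^ 2" using square_decay_bound[OF y] by blast
  define a where "a k n = (if 2 * k \<le> n then of_nat (Suc n) ^ 2 * (v n k * x k * y (n - k)) else 0)" for k n
  have W0: "W \<ge> 0" using order_trans[OF norm_ge_zero W[of 0 0]] by simp
  have limit: "(\<lambda>n. a k n) \<longlonglongrightarrow> w * x k" for k
  proof -
    have 1: "(\<lambda>n. (of_nat (Suc n) / (of_nat n + (1 - of_nat k))) ^ 2 * (of_nat (Suc (n - k)) ^ 2 * y (n - k)))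
       \<longlonglongrightarrow> 1 ^ 2 * (1 :: complex)"
    proof -
      have 1: "(\<lambda>n. of_nat (Suc n) / (of_nat n + (1 - of_nat k))) \<longlonglongrightarrow> (1 :: complex)"
        using tendsto_Suc_over_add[of "1 - of_nat k"] by (simp only: add.commute)
      have 2: "(\<lambda>n. of_nat (Suc (n - k)) ^ 2 * y (n - k)) \<longlonglongrightarrow> 1"
        by (rule filterlim_compose[OF y filterlim_minus_const_nat_at_top])
      show ?thesis by (rule tendsto_mult[OF tendsto_power[OF 1] 2])
    qed
    have 2: "(\<lambda>n. v n k * x k * ((of_nat (Suc n) / (of_nat n + (1 - of_nat k))) ^ 2 * (of_nat (Suc (n - k)) ^ 2 * y (n - k))))
       \<longlonglongrightarrow> w * x k * (1 ^ 2 * 1)"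
      by (rule tendsto_mult[OF tendsto_mult[OF v tendsto_const] 1])
    have "\<forall>\<^sub>F n in sequentially. v n k * x k * ((of_nat (Suc n) / (of_nat n + (1 - of_nat k))) ^ 2 *
       (of_nat (Suc (n - k)) ^ 2 * y (n - k))) = a k n"
      using eventually_ge_at_top[of "2 * k"]
    proof eventually_elim
      case (elim n)
      then have "of_nat (Suc (n - k)) = of_nat n + (1 - of_nat k :: complex)" by (simp add: of_nat_diff)
      then show ?case using elim of_nat_neq_0[of "n - k", where ?'a = complex]
        by (simp add: a_def power_divide del: of_nat_Suc)
    qed
    then show ?thesis using 2 by (simp add: tendsto_cong)
  qed
  define M where "M k = 4 * W * C * D / real (Suc k) ^ 2" for k
  have bd: "norm (a k n) \<le> M k" for k n
  proof (cases "2 * k \<le> n")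
    case True
    have r: "real (Suc n) ^ 2 \<le> 4 * real (Suc (n - k)) ^ 2"
    proof -
      have "real (Suc n) \<le> 2 * real (Suc (n - k))" using True by (simp add: of_nat_diff)
      then have "real (Suc n) ^ 2 \<le> (2 * real (Suc (n - k))) ^ 2" by (intro power_mono) auto
      then show ?thesis by (simp add: power_mult_distrib del: of_nat_Suc)
    qed
    have "norm (a k n) = real (Suc n) ^ 2 * (norm (v n k) * norm (x k) * norm (y (n - k)))"
      using True by (simp add: a_def norm_mult norm_power del: of_nat_Suc)
    also have "\<dots> \<le> real (Suc n) ^ 2 * (W * (C / real (Suc k) ^ 2) * (D / real (Suc (n - k)) ^ 2))"
      by (intro mult_left_mono mult_mono W True C D mult_nonneg_nonneg W0) (use C(1) in auto)
    also have "\<dots> = (real (Suc n) ^ 2 / real (Suc (n - k)) ^ 2) * (W * C * D / real (Suc k) ^ 2)"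
      by simp
    also have "\<dots> \<le> 4 * (W * C * D / real (Suc k) ^ 2)"
      by (intro mult_right_mono) (use r W0 C(1) D(1) in \<open>auto simp: divide_simps simp del: of_nat_Suc\<close>)
    finally show ?thesis by (simp add: M_def)
  next
    case False
    then show ?thesis using W0 C(1) D(1) by (simp add: a_def M_def)
  qed
  have "(\<lambda>n. \<Sum>k. a k n) \<longlonglongrightarrow> (\<Sum>k. w * x k)"
  proof -
    have "summable M" unfolding M_def by (rule inverse_Suc_squares_summable)
    moreover have "\<forall>\<^sub>F (k, n) in sequentially \<times>\<^sub>F sequentially. norm (a k n) \<le> M k"
      by (rule always_eventually) (use bd in auto)
    ultimately show ?thesis using tannerys_theorem[of a "\<lambda>k. w * x k" sequentially M] limit by simp
  qed
  moreover have "(\<Sum>k. a k n) = of_nat (Suc n) ^ 2 * (\<Sum>k | 2 * k \<le> n. v n k * x k * y (n - k))" for n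
  proof -
    have fin: "finite {k. 2 * k \<le> n}" by (rule finite_subset[of _ "{..n}"]) auto
    have "(\<Sum>k. a k n) = (\<Sum>k | 2 * k \<le> n. a k n)"
      by (rule suminf_finite[OF fin]) (simp add: a_def)
    then show ?thesis by (simp add: a_def sum_distrib_left)
  qed
  moreover have "(\<Sum>k. w * x k) = w * suminf x"
    using square_decay_summable[OF x] by (rule suminf_mult)
  ultimately show ?thesis by simp
qed

section \<open>The four-term relation between two pairs of balanced series\<close>

lemma pochhammer_reflect_Gamma:
  fixes z :: complex
  assumes "z \<notin> \<int>\<^sub>\<le>\<^sub>0" "k \<le> n"
  shows "pochhammer (1 - z - of_nat n) k = (-1) ^ k * (Gamma (z + of_nat n) / Gamma (z + of_nat (n - k)))"
proof -
  have 1: "1 - z - of_nat n = - (z + of_nat n - 1)" by simp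
  have 2: "z + of_nat n - 1 - of_nat k + 1 = z + of_nat (n - k)" using assms(2) by (simp add: of_nat_diff)
  have 3: "z + of_nat (n - k) + of_nat k = z + of_nat n" using assms(2) by (simp add: of_nat_diff)
  show ?thesis unfolding 1 pochhammer_minus 2
    pochhammer_Gamma[OF add_of_nat_not_nonpos_Ints(1)[OF assms(1)]] 3 ..
qed

lemma not_Ints_not_nonpos_Ints: "z \<notin> \<int> \<Longrightarrow> z \<notin> \<int>\<^sub>\<le>\<^sub>0" for z :: complex
  using nonpos_Ints_Int by blast

lemma Gamma_nonzero': "z \<notin> \<int> \<Longrightarrow> Gamma z \<noteq> 0" for z :: complex
  using not_Ints_not_nonpos_Ints Gamma_eq_zero_iff by blast

text \<open>
  The parameters \<open>A\<close>, \<open>-n + e - f\<close>, \<open>-n + e - g\<close> and \<open>-n\<close> tend to infinity with \<open>n\<close>. Reversing the factors with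
  large parameters exhibits the terms of two balanced series, one starting at \<open>k = 0\<close> and one at \<open>k = n\<close>;
  the factor \<open>(A + 2k)/A\<close> tends to 1 at the former end and to -1 at the latter.
\<close>

lemma vwp_term_eq_convolution:
  fixes p1 p2 p3 p4 e f g :: complex and n k :: nat
  defines "A \<equiv> - of_nat n - 1 + e"
  assumes k: "k \<le> n" and e: "e \<notin> \<int>" and f: "f \<notin> \<int>" and g: "g \<notin> \<int>"
    and p1: "p1 \<notin> \<int>" and p2: "p2 \<notin> \<int>" and p3: "p3 \<notin> \<int>" and p4: "p4 \<notin> \<int>"
    and ep1: "e - p1 \<notin> \<int>" and ep2: "e - p2 \<notin> \<int>" and ep3: "e - p3 \<notin> \<int>" and ep4: "e - p4 \<notin> \<int>"
    and fe: "f - e \<notin> \<int>" and ge: "g - e \<notin> \<int>"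
  shows "vwp_term A [p1, p2, - of_nat n + e - f, p3, p4, - of_nat n + e - g, - of_nat n] k / A =
    Gamma e * Gamma f * Gamma g / (Gamma p1 * Gamma p2 * Gamma p3 * Gamma p4) *
    (((A + 2 * of_nat k) / A) * Phi_term p1 p2 p3 p4 e f g k *
       Phi_term (1 + p1 - e) (1 + p2 - e) (1 + p3 - e) (1 + p4 - e) (2 - e) (1 + f - e) (1 + g - e) (n - k)) /
    Phi_term (1 + p1 - e) (1 + p2 - e) (1 + p3 - e) (1 + p4 - e) (2 - e) (1 + f - e) (1 + g - e) n"
proof -
  define s where "s = ((-1) ^ k :: complex)"
  define m where "m = n - k"
  have s: "s * s = 1" by (simp add: s_def flip: power_add)
  have si: "x / (s * y) = s * (x / y)" for x y
  proof -
    have "inverse s = s" using s by (rule inverse_unique)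
    then show ?thesis by (simp add: divide_inverse mult_ac)
  qed
  have ne: "2 - e \<notin> \<int>" "1 + f - e \<notin> \<int>" "1 + g - e \<notin> \<int>"
  proof -
    have "- e \<notin> \<int>" using e minus_in_Ints_iff by blast
    then show "2 - e \<notin> \<int>" by (rule not_Ints_shift[of _ _ 2]) simp
  qed (rule not_Ints_shift[OF fe, of _ 1] not_Ints_shift[OF ge, of _ 1], simp)+
  have np: "1 + p - e \<notin> \<int>" if "e - p \<notin> \<int>" for p
  proof -
    have "- (e - p) \<notin> \<int>" using that minus_in_Ints_iff by blast
    then show ?thesis by (rule not_Ints_shift[of _ _ 1]) simp
  qed
  note N = not_Ints_not_nonpos_Ints
  have w0: "wp_quot A A k = s * (Gamma (2 - e + of_nat n) / (Gamma (2 - e + of_nat m) * fact k))"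
  proof -
    have 1: "A = 1 - (2 - e) - of_nat n" by (simp add: A_def)
    have "wp_quot A A k = pochhammer A k / fact k" by (simp add: wp_quot_def pochhammer_fact)
    then show ?thesis
      using pochhammer_reflect_Gamma[OF N[OF ne(1)] k] unfolding 1[symmetric] s_def m_def by simp
  qed
  have wpp: "wp_quot A p k = s * (Gamma (p + of_nat k) / Gamma p * (Gamma (1 + p - e + of_nat m) / Gamma (1 + p - e + of_nat n)))"
    if "p \<notin> \<int>" "e - p \<notin> \<int>" for p
  proof -
    have 1: "1 + A - p = 1 - (1 + p - e) - of_nat n" by (simp add: A_def)
    show ?thesis unfolding wp_quot_def 1 pochhammer_reflect_Gamma[OF N[OF np[OF that(2)]] k]
        pochhammer_Gamma[OF N[OF that(1)]] s_def[symmetric] m_def[symmetric]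
      unfolding si by simp
  qed
  have wpf: "wp_quot A (- of_nat n + e - f) k = s * (Gamma (1 + f - e + of_nat n) / Gamma (1 + f - e + of_nat m) * (Gamma f / Gamma (f + of_nat k)))"
    if "f \<notin> \<int>" "1 + f - e \<notin> \<int>" for f
  proof -
    have 1: "1 + A - (- of_nat n + e - f) = f" by (simp add: A_def)
    have 2: "- of_nat n + e - f = 1 - (1 + f - e) - of_nat n" by simp
    show ?thesis unfolding wp_quot_def 1 unfolding 2 pochhammer_reflect_Gamma[OF N[OF that(2)] k]
        pochhammer_Gamma[OF N[OF that(1)]] s_def[symmetric] m_def[symmetric]
      by simp
  qed
  have wn: "wp_quot A (- of_nat n) k = s * (fact n / fact m * (Gamma e / Gamma (e + of_nat k)))"
  proof -
    have 1: "1 + A - (- of_nat n) = e" by (simp add: A_def)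
    have 2: "- of_nat n = 1 - 1 - (of_nat n :: complex)" by simp
    have 3: "1 \<notin> (\<int>\<^sub>\<le>\<^sub>0 :: complex set)" by simp
    have 4: "Gamma (1 + of_nat j) = (fact j :: complex)" for j by (simp add: Gamma_fact add.commute)
    show ?thesis unfolding wp_quot_def 1 unfolding 2 pochhammer_reflect_Gamma[OF 3 k]
        pochhammer_Gamma[OF N[OF e]] s_def[symmetric] m_def[symmetric] 4
      by simp
  qed
  \<comment> \<open>Eight reversals occur, one for \<open>A\<close> and one for each of the seven
    parameters, so the signs \<open>(-1) ^ k\<close> cancel.\<close>
  have s8: "s * x0 * ((s * x1) * ((s * x2) * ((s * x3) * ((s * x4) * ((s * x5) * ((s * x6) * (s * x7))))))) =
      x0 * (x1 * (x2 * (x3 * (x4 * (x5 * (x6 * x7))))))" for x0 x1 x2 x3 x4 x5 x6 x7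
  proof -
    have "s * x0 * ((s * x1) * ((s * x2) * ((s * x3) * ((s * x4) * ((s * x5) * ((s * x6) * (s * x7))))))) =
      (s * s) * (s * s) * (s * s) * (s * s) * (x0 * (x1 * (x2 * (x3 * (x4 * (x5 * (x6 * x7)))))))"
      by (simp only: mult_ac)
    then show ?thesis unfolding s by simp
  qed
  have vw: "vwp_term A [p1, p2, - of_nat n + e - f, p3, p4, - of_nat n + e - g, - of_nat n] k =
      (A + 2 * of_nat k) * (wp_quot A A k * (wp_quot A p1 k * (wp_quot A p2 k * (wp_quot A (- of_nat n + e - f) k * (wp_quot A p3 k * (wp_quot A p4 k *
       (wp_quot A (- of_nat n + e - g) k * wp_quot A (- of_nat n) k)))))))"
    by (simp add: vwp_term_def)
  show ?thesis
    unfolding vw w0 wpp[OF p1 ep1] wpp[OF p2 ep2] wpp[OF p3 ep3] wpp[OF p4 ep4] wpf[OF f ne(2)] wpf[OF g ne(3)] wn s8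
      Phi_term_def m_def[symmetric]
    by (simp add: mult_ac)
qed

lemma vwp_weight_limits:
  fixes e :: complex
  assumes e: "e \<notin> \<int>"
  defines "A n \<equiv> - of_nat n - 1 + e"
  shows "(\<lambda>n. (A n + 2 * of_nat k) / A n) \<longlonglongrightarrow> 1"
    and "(\<lambda>n. (A n + 2 * of_nat (n - k)) / A n) \<longlonglongrightarrow> -1"
    and "\<exists>W. \<forall>n k. k \<le> n \<longrightarrow> norm ((A n + 2 * of_nat k) / A n) \<le> W"
proof -
  have A0: "A n \<noteq> 0" for n
  proof -
    have "A n \<notin> \<int>" unfolding A_def by (rule not_Ints_shift[OF e, of _ "- int n - 1"]) simp
    then show ?thesis by auto
  qed
  have nA: "(\<lambda>n. of_nat n / A n) \<longlonglongrightarrow> -1"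
  proof -
    have 1: "(\<lambda>n. of_nat (Suc n) / ((1 - e) + of_nat n)) \<longlonglongrightarrow> 1"
      by (rule tendsto_Suc_over_add)
    have 2: "(\<lambda>n. of_nat n / of_nat (Suc n) :: complex) \<longlonglongrightarrow> 1"
      by (rule LIMSEQ_n_over_Suc_n)
    have "(\<lambda>n. - (of_nat n / of_nat (Suc n) * (of_nat (Suc n) / ((1 - e) + of_nat n)))) \<longlonglongrightarrow> - (1 * 1)"
      by (rule tendsto_minus[OF tendsto_mult[OF 2 1]])
    moreover have "- (of_nat n / of_nat (Suc n) * (of_nat (Suc n) / ((1 - e) + of_nat n))) = of_nat n / A n" for n
    proof -
      have A: "A n = - ((1 - e) + of_nat n)" by (simp add: A_def)
      have "of_nat n / of_nat (Suc n) * (of_nat (Suc n) / z) = of_nat n / z" for z :: complex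
        using of_nat_neq_0[of n, where ?'a = complex] by (simp del: of_nat_Suc)
      then show ?thesis unfolding A by (simp only: divide_minus_right)
    qed
    ultimately show ?thesis by simp
  qed
  have kA: "(\<lambda>n. of_nat k / A n) \<longlonglongrightarrow> 0" for k
  proof -
    have "(\<lambda>n. of_nat k * (of_nat n / A n * inverse (of_nat n))) \<longlonglongrightarrow> of_nat k * (-1 * 0)"
      by (intro tendsto_mult tendsto_const nA lim_inverse_n)
    moreover have "\<forall>\<^sub>F n in sequentially. of_nat k * (of_nat n / A n * inverse (of_nat n)) = of_nat k / A n"
      using eventually_gt_at_top[of 0] by eventually_elim simp
    ultimately have "(\<lambda>n. of_nat k / A n) \<longlonglongrightarrow> of_nat k * (-1 * 0)"
      by (rule Lim_transform_eventually)
    then show ?thesis by simp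
  qed
  have "(\<lambda>n. 1 + 2 * (of_nat k / A n)) \<longlonglongrightarrow> 1 + 2 * 0"
    by (intro tendsto_intros kA)
  then show "(\<lambda>n. (A n + 2 * of_nat k) / A n) \<longlonglongrightarrow> 1"
    using A0 by (simp add: add_divide_distrib)
  have "(\<lambda>n. 1 + 2 * (of_nat n / A n) - 2 * (of_nat k / A n)) \<longlonglongrightarrow> 1 + 2 * (-1) - 2 * 0"
    by (intro tendsto_intros kA nA)
  then have *: "(\<lambda>n. 1 + 2 * (of_nat n / A n) - 2 * (of_nat k / A n)) \<longlonglongrightarrow> -1" by simp
  have "\<forall>\<^sub>F n in sequentially. 1 + 2 * (of_nat n / A n) - 2 * (of_nat k / A n) = (A n + 2 * of_nat (n - k)) / A n"
    using eventually_ge_at_top[of k]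
    by eventually_elim (use A0 in \<open>simp add: of_nat_diff add_divide_distrib diff_divide_distrib algebra_simps\<close>)
  then show "(\<lambda>n. (A n + 2 * of_nat (n - k)) / A n) \<longlonglongrightarrow> -1"
    using * by (simp add: tendsto_cong)
  obtain B where B: "\<And>n. norm (of_nat n / A n) \<le> B"
    using BseqE[OF convergent_imp_Bseq[OF convergentI[OF nA]]] by blast
  have "norm ((A n + 2 * of_nat k) / A n) \<le> 1 + 2 * B" if "k \<le> n" for n k
  proof -
    have "(A n + 2 * of_nat k) / A n = 1 + 2 * (of_nat k / A n)" using A0 by (simp add: add_divide_distrib)
    also have "norm \<dots> \<le> 1 + 2 * norm (of_nat k / A n)"
      using norm_triangle_ineq[of 1 "2 * (of_nat k / A n)"] by (simp only: norm_mult norm_one norm_numeral)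
    also have "norm (of_nat k / A n) \<le> norm (of_nat n / A n)"
      using that by (simp add: norm_divide divide_right_mono)
    also have "\<dots> \<le> B" by (rule B)
    finally show ?thesis by simp
  qed
  then show "\<exists>W. \<forall>n k. k \<le> n \<longrightarrow> norm ((A n + 2 * of_nat k) / A n) \<le> W" by blast
qed

lemma vwp_convolution_limit:
  fixes x y :: "nat \<Rightarrow> complex" and e :: complex
  assumes e: "e \<notin> \<int>"
    and x: "(\<lambda>n. of_nat (Suc n) ^ 2 * x n) \<longlonglongrightarrow> 1"
    and y: "(\<lambda>n. of_nat (Suc n) ^ 2 * y n) \<longlonglongrightarrow> 1"
  defines "A n \<equiv> - of_nat n - 1 + e"
  shows "(\<lambda>n. of_nat (Suc n) ^ 2 * (\<Sum>k\<le>n. (A n + 2 * of_nat k) / A n * x k * y (n - k))) \<longlonglongrightarrow> suminf x - suminf y"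
proof -
  note lims = vwp_weight_limits[OF e, folded A_def]
  obtain W where W: "\<And>n k. k \<le> n \<Longrightarrow> norm ((A n + 2 * of_nat k) / A n) \<le> W"
    using lims(3) by blast
  have W0: "W \<ge> 0" using order_trans[OF norm_ge_zero W[of 0 0]] by simp
  \<comment> \<open>The second half of the sum is reversed. The strict inequality keeps the middle
    index \<open>2 * k = n\<close> out of it, since the first half already contains that
    index.\<close>
  define v where "v n k = (if 2 * k < n then (A n + 2 * of_nat (n - k)) / A n else 0)" for n k
  have 1: "(\<lambda>n. of_nat (Suc n) ^ 2 * (\<Sum>k | 2 * k \<le> n. (A n + 2 * of_nat k) / A n * x k * y (n - k))) \<longlonglongrightarrow> 1 * suminf x"
    by (rule half_convolution_limit[OF x y lims(1), where W = W]) (use W in auto)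
  have vlim: "(\<lambda>n. v n k) \<longlonglongrightarrow> -1" for k
  proof -
    have "\<forall>\<^sub>F n in sequentially. (A n + 2 * of_nat (n - k)) / A n = v n k"
      using eventually_gt_at_top[of "2 * k"] by eventually_elim (simp add: v_def)
    then show ?thesis using lims(2)[of k] by (simp add: tendsto_cong)
  qed
  have 2: "(\<lambda>n. of_nat (Suc n) ^ 2 * (\<Sum>k | 2 * k \<le> n. v n k * y k * x (n - k))) \<longlonglongrightarrow> -1 * suminf y"
    by (rule half_convolution_limit[OF y x vlim, where W = W]) (use W W0 in \<open>auto simp: v_def simp del: of_nat_diff\<close>)
  have split: "(\<Sum>k\<le>n. (A n + 2 * of_nat k) / A n * x k * y (n - k)) =
     (\<Sum>k | 2 * k \<le> n. (A n + 2 * of_nat k) / A n * x k * y (n - k)) + (\<Sum>k | 2 * k \<le> n. v n k * y k * x (n - k))" for n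
  proof -
    have fin: "finite {k. 2 * k \<le> n}" by (rule finite_subset[of _ "{..n}"]) auto
    have "{..n} = {k. 2 * k \<le> n} \<union> {k. k \<le> n \<and> n < 2 * k}" by auto
    then have "(\<Sum>k\<le>n. (A n + 2 * of_nat k) / A n * x k * y (n - k)) =
       (\<Sum>k | 2 * k \<le> n. (A n + 2 * of_nat k) / A n * x k * y (n - k)) +
       (\<Sum>k | k \<le> n \<and> n < 2 * k. (A n + 2 * of_nat k) / A n * x k * y (n - k))"
      using fin by (simp add: sum.union_disjoint disjoint_iff)
    also have "(\<Sum>k | k \<le> n \<and> n < 2 * k. (A n + 2 * of_nat k) / A n * x k * y (n - k)) =
       (\<Sum>k | 2 * k < n. v n k * y k * x (n - k))"
      by (rule sum.reindex_bij_witness[of _ "\<lambda>k. n - k" "\<lambda>k. n - k"]) (auto simp: v_def)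
    also have "\<dots> = (\<Sum>k | 2 * k \<le> n. v n k * y k * x (n - k))"
      by (rule sum.mono_neutral_left[OF fin]) (auto simp: v_def)
    finally show ?thesis .
  qed
  show ?thesis unfolding split distrib_left using tendsto_add[OF 1 2] by simp
qed


section \<open>The limit of Bailey's transformation and the duality of pairs\<close>

definition Phi :: complex_fun7 where
  "Phi a b c d e f g = suminf (Phi_term a b c d e f g)"

lemma diff_not_Ints: "z \<notin> \<int> \<Longrightarrow> of_int k - z \<notin> \<int>" for z :: complex
proof -
  assume "z \<notin> \<int>"
  then have "- z \<notin> \<int>" using minus_in_Ints_iff by blast
  then show ?thesis by (rule not_Ints_shift[of _ _ k]) simp
qed

lemma one_plus_minus_not_Ints: "y - x \<notin> \<int> \<Longrightarrow> 1 + x - y \<notin> \<int>" for x y :: complex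
  using diff_not_Ints[of "y - x" 1] by (simp add: algebra_simps)

text \<open>The terms are those of a convolution divided by \<open>y n\<close>. Convolution and
  divisor both decay like \<open>(n + 1) ^ -2\<close>, hence the quotient converges; the weight
  \<open>(A + 2 k) / A\<close> gives the contributions of the two ends opposite signs.\<close>

lemma vwp_limit:
  fixes p1 p2 p3 p4 e f g :: complex
  assumes bal: "e + f + g - p1 - p2 - p3 - p4 = 1"
    and e: "e \<notin> \<int>" and f: "f \<notin> \<int>" and g: "g \<notin> \<int>"
    and p1: "p1 \<notin> \<int>" and p2: "p2 \<notin> \<int>" and p3: "p3 \<notin> \<int>" and p4: "p4 \<notin> \<int>"
    and ep1: "e - p1 \<notin> \<int>" and ep2: "e - p2 \<notin> \<int>" and ep3: "e - p3 \<notin> \<int>" and ep4: "e - p4 \<notin> \<int>"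
    and fe: "f - e \<notin> \<int>" and ge: "g - e \<notin> \<int>"
  shows "(\<lambda>n. (\<Sum>k\<le>n. vwp_term (- of_nat n - 1 + e) [p1, p2, - of_nat n + e - f, p3, p4, - of_nat n + e - g, - of_nat n] k) /
      (- of_nat n - 1 + e)) \<longlonglongrightarrow>
    Gamma e * Gamma f * Gamma g / (Gamma p1 * Gamma p2 * Gamma p3 * Gamma p4) *
    (Phi p1 p2 p3 p4 e f g - Phi (1 + p1 - e) (1 + p2 - e) (1 + p3 - e) (1 + p4 - e) (2 - e) (1 + f - e) (1 + g - e))"
proof -
  define A where "A n = - of_nat n - 1 + e" for n
  define x where "x = Phi_term p1 p2 p3 p4 e f g"
  define y where "y = Phi_term (1 + p1 - e) (1 + p2 - e) (1 + p3 - e) (1 + p4 - e) (2 - e) (1 + f - e) (1 + g - e)"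
  define K where "K = Gamma e * Gamma f * Gamma g / (Gamma p1 * Gamma p2 * Gamma p3 * Gamma p4)"
  note N = not_Ints_not_nonpos_Ints
  have e2: "2 - e \<notin> \<int>" using diff_not_Ints[OF e, of 2] by simp
  have fe': "1 + f - e \<notin> \<int>" by (rule not_Ints_shift[OF fe, of _ 1]) simp
  have ge': "1 + g - e \<notin> \<int>" by (rule not_Ints_shift[OF ge, of _ 1]) simp
  have x: "(\<lambda>n. of_nat (Suc n) ^ 2 * x n) \<longlonglongrightarrow> 1"
    unfolding x_def by (rule Phi_term_asymp[OF bal]) (intro N p1 p2 p3 p4 e f g)+
  have y: "(\<lambda>n. of_nat (Suc n) ^ 2 * y n) \<longlonglongrightarrow> 1"
    unfolding y_def
    by (rule Phi_term_asymp) (use bal in \<open>simp add: algebra_simps\<close>,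
      (intro N e2 fe' ge' one_plus_minus_not_Ints[OF ep1] one_plus_minus_not_Ints[OF ep2]
         one_plus_minus_not_Ints[OF ep3] one_plus_minus_not_Ints[OF ep4])+)
  have eq: "(\<Sum>k\<le>n. vwp_term (A n) [p1, p2, - of_nat n + e - f, p3, p4, - of_nat n + e - g, - of_nat n] k) / A n =
     K * ((of_nat (Suc n) ^ 2 * (\<Sum>k\<le>n. (A n + 2 * of_nat k) / A n * x k * y (n - k))) / (of_nat (Suc n) ^ 2 * y n))" for n
  proof -
    have "(\<Sum>k\<le>n. vwp_term (A n) [p1, p2, - of_nat n + e - f, p3, p4, - of_nat n + e - g, - of_nat n] k) / A n =
      (\<Sum>k\<le>n. K * ((A n + 2 * of_nat k) / A n * x k * y (n - k)) / y n)"
      unfolding sum_divide_distrib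
      by (rule sum.cong) (simp_all only: A_def x_def y_def K_def atMost_iff
        vwp_term_eq_convolution[OF _ e f g p1 p2 p3 p4 ep1 ep2 ep3 ep4 fe ge])
    also have "\<dots> = K * ((\<Sum>k\<le>n. (A n + 2 * of_nat k) / A n * x k * y (n - k)) / y n)"
      by (simp add: sum_distrib_left sum_divide_distrib)
    also have "\<dots> = K * ((of_nat (Suc n) ^ 2 * (\<Sum>k\<le>n. (A n + 2 * of_nat k) / A n * x k * y (n - k))) / (of_nat (Suc n) ^ 2 * y n))"
      using of_nat_neq_0[of n, where ?'a = complex] by (simp del: of_nat_Suc)
    finally show ?thesis .
  qed
  have "(\<lambda>n. K * ((of_nat (Suc n) ^ 2 * (\<Sum>k\<le>n. (A n + 2 * of_nat k) / A n * x k * y (n - k))) / (of_nat (Suc n) ^ 2 * y n)))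
     \<longlonglongrightarrow> K * ((suminf x - suminf y) / 1)"
    by (rule tendsto_mult[OF tendsto_const tendsto_divide[OF vwp_convolution_limit[OF e x y, folded A_def] y]]) simp
  then show ?thesis unfolding eq[symmetric] unfolding A_def K_def x_def y_def Phi_def by simp
qed

text \<open>
  This is \<open>\<pi> L(a,b,c,d;e;f,g)\<close>, since \<open>\<Gamma>(e) \<Gamma>(1-e) sin \<pi>e = \<pi>\<close>.
\<close>

definition Phi_pair :: complex_fun7 where
  "Phi_pair a b c d e f g = (Phi a b c d e f g -
     Phi (1 + a - e) (1 + b - e) (1 + c - e) (1 + d - e) (2 - e) (1 + f - e) (1 + g - e)) *
     (Gamma e * Gamma (1 - e)) /
     (Gamma a * Gamma b * Gamma c * Gamma d *
      (Gamma (1 + a - e) * Gamma (1 + b - e) * Gamma (1 + c - e) * Gamma (1 + d - e)))"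

text \<open>Bailey's transformation is applied with the triple \<open>a\<close>, \<open>b\<close>,
  \<open>-n + e - f\<close>, in which one parameter is large. The new base is
  \<open>-n - 1 + e'\<close>, and the untouched large parameter \<open>-n + e - g\<close> equals
  \<open>-n + e' - g'\<close>, so both sides are sums of the kind treated in
  \<open>vwp_limit\<close>. The Gamma arguments in the prefactor have equal sums above and below,
  whence its dependence on \<open>n\<close> disappears in the limit.\<close>

lemma Phi_pair_transform:
  fixes a b c d e f g :: complex
  defines "e' \<equiv> e + f - a - b" and "g' \<equiv> f + g - a - b"
  assumes bal: "e + f + g - a - b - c - d = 1"
    and e: "e \<notin> \<int>" and f: "f \<notin> \<int>" and g: "g \<notin> \<int>"
    and a: "a \<notin> \<int>" and b: "b \<notin> \<int>" and c: "c \<notin> \<int>" and d: "d \<notin> \<int>"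
    and ea: "e - a \<notin> \<int>" and eb: "e - b \<notin> \<int>" and ec: "e - c \<notin> \<int>" and ed: "e - d \<notin> \<int>"
    and fe: "f - e \<notin> \<int>" and ge: "g - e \<notin> \<int>"
    and e': "e' \<notin> \<int>" and g': "g' \<notin> \<int>" and fa: "f - a \<notin> \<int>" and fb: "f - b \<notin> \<int>"
    and fab: "f - a - b \<notin> \<int>" and fe': "f - e' \<notin> \<int>" and e'c: "e' - c \<notin> \<int>" and e'd: "e' - d \<notin> \<int>"
  shows "Phi_pair a b c d e f g = Phi_pair (f - b) (f - a) c d e' f g'"
proof -
  define D where "D = Phi a b c d e f g - Phi (1 + a - e) (1 + b - e) (1 + c - e) (1 + d - e) (2 - e) (1 + f - e) (1 + g - e)"
  define a' b' where "a' = f - b" and "b' = f - a"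
  define D' where "D' = Phi a' b' c d e' f g' - Phi (1 + a' - e') (1 + b' - e') (1 + c - e') (1 + d - e') (2 - e') (1 + f - e') (1 + g' - e')"
  note N = not_Ints_not_nonpos_Ints
  have bal': "e' + f + g' - a' - b' - c - d = 1"
    using bal by (simp add: e'_def g'_def a'_def b'_def algebra_simps)
  have a': "a' \<notin> \<int>" and b': "b' \<notin> \<int>" using fa fb by (simp_all add: a'_def b'_def)
  have ea': "e' - a' \<notin> \<int>" "e' - b' \<notin> \<int>"
    using ea eb by (simp_all add: e'_def a'_def b'_def algebra_simps)
  have ge': "g' - e' \<notin> \<int>" using ge by (simp add: g'_def e'_def algebra_simps)
  define X where "X n = (\<Sum>k\<le>n. vwp_term (- of_nat n - 1 + e) [a, b, - of_nat n + e - f, c, d, - of_nat n + e - g, - of_nat n] k) /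
      (- of_nat n - 1 + e)" for n
  define X' where "X' n = (\<Sum>k\<le>n. vwp_term (- of_nat n - 1 + e') [a', b', - of_nat n + e' - f, c, d, - of_nat n + e' - g', - of_nat n] k) /
      (- of_nat n - 1 + e')" for n
  have limX: "X \<longlonglongrightarrow> Gamma e * Gamma f * Gamma g / (Gamma a * Gamma b * Gamma c * Gamma d) * D"
    unfolding X_def D_def by (rule vwp_limit[OF bal e f g a b c d ea eb ec ed fe ge])
  have limX': "X' \<longlonglongrightarrow> Gamma e' * Gamma f * Gamma g' / (Gamma a' * Gamma b' * Gamma c * Gamma d) * D'"
    unfolding X'_def D'_def by (rule vwp_limit[OF bal' e' f g' a' b' c d ea' e'c e'd fe' ge'])
  have ne: "1 - e \<notin> \<int>" "1 - e' \<notin> \<int>" "1 + c - e' \<notin> \<int>" "1 + d - e' \<notin> \<int>" "1 + c - e \<notin> \<int>" "1 + d - e \<notin> \<int>"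
    using diff_not_Ints[OF e, of 1] diff_not_Ints[OF e', of 1]
      one_plus_minus_not_Ints[OF e'c] one_plus_minus_not_Ints[OF e'd]
      one_plus_minus_not_Ints[OF ec] one_plus_minus_not_Ints[OF ed] by simp_all
  define R where "R n = Gamma (1 - e + of_nat n) * Gamma (1 + c - e' + of_nat n) * Gamma (1 + d - e' + of_nat n) * Gamma (g' + of_nat n) /
     (Gamma (1 - e' + of_nat n) * Gamma (1 + c - e + of_nat n) * Gamma (1 + d - e + of_nat n) * Gamma (g + of_nat n))" for n
  define K where "K = Gamma (1 - e') * Gamma (1 + c - e) * Gamma (1 + d - e) * Gamma g /
    (Gamma (1 - e) * Gamma (1 + c - e') * Gamma (1 + d - e') * Gamma g')"
  have limR: "R \<longlonglongrightarrow> 1"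
    unfolding R_def
    by (rule Gamma_ratio_tendsto_1) (simp add: e'_def g'_def, (intro N ne g g')+)
  have XX': "X n = K * R n * X' n" for n
  proof -
    define A where "A = - of_nat n - 1 + e"
    define l where "l = - of_nat n - 1 + e'"
    have l_eq: "1 + 2 * A - a - b - (- of_nat n + e - f) = l"
      by (simp add: A_def l_def e'_def)
    have tr: "l + a - A = a'" "l + b - A = b'" "l + (- of_nat n + e - f) - A = - of_nat n + e' - f"
      by (simp_all add: A_def l_def e'_def a'_def b'_def)
    have gg: "- of_nat n + e - g = - of_nat n + e' - g'" by (simp add: e'_def g'_def)
    have AI: "A + z \<notin> \<int>" if "e + z \<notin> \<int>" for z
      unfolding A_def by (rule not_Ints_shift[OF that, of _ "- int n - 1"]) simp
    have lI: "l + z \<notin> \<int>" if "e' + z \<notin> \<int>" for z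
      unfolding l_def by (rule not_Ints_shift[OF that, of _ "- int n - 1"]) simp
    have B: "(\<Sum>k\<le>n. vwp_term A [a, b, - of_nat n + e - f, c, d, - of_nat n + e - g, - of_nat n] k) / A =
      pochhammer (1 + A) n * pochhammer (1 + l - c) n * pochhammer (1 + l - d) n * pochhammer (1 + l - (- of_nat n + e - g)) n /
      (pochhammer (1 + l) n * pochhammer (1 + A - c) n * pochhammer (1 + A - d) n * pochhammer (1 + A - (- of_nat n + e - g)) n) *
      ((\<Sum>k\<le>n. vwp_term l [a', b', - of_nat n + e' - f, c, d, - of_nat n + e - g, - of_nat n] k) / l)"
    proof (rule bailey_9F8[of A a b "- of_nat n + e - f" c d "- of_nat n + e - g" n, unfolded l_eq tr])
      show "2 + 3 * A = a + b + (- of_nat n + e - f) + c + d + (- of_nat n + e - g) - of_nat n"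
        using bal by (simp add: A_def algebra_simps)
      show "A \<notin> \<int>" "A - a \<notin> \<int>" "A - b \<notin> \<int>" "A - c \<notin> \<int>" "A - d \<notin> \<int>"
        using AI[of 0] AI[of "- a"] AI[of "- b"] AI[of "- c"] AI[of "- d"] e ea eb ec ed by simp_all
      show "l \<notin> \<int>" "l - c \<notin> \<int>" "l - d \<notin> \<int>"
        using lI[of 0] lI[of "- c"] lI[of "- d"] e' e'c e'd by simp_all
      have "- (f - a - b) \<notin> \<int>" using fab minus_in_Ints_iff by blast
      then show "A - l \<notin> \<int>" by (simp add: A_def l_def e'_def algebra_simps)
      show "A - (- of_nat n + e - f) \<notin> \<int>"
        by (rule not_Ints_shift[OF f, of _ "-1"]) (simp add: A_def)
      show "A - (- of_nat n + e - g) \<notin> \<int>"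
        by (rule not_Ints_shift[OF g, of _ "-1"]) (simp add: A_def)
      show "l - (- of_nat n + e - g) \<notin> \<int>"
        by (rule not_Ints_shift[OF g', of _ "-1"]) (simp add: l_def e'_def g'_def)
    qed
    define s where "s = ((-1) ^ n :: complex)"
    have s0: "s \<noteq> 0" by (simp add: s_def)
    have P: "pochhammer (1 + A - z) n = s * (Gamma (1 + z - e + of_nat n) / Gamma (1 + z - e))" if "1 + z - e \<notin> \<int>" for z
    proof -
      have eq: "1 + A - z = 1 - (1 + z - e) - of_nat n" by (simp add: A_def)
      show ?thesis unfolding eq pochhammer_reflect_Gamma[OF N[OF that] order_refl] by (simp add: s_def)
    qed
    have P': "pochhammer (1 + l - z) n = s * (Gamma (1 + z - e' + of_nat n) / Gamma (1 + z - e'))" if "1 + z - e' \<notin> \<int>" for z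
    proof -
      have eq: "1 + l - z = 1 - (1 + z - e') - of_nat n" by (simp add: l_def)
      show ?thesis unfolding eq pochhammer_reflect_Gamma[OF N[OF that] order_refl] by (simp add: s_def)
    qed
    have gA: "1 + A - (- of_nat n + e - g) = g" "1 + l - (- of_nat n + e - g) = g'"
      by (simp_all add: A_def l_def e'_def g'_def)
    have KR: "K * R n = pochhammer (1 + A) n * pochhammer (1 + l - c) n * pochhammer (1 + l - d) n * pochhammer g' n /
      (pochhammer (1 + l) n * pochhammer (1 + A - c) n * pochhammer (1 + A - d) n * pochhammer g n)"
      using P[of 0] P'[of 0] ne s0
      by (simp add: P P' pochhammer_Gamma[OF N[OF g]] pochhammer_Gamma[OF N[OF g']] K_def R_def mult_ac)
    show ?thesis
      unfolding X_def X'_def A_def[symmetric] l_def[symmetric] KR gg[symmetric] using B unfolding gA .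
  qed
  have "X \<longlonglongrightarrow> K * 1 * (Gamma e' * Gamma f * Gamma g' / (Gamma a' * Gamma b' * Gamma c * Gamma d) * D')"
    unfolding XX' by (intro tendsto_mult tendsto_const limR limX')
  from LIMSEQ_unique[OF limX this]
  have main: "Gamma e * Gamma f * Gamma g / (Gamma a * Gamma b * Gamma c * Gamma d) * D =
     K * (Gamma e' * Gamma f * Gamma g' / (Gamma a' * Gamma b' * Gamma c * Gamma d) * D')" by simp
  have G: "Gamma z \<noteq> 0" if "z \<notin> \<int>" for z :: complex using that by (rule Gamma_nonzero')
  define U where "U = Gamma (1 - e) / (Gamma f * Gamma g * Gamma (1 + a - e) * Gamma (1 + b - e) * Gamma (1 + c - e) * Gamma (1 + d - e))"
  have ab': "1 + a' - e' = 1 + a - e" "1 + b' - e' = 1 + b - e" by (simp_all add: a'_def b'_def e'_def)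
  have "Phi_pair a b c d e f g = U * (Gamma e * Gamma f * Gamma g / (Gamma a * Gamma b * Gamma c * Gamma d) * D)"
    unfolding Phi_pair_def D_def[symmetric] U_def using G[OF f] G[OF g] by (simp add: mult_ac)
  also have "\<dots> = Phi_pair a' b' c d e' f g'"
    unfolding main unfolding Phi_pair_def D'_def[symmetric] unfolding U_def K_def ab' using G[OF f] G[OF g] G[OF g'] G[OF ne(1)] G[OF ne(5)] G[OF ne(6)]
    by (simp add: mult_ac)
  finally show ?thesis by (simp only: a'_def b'_def)
qed

section \<open>The relation between series at zero and at infinity\<close>

text \<open>The sum is the coefficient of degree \<open>card I - 1\<close> in the Lagrange
  interpolation polynomial of \<open>p\<close> at the points \<open>z i\<close>. That polynomial is
  \<open>p\<close> itself, whose degree is smaller.\<close>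

lemma sum_residues_eq_0:
  fixes z :: "'i \<Rightarrow> complex" and p :: "complex poly"
  assumes fin: "finite I" and inj: "inj_on z I" and deg: "degree p + 2 \<le> card I"
  shows "(\<Sum>i\<in>I. poly p (z i) / (\<Prod>j\<in>I - {i}. z i - z j)) = 0"
proof -
  define D where "D i = (\<Prod>j\<in>I - {i}. z i - z j)" for i
  define B where "B i = (\<Prod>j\<in>I - {i}. [:- z j, 1:])" for i
  define q where "q = (\<Sum>i\<in>I. smult (poly p (z i) / D i) (B i))"
  have D0: "D i \<noteq> 0" if "i \<in> I" for i
    using fin inj that by (auto simp: D_def inj_on_def)
  have B_eval: "poly (B i) (z k) = (if k = i then D i else 0)" if "i \<in> I" "k \<in> I" for i k
    using fin that by (auto simp: B_def D_def poly_prod)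
  have degB: "degree (B i) = card I - 1" if "i \<in> I" for i
    using fin that by (simp add: B_def degree_prod_eq_sum_degree)
  have leadB: "coeff (B i) (card I - 1) = 1" if "i \<in> I" for i
  proof -
    have "lead_coeff (B i) = 1" unfolding B_def by (simp add: lead_coeff_prod)
    then show ?thesis using degB[OF that] by simp
  qed
  have degq: "degree q \<le> card I - 1"
    unfolding q_def by (rule degree_sum_le[OF fin]) (use degB degree_smult_le in \<open>metis\<close>)
  have "q = p"
  proof (rule poly_eqI_degree)
    fix x assume "x \<in> z ` I"
    then obtain k where k: "k \<in> I" "x = z k" by blast
    have "poly q x = (\<Sum>i\<in>I. poly p (z i) / D i * (if k = i then D i else 0))"
      unfolding q_def poly_sum using k B_eval by (intro sum.cong) auto
    also have "\<dots> = (\<Sum>i\<in>I. if k = i then poly p (z i) else 0)"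
      using D0 by (intro sum.cong) auto
    also have "\<dots> = poly p x" using fin k by simp
    finally show "poly q x = poly p x" .
  next
    have "card (z ` I) = card I" using inj by (rule card_image)
    then show "degree q < card (z ` I)" "degree p < card (z ` I)" using degq deg by linarith+
  qed
  then have "coeff q (card I - 1) = coeff p (card I - 1)" by simp
  also have "coeff p (card I - 1) = 0" using deg by (intro coeff_eq_0) linarith
  also have "coeff q (card I - 1) = (\<Sum>i\<in>I. poly p (z i) / D i)"
    unfolding q_def coeff_sum using leadB by (intro sum.cong) auto
  finally show ?thesis unfolding D_def .
qed

lemma prod_descending_linear:
  fixes w u :: complex
  shows "(\<Prod>k\<le>N. w - (u + of_nat k)) = (-1) ^ Suc N * pochhammer (u - w) (Suc N)"
proof -
  have "(\<Prod>k\<le>N. w - (u + of_nat k)) = (\<Prod>k\<le>N. (-1) * ((u - w) + of_nat k))"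
    by (rule prod.cong) simp_all
  also have "\<dots> = (-1) ^ Suc N * (\<Prod>k\<le>N. (u - w) + of_nat k)"
    by (simp only: prod.distrib prod_constant card_atMost)
  finally show ?thesis by (simp add: pochhammer_Suc_prod atLeast0AtMost)
qed

lemma prod_differences_omit:
  fixes n N :: nat
  assumes "n \<le> N"
  shows "(\<Prod>k\<in>{..N} - {n}. of_nat n - of_nat k :: complex) = (-1) ^ (N - n) * (fact n * fact (N - n))"
proof -
  obtain M where N: "N = n + M" using assms le_Suc_ex by blast
  have "{..N} - {n} = {..<n} \<union> {n<..n + M}" using N by auto
  then have "(\<Prod>k\<in>{..N} - {n}. of_nat n - of_nat k :: complex) =
     (\<Prod>k<n. of_nat n - of_nat k) * (\<Prod>k\<in>{n<..n + M}. of_nat n - of_nat k)"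
    by (simp add: prod.union_disjoint disjoint_iff)
  also have "(\<Prod>k<n. of_nat n - of_nat k :: complex) = fact n"
  proof -
    have "(\<Prod>k<n. of_nat n - of_nat k :: complex) = (\<Prod>k<n. of_nat (n - k))"
      by (rule prod.cong) (auto simp: of_nat_diff)
    also have "\<dots> = (\<Prod>k\<in>{1..n}. of_nat k)"
      by (rule prod.reindex_bij_witness[of _ "\<lambda>k. n - k" "\<lambda>k. n - k"]) auto
    finally show ?thesis by (simp add: fact_prod)
  qed
  also have "(\<Prod>k\<in>{n<..n + M}. of_nat n - of_nat k :: complex) = (\<Prod>k\<in>{1..M}. - of_nat k)"
    by (rule prod.reindex_bij_witness[of _ "\<lambda>k. k + n" "\<lambda>k. k - n"]) (auto simp: of_nat_diff)
  also have "\<dots> = (-1) ^ M * fact M"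
    by (simp add: fact_prod prod_uminus)
  finally show ?thesis by (simp add: N)
qed

text \<open>Since \<open>N + n + 1 \<le> 2 * (n + 1) * (N - n + 1)\<close>, the quotient of powers
  is at most \<open>(2 * (n + 1)) powr \<bar>Re \<tau>\<bar>\<close> in norm. The summands are thus
  dominated by a multiple of \<open>(n + 1) powr (\<bar>Re \<tau>\<bar> - 2)\<close>, which is
  summable for \<open>\<bar>Re \<tau>\<bar> < 1\<close>. This is the origin of all later bounds on
  real parts.\<close>

lemma kernel_sum_limit:
  fixes x H1 H2 :: "nat \<Rightarrow> complex" and \<tau> :: complex
  assumes x: "(\<lambda>n. of_nat (Suc n) ^ 2 * x n) \<longlonglongrightarrow> 1"
    and H1: "H1 \<longlonglongrightarrow> 1" and H2: "H2 \<longlonglongrightarrow> 1" and \<tau>: "\<bar>Re \<tau>\<bar> < 1"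
  shows "(\<lambda>N. \<Sum>n\<le>N. x n * (H1 (N - n) * H2 (N + n) *
     (of_nat (Suc (N - n)) powr \<tau> / of_nat (Suc (N + n)) powr \<tau>))) \<longlonglongrightarrow> suminf x"
proof -
  obtain C where C: "C > 0" "\<And>n. norm (x n) \<le> C / real (Suc n) ^ 2" using square_decay_bound[OF x] by blast
  obtain D where D: "D > 0" "\<And>n. norm (H1 n) \<le> D"
    using BseqE[OF convergent_imp_Bseq[OF convergentI[OF H1]]] by blast
  obtain E where E: "E > 0" "\<And>n. norm (H2 n) \<le> E"
    using BseqE[OF convergent_imp_Bseq[OF convergentI[OF H2]]] by blast
  define t where "t = \<bar>Re \<tau>\<bar>"
  define r where "r N n = of_nat (Suc (N - n)) powr \<tau> / of_nat (Suc (N + n)) powr \<tau>" for N n :: nat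
  define a where "a n N = (if n \<le> N then x n * (H1 (N - n) * H2 (N + n) * r N n) else 0)" for n N
  define M where "M n = C * D * E * 2 powr t * real (Suc n) powr (t - 2)" for n
  have r_norm: "norm (r N n) \<le> 2 powr t * real (Suc n) powr t" if nN: "n \<le> N" for N n
  proof -
    define y where "y = real (Suc (N - n)) / real (Suc (N + n))"
    have y: "0 < y" "y \<le> 1" by (simp_all add: y_def)
    have ub: "1 / y \<le> 2 * real (Suc n)"
    proof -
      have "real (Suc (N + n)) \<le> 2 * real (Suc n) * real (Suc (N - n))"
      proof -
        have "Suc (N + n) \<le> 2 * Suc n * Suc (N - n)"
        proof -
          obtain m where N: "N = n + m" using nN le_Suc_ex by blast
          have "2 * Suc n * Suc m = 2 * (n * m) + 2 * n + 2 * m + 2" by simp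
          then show ?thesis unfolding N by simp
        qed
        then have "real (Suc (N + n)) \<le> real (2 * Suc n * Suc (N - n))" by (simp only: of_nat_le_iff)
        then show ?thesis by (simp only: of_nat_mult of_nat_numeral)
      qed
      then show ?thesis unfolding y_def by (simp add: divide_simps del: of_nat_Suc)
    qed
    have "norm (r N n) = y powr Re \<tau>"
      unfolding r_def y_def norm_divide
      using norm_powr_real_powr[of "of_nat (Suc (N - n))" \<tau>] norm_powr_real_powr[of "of_nat (Suc (N + n))" \<tau>]
      by (simp add: powr_divide del: of_nat_Suc)
    also have "\<dots> \<le> (1 / y) powr t"
    proof (cases "Re \<tau> \<ge> 0")
      case True
      have "y powr Re \<tau> \<le> 1 powr Re \<tau>" using y True by (intro powr_mono2) auto
      also have "\<dots> \<le> (1 / y) powr t" using y by (simp add: t_def ge_one_powr_ge_zero)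
      finally show ?thesis .
    next
      case False
      then show ?thesis using y by (simp add: t_def powr_divide powr_minus_divide flip: powr_minus)
    qed
    also have "\<dots> \<le> (2 * real (Suc n)) powr t"
      using ub y by (intro powr_mono2) (auto simp: t_def)
    also have "\<dots> = 2 powr t * real (Suc n) powr t"
      by (rule powr_mult)
    finally show ?thesis .
  qed
  have r_lim: "(\<lambda>N. r N n) \<longlonglongrightarrow> 1" for n
  proof -
    have y: "(\<lambda>N. of_nat (Suc (N - n)) / of_nat (Suc (N + n))) \<longlonglongrightarrow> (1 :: complex)"
    proof -
      have "(\<lambda>N. inverse (of_nat (Suc N) / ((1 - of_nat n) + of_nat N)) * (of_nat (Suc N) / ((1 + of_nat n) + of_nat N)))
          \<longlonglongrightarrow> inverse 1 * (1 :: complex)"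
        by (intro tendsto_mult tendsto_inverse tendsto_Suc_over_add) simp
      moreover have "\<forall>\<^sub>F N in sequentially. inverse (of_nat (Suc N) / ((1 - of_nat n) + of_nat N)) *
          (of_nat (Suc N) / ((1 + of_nat n) + of_nat N)) = (of_nat (Suc (N - n)) / of_nat (Suc (N + n)) :: complex)"
        using eventually_ge_at_top[of n]
      proof eventually_elim
        case (elim N)
        have 1: "(1 - of_nat n) + of_nat N = (of_nat (Suc (N - n)) :: complex)" using elim by (simp add: of_nat_diff)
        have 2: "(1 + of_nat n) + of_nat N = (of_nat (Suc (N + n)) :: complex)" by simp
        show ?case unfolding 1 2 using of_nat_neq_0[of N, where ?'a = complex] by (simp del: of_nat_Suc)
      qed
      ultimately have "(\<lambda>N. of_nat (Suc (N - n)) / of_nat (Suc (N + n))) \<longlonglongrightarrow> inverse 1 * (1 :: complex)"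
        by (rule Lim_transform_eventually)
      then show ?thesis by simp
    qed
    have "(\<lambda>N. (of_nat (Suc (N - n)) / of_nat (Suc (N + n))) powr \<tau>) \<longlonglongrightarrow> 1 powr \<tau>"
      by (rule tendsto_powr_complex[OF _ y tendsto_const]) simp
    moreover have "(of_nat (Suc (N - n)) / of_nat (Suc (N + n))) powr \<tau> = r N n" for N
    proof -
      have nz: "of_nat (Suc (N + n)) \<noteq> (0 :: complex)" by (rule of_nat_neq_0)
      have "of_nat (Suc (N - n)) / of_nat (Suc (N + n)) = (of_real (real (Suc (N - n)) / real (Suc (N + n))) :: complex)"
        by (simp only: of_real_divide of_real_of_nat_eq)
      then have "(of_nat (Suc (N - n)) / of_nat (Suc (N + n)) * of_nat (Suc (N + n))) powr \<tau> =
        (of_nat (Suc (N - n)) / of_nat (Suc (N + n))) powr \<tau> * of_nat (Suc (N + n)) powr \<tau>"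
        by (intro powr_times_real) (simp_all add: complex_is_Real_iff del: of_nat_Suc)
      then have "of_nat (Suc (N - n)) powr \<tau> =
        (of_nat (Suc (N - n)) / of_nat (Suc (N + n))) powr \<tau> * of_nat (Suc (N + n)) powr \<tau>"
        using nz by (simp del: of_nat_Suc)
      then show ?thesis unfolding r_def using nz by (simp del: of_nat_Suc)
    qed
    ultimately show ?thesis by simp
  qed
  have limit: "(\<lambda>N. a n N) \<longlonglongrightarrow> x n" for n
  proof -
    have "(\<lambda>N. x n * (H1 (N - n) * H2 (N + n) * r N n)) \<longlonglongrightarrow> x n * (1 * 1 * 1)"
      by (intro tendsto_mult tendsto_const r_lim filterlim_compose[OF H1 filterlim_minus_const_nat_at_top]
          LIMSEQ_ignore_initial_segment H2)
    moreover have "\<forall>\<^sub>F N in sequentially. x n * (H1 (N - n) * H2 (N + n) * r N n) = a n N"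
      using eventually_ge_at_top[of n] by eventually_elim (simp add: a_def)
    ultimately show ?thesis by (simp add: tendsto_cong)
  qed
  have bd: "norm (a n N) \<le> M n" for n N
  proof (cases "n \<le> N")
    case True
    have "norm (a n N) = norm (x n) * (norm (H1 (N - n)) * norm (H2 (N + n)) * norm (r N n))"
      using True by (simp add: a_def norm_mult)
    also have "\<dots> \<le> C / real (Suc n) ^ 2 * (D * E * (2 powr t * real (Suc n) powr t))"
      by (intro mult_mono C D E r_norm True mult_nonneg_nonneg) (use C(1) D(1) E(1) in auto)
    also have "\<dots> = M n"
      by (simp add: M_def powr_diff powr_numeral del: of_nat_Suc)
    finally show ?thesis .
  next
    case False
    then show ?thesis using C(1) D(1) E(1) by (simp add: a_def M_def)
  qed
  have sM: "summable M"
  proof -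
    have "summable (\<lambda>n. real n powr (t - 2))" using \<tau> by (simp add: summable_real_powr_iff t_def)
    then have "summable (\<lambda>n. real (Suc n) powr (t - 2))" by (subst summable_Suc_iff)
    then show ?thesis unfolding M_def by (rule summable_mult)
  qed
  have "\<forall>\<^sub>F (k, n) in sequentially \<times>\<^sub>F sequentially. norm (a k n) \<le> M k"
    by (rule always_eventually) (use bd in auto)
  then have "(\<lambda>N. \<Sum>n. a n N) \<longlonglongrightarrow> suminf x"
    using tannerys_theorem[of a x sequentially M] limit sM by simp
  moreover have "(\<Sum>n. a n N) = (\<Sum>n\<le>N. x n * (H1 (N - n) * H2 (N + n) * r N n))" for N
    by (subst suminf_finite[of "{..N}"]) (auto simp: a_def)
  ultimately show ?thesis unfolding r_def by simp
qed

section \<open>Residues of the truncated Gamma quotient\<close>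

abbreviation sinpi :: "complex \<Rightarrow> complex" where "sinpi x \<equiv> sin (of_real pi * x)"

lemma Gamma_refl_inverse:
  assumes "w \<notin> \<int>"
  shows "1 / (Gamma w * Gamma (1 - w)) = sinpi w / of_real pi"
  using Gamma_reflection_complex[of w] by simp

text \<open>The first \<open>n\<close> factors are read backwards from \<open>w\<close> and the
  other \<open>m\<close> forwards from \<open>1 - w\<close>; the reflection formula joins the two
  Gamma quotients into a sine. The sine coefficients of the connection formula arise here.\<close>

lemma pochhammer_cross:
  fixes w :: complex
  assumes w: "w \<notin> \<int>"
  shows "pochhammer (1 - w - of_nat n) (n + m) = Gamma (1 - w + of_nat m) * Gamma (w + of_nat n) * ((-1) ^ n * (sinpi w / of_real pi))"
proof -
  have w1: "1 - w \<notin> \<int>" using diff_not_Ints[OF w, of 1] by simp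
  have 1: "1 - w - of_nat n + of_nat n = 1 - w" by simp
  show ?thesis
    unfolding pochhammer_product' 1 pochhammer_Gamma[OF not_Ints_not_nonpos_Ints[OF w1]]
      pochhammer_reflect_Gamma[OF not_Ints_not_nonpos_Ints[OF w] order_refl] Gamma_refl_inverse[OF w, symmetric]
    by (simp add: mult_ac)
qed

text \<open>
  Up to signs, the residues of the rational function
  \<open>(1-b-s)\<^sub>N (e+s)\<^sub>N (1-c-s)\<^bsub>N+1\<^esub> (1-d-s)\<^bsub>N+1\<^esub> / ((a+s) (-s) (1-f-s) (1-g-s))\<^bsub>N+1\<^esub>\<close> at \<open>s = n\<close> and at \<open>s = -a - n\<close>.
  The two lengths \<open>N\<close> make the numerator degree two less than the denominator degree, so that all residues add up to 0.
  The residues at \<open>1 - f + n\<close> and \<open>1 - g + n\<close> are those at \<open>n\<close> for shifted parameters.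
\<close>

definition res_lower :: "nat \<Rightarrow> nat \<Rightarrow> complex \<Rightarrow> complex \<Rightarrow> complex \<Rightarrow> complex \<Rightarrow> complex \<Rightarrow> complex \<Rightarrow> complex \<Rightarrow> complex" where
  "res_lower N n a b c d e f g = (-1) ^ n * (pochhammer (1 - b - of_nat n) N * pochhammer (e + of_nat n) N *
     pochhammer (1 - c - of_nat n) (Suc N) * pochhammer (1 - d - of_nat n) (Suc N)) /
   (fact n * fact (N - n) * pochhammer (a + of_nat n) (Suc N) * pochhammer (1 - f - of_nat n) (Suc N) *
    pochhammer (1 - g - of_nat n) (Suc N))"

definition res_upper :: "nat \<Rightarrow> nat \<Rightarrow> complex \<Rightarrow> complex \<Rightarrow> complex \<Rightarrow> complex \<Rightarrow> complex \<Rightarrow> complex \<Rightarrow> complex \<Rightarrow> complex" where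
  "res_upper N n a b c d e f g = (-1) ^ n * (pochhammer (1 + a - b + of_nat n) N * pochhammer (e - a - of_nat n) N *
     pochhammer (1 + a - c + of_nat n) (Suc N) * pochhammer (1 + a - d + of_nat n) (Suc N)) /
   (fact n * fact (N - n) * pochhammer (a + of_nat n) (Suc N) * pochhammer (1 + a - f + of_nat n) (Suc N) *
    pochhammer (1 + a - g + of_nat n) (Suc N))"

lemma poly_prod_pochhammer:
  fixes w s :: complex
  shows "poly (\<Prod>k<N. [:w + of_nat k, 1:]) s = pochhammer (w + s) N"
    and "poly (\<Prod>k<N. [:w + of_nat k, -1:]) s = pochhammer (w - s) N"
  unfolding poly_prod pochhammer_prod atLeast0LessThan by (rule prod.cong, simp_all add: algebra_simps)+

lemma degree_prod_linear_le: "degree (\<Prod>k<N. [:w k, u:]) \<le> N"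
proof -
  have "degree (\<Prod>k<N. [:w k, u:]) \<le> (\<Sum>k<N. degree [:w k, u:])"
    using degree_prod_sum_le[of "{..<N}" "\<lambda>k. [:w k, u:]"] by (simp add: o_def)
  also have "\<dots> \<le> (\<Sum>k<N. 1)" by (intro sum_mono) simp
  finally show ?thesis by simp
qed

text \<open>The poles form four chains of \<open>N + 1\<close> points: one descends from
  \<open>-a\<close>, three ascend from the points of \<open>T\<close>. Non-integrality of the
  differences keeps the chains disjoint, so all \<open>4 * N + 4\<close> poles are simple, against
  numerator degree at most \<open>4 * N + 2\<close>. Translating the variable by \<open>t\<close> in
  \<open>T\<close> adds \<open>t\<close> to \<open>a\<close>, \<open>b\<close>, \<open>c\<close>,
  \<open>d\<close>, \<open>e\<close> and turns the chain of \<open>t\<close> into the one starting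
  at 0, so one residue formula covers all three.\<close>

lemma res_identity:
  fixes a b c d e f g :: complex
  assumes a: "a \<notin> \<int>" and f: "f \<notin> \<int>" and g: "g \<notin> \<int>" and fa: "f - a \<notin> \<int>" and ga: "g - a \<notin> \<int>" and fg: "f - g \<notin> \<int>"
  shows "(\<Sum>n\<le>N. res_upper N n a b c d e f g) = (\<Sum>n\<le>N. res_lower N n a b c d e f g) +
     (\<Sum>n\<le>N. res_lower N n (1 + a - f) (1 + b - f) (1 + c - f) (1 + d - f) (1 + e - f) (2 - f) (1 + g - f)) +
     (\<Sum>n\<le>N. res_lower N n (1 + a - g) (1 + b - g) (1 + c - g) (1 + d - g) (1 + e - g) (2 - g) (1 + f - g))"
proof -
  define T where "T = {0, 1 - f, 1 - g}"
  define I where "I = {..N} <+> (T \<times> {..N})"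
  define z where "z i = (case i of Inl n \<Rightarrow> - a - of_nat n | Inr (t, n) \<Rightarrow> t + of_nat n)" for i :: "nat + complex \<times> nat"
  define p where "p = (\<Prod>k<N. [:(1 - b) + of_nat k, -1:]) * (\<Prod>k<N. [:e + of_nat k, 1:]) *
     (\<Prod>k<Suc N. [:(1 - c) + of_nat k, -1:]) * (\<Prod>k<Suc N. [:(1 - d) + of_nat k, -1:])"
  define D where "D i = (\<Prod>j\<in>I - {i}. z i - z j)" for i
  have f1: "1 - f \<noteq> 0" "1 - g \<noteq> 0" "1 - f \<noteq> 1 - g"
  proof -
    show "1 - f \<noteq> 0" "1 - g \<noteq> 0" using f g by auto
    show "1 - f \<noteq> 1 - g" using fg by auto
  qed
  have finT: "finite T" and cardT: "card T = 3"
    using f1 by (auto simp: T_def)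
  have finI: "finite I" by (simp add: I_def finT)
  have cardI: "card I = 4 * Suc N"
    by (simp add: I_def finT cardT card_Plus card_cartesian_product)
  have Tdiff: "t - t' \<notin> \<int>" if "t \<in> T" "t' \<in> T" "t \<noteq> t'" for t t'
  proof -
    have "- f \<notin> \<int>" "- g \<notin> \<int>" "- (f - g) \<notin> \<int>" using f g fg minus_in_Ints_iff by blast+
    then have "f - 1 \<notin> \<int>" "g - 1 \<notin> \<int>" "1 - f \<notin> \<int>" "1 - g \<notin> \<int>" "g - f \<notin> \<int>"
      using not_Ints_shift[OF f, of "f - 1" "-1"] not_Ints_shift[OF g, of "g - 1" "-1"]
        not_Ints_shift[of "- f" "1 - f" 1] not_Ints_shift[of "- g" "1 - g" 1] by simp_all
    then show ?thesis using that fg by (auto simp: T_def)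
  qed
  have aT: "a + t \<notin> \<int>" if "t \<in> T" for t
  proof -
    have "- (f - a) \<notin> \<int>" "- (g - a) \<notin> \<int>" using fa ga minus_in_Ints_iff by blast+
    then have "a + (1 - f) \<notin> \<int>" "a + (1 - g) \<notin> \<int>"
      using not_Ints_shift[of "- (f - a)" "a + (1 - f)" 1] not_Ints_shift[of "- (g - a)" "a + (1 - g)" 1] by simp_all
    then show ?thesis using that a by (auto simp: T_def)
  qed
  have Ints_eq: "x - y \<in> \<int>" if "x + of_nat n = y + of_nat m" for x y :: complex and n m
  proof -
    have "x - y = of_nat m - of_nat n" using that by (simp add: algebra_simps)
    then show ?thesis by simp
  qed
  have inj: "inj_on z I"
  proof (rule inj_onI)
    fix i j assume i: "i \<in> I" and j: "j \<in> I" and eq: "z i = z j"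
    have mixed: False if "- a - of_nat n = t + of_nat m" "t \<in> T" for t n m
    proof -
      have "t = - a - of_nat n - of_nat m" using that(1) by simp
      then have "a + t = - of_nat n - of_nat m" by simp
      then show False using aT[OF that(2)] by simp
    qed
    consider n m where "i = Inl n" "j = Inl m" | n t m where "i = Inl n" "j = Inr (t, m)" "t \<in> T"
      | n t m where "j = Inl n" "i = Inr (t, m)" "t \<in> T"
      | t n t' m where "i = Inr (t, n)" "j = Inr (t', m)" "t \<in> T" "t' \<in> T"
      using i j by (auto simp: I_def Plus_def)
    then show "i = j"
    proof cases
      case 1 then show ?thesis using eq by (simp add: z_def)
    next
      case 2 then show ?thesis using eq mixed[of n t m] by (simp add: z_def)
    next
      case 3 then show ?thesis using eq mixed[of n t m] by (simp add: z_def)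
    next
      case 4
      then have *: "t + of_nat n = t' + of_nat m" using eq by (simp add: z_def)
      then have "t = t'" using Tdiff[of t t'] Ints_eq[OF *] 4 by blast
      then show ?thesis using * 4 by simp
    qed
  qed
  have degp: "degree p + 2 \<le> card I"
  proof -
    have "degree p \<le> N + N + Suc N + Suc N"
      unfolding p_def by (intro order_trans[OF degree_mult_le] add_mono degree_prod_linear_le)
    then show ?thesis unfolding cardI by simp
  qed
  have poly_p: "poly p s = pochhammer (1 - b - s) N * pochhammer (e + s) N * pochhammer (1 - c - s) (Suc N) *
     pochhammer (1 - d - s) (Suc N)" for s
    unfolding p_def poly_mult poly_prod_pochhammer ..
  have total: "(\<Sum>n\<le>N. poly p (z (Inl n)) / D (Inl n)) + (\<Sum>t\<in>T. \<Sum>n\<le>N. poly p (z (Inr (t, n))) / D (Inr (t, n))) = 0"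
  proof -
    have "(\<Sum>i\<in>I. poly p (z i) / D i) = 0" unfolding D_def
      by (rule sum_residues_eq_0[OF finI inj degp])
    then show ?thesis unfolding I_def by (simp add: sum.Plus finT sum.cartesian_product case_prod_beta)
  qed
  have sg: "(-1 :: complex) ^ (N - n) = (-1) ^ N * (-1) ^ n" if "n \<le> N" for n
  proof -
    obtain m where "N = n + m" using \<open>n \<le> N\<close> le_Suc_ex by blast
    then show ?thesis by (simp add: power_add)
  qed
  have ss: "(-1 :: complex) ^ j * (-1) ^ j = 1" for j by (simp flip: power_add)
  have upper: "poly p (z (Inl n)) / D (Inl n) = - ((-1) ^ N * res_upper N n a b c d e f g)" if n: "n \<le> N" for n
  proof -
    have set: "I - {Inl n} = ({..N} - {n}) <+> (T \<times> {..N})" by (auto simp: I_def Plus_def)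
    have own: "(\<Prod>k\<in>{..N} - {n}. (- a - of_nat n) - (- a - of_nat k)) = (-1) ^ n * (fact n * fact (N - n))"
    proof -
      have "(\<Prod>k\<in>{..N} - {n}. (- a - of_nat n) - (- a - of_nat k)) = (\<Prod>k\<in>{..N} - {n}. (-1) * (of_nat n - of_nat k))"
        by (rule prod.cong) simp_all
      also have "\<dots> = (-1) ^ N * (\<Prod>k\<in>{..N} - {n}. of_nat n - of_nat k)"
        using n by (simp only: prod.distrib prod_constant) simp
      finally show ?thesis unfolding prod_differences_omit[OF n] sg[OF n] using ss[of N] by (simp add: mult.assoc[symmetric])
    qed
    have "D (Inl n) = (-1) ^ n * (fact n * fact (N - n)) * (\<Prod>t\<in>T. \<Prod>k\<le>N. (- a - of_nat n) - (t + of_nat k))"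
      unfolding D_def set
      by (simp add: prod.Plus finT z_def own[simplified] prod.cartesian_product case_prod_beta)
    also have "(\<Prod>t\<in>T. \<Prod>k\<le>N. (- a - of_nat n) - (t + of_nat k)) =
       (\<Prod>t\<in>T. (-1) ^ Suc N * pochhammer (t - (- a - of_nat n)) (Suc N))"
      unfolding prod_descending_linear ..
    also have "\<dots> = - ((-1) ^ N * (pochhammer (a + of_nat n) (Suc N) * pochhammer (1 + a - f + of_nat n) (Suc N) *
        pochhammer (1 + a - g + of_nat n) (Suc N)))"
    proof -
      have h: "0 - (- a - of_nat n) = a + of_nat n" "1 - f - (- a - of_nat n) = 1 + a - f + of_nat n"
        "1 - g - (- a - of_nat n) = 1 + a - g + of_nat n" by simp_all
      have g3: "(-1) ^ Suc N * x * ((-1) ^ Suc N * y * ((-1) ^ Suc N * w)) = - ((-1) ^ N * (x * y * w))" for x y w :: complex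
      proof -
        have "(-1) ^ Suc N * x * ((-1) ^ Suc N * y * ((-1) ^ Suc N * w)) = ((-1) ^ Suc N * (-1) ^ Suc N) * ((-1) ^ Suc N * (x * y * w))"
          by (simp only: mult_ac)
        then show ?thesis unfolding ss by simp
      qed
      have prodT: "(\<Prod>t\<in>T. F t) = F 0 * (F (1 - f) * F (1 - g))" for F :: "complex \<Rightarrow> complex"
        using f1 by (simp add: T_def)
      show ?thesis unfolding prodT h g3 ..
    qed
    finally have D: "D (Inl n) = - ((-1) ^ N * ((-1) ^ n * (fact n * fact (N - n) * (pochhammer (a + of_nat n) (Suc N) *
        pochhammer (1 + a - f + of_nat n) (Suc N) * pochhammer (1 + a - g + of_nat n) (Suc N)))))"
      by simp
    have args: "1 - x - (- a - of_nat n) = 1 + a - x + of_nat n" "e + (- a - of_nat n) = e - a - of_nat n" for x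
      by simp_all
    have inv: "X / - (s * (t * Y)) = - (s * (t * X / Y))" if "s * s = 1" "t * t = 1" for s t X Y :: complex
    proof -
      have "inverse s = s" "inverse t = t" using that by (simp_all add: inverse_unique)
      then show ?thesis by (simp add: divide_inverse mult_ac)
    qed
    have "z (Inl n) = - a - of_nat n" by (simp add: z_def)
    then show ?thesis unfolding D inv[OF ss ss] res_upper_def poly_p by (simp only: args mult_ac)
  qed
  have lower: "poly p (z (Inr (t, n))) / D (Inr (t, n)) = (-1) ^ N *
      res_lower N n (a + t) (b + t) (c + t) (d + t) (e + t) (1 + t - t1) (1 + t - t2)"
    if n: "n \<le> N" and T: "T = {t, t1, t2}" "t \<noteq> t1" "t \<noteq> t2" "t1 \<noteq> t2" for n t t1 t2
  proof -
    have set: "I - {Inr (t, n)} = {..N} <+> (({t} \<times> ({..N} - {n})) \<union> ({t1, t2} \<times> {..N}))"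
      using T by (auto simp: I_def Plus_def)
    have "D (Inr (t, n)) = (\<Prod>k\<le>N. (t + of_nat n) - (- a - of_nat k)) *
       (\<Prod>(t', k)\<in>({t} \<times> ({..N} - {n})) \<union> ({t1, t2} \<times> {..N}). (t + of_nat n) - (t' + of_nat k))"
      unfolding D_def set by (simp add: prod.Plus z_def case_prod_beta)
    also have "(\<Prod>(t', k)\<in>({t} \<times> ({..N} - {n})) \<union> ({t1, t2} \<times> {..N}). (t + of_nat n) - (t' + of_nat k)) =
       (\<Prod>(t', k)\<in>{t} \<times> ({..N} - {n}). (t + of_nat n) - (t' + of_nat k)) *
       (\<Prod>(t', k)\<in>{t1, t2} \<times> {..N}. (t + of_nat n) - (t' + of_nat k))"
      by (rule prod.union_disjoint) (use T in auto)
    also have "(\<Prod>(t', k)\<in>{t} \<times> ({..N} - {n}). (t + of_nat n) - (t' + of_nat k)) = (-1) ^ N * ((-1) ^ n * (fact n * fact (N - n)))"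
      unfolding prod.cartesian_product[symmetric] using prod_differences_omit[OF n] sg[OF n] by simp
    also have "(\<Prod>(t', k)\<in>{t1, t2} \<times> {..N}. (t + of_nat n) - (t' + of_nat k)) =
       pochhammer (t1 - (t + of_nat n)) (Suc N) * pochhammer (t2 - (t + of_nat n)) (Suc N)"
    proof -
      have "(\<Prod>(t', k)\<in>{t1, t2} \<times> {..N}. (t + of_nat n) - (t' + of_nat k)) =
        (-1) ^ Suc N * pochhammer (t1 - (t + of_nat n)) (Suc N) * ((-1) ^ Suc N * pochhammer (t2 - (t + of_nat n)) (Suc N))"
        unfolding prod.cartesian_product[symmetric] prod_descending_linear using T(4) by (simp del: power_Suc)
      also have "\<dots> = ((-1) ^ Suc N * (-1) ^ Suc N) * (pochhammer (t1 - (t + of_nat n)) (Suc N) * pochhammer (t2 - (t + of_nat n)) (Suc N))"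
        by (simp only: mult_ac)
      finally show ?thesis unfolding ss by simp
    qed
    also have "(\<Prod>k\<le>N. (t + of_nat n) - (- a - of_nat k)) = pochhammer (a + t + of_nat n) (Suc N)"
      unfolding pochhammer_Suc_prod atLeast0AtMost by (rule prod.cong) simp_all
    finally have D: "D (Inr (t, n)) = (-1) ^ N * ((-1) ^ n * (fact n * fact (N - n) * (pochhammer (a + t + of_nat n) (Suc N) *
      (pochhammer (t1 - (t + of_nat n)) (Suc N) * pochhammer (t2 - (t + of_nat n)) (Suc N)))))"
      by (simp only: mult_ac)
    have inv: "X / (s * (t * Y)) = s * (t * X / Y)" if "s * s = 1" "t * t = 1" for s t X Y :: complex
    proof -
      have "inverse s = s" "inverse t = t" using that by (simp_all add: inverse_unique)
      then show ?thesis by (simp add: divide_inverse mult_ac)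
    qed
    have args: "1 - (x + t) - of_nat n = 1 - x - (t + of_nat n)" "1 - (1 + t - y) - of_nat n = y - (t + of_nat n)"
       "e + t + of_nat n = e + (t + of_nat n)" for x y by simp_all
    have "z (Inr (t, n)) = t + of_nat n" by (simp add: z_def)
    then show ?thesis unfolding D inv[OF ss ss] res_lower_def poly_p args by (simp only: mult_ac)
  qed
  have l0: "poly p (z (Inr (0, n))) / D (Inr (0, n)) = (-1) ^ N * res_lower N n a b c d e f g" if "n \<le> N" for n
    using lower[OF that, of 0 "1 - f" "1 - g"] f1 by (simp add: T_def)
  have lf: "poly p (z (Inr (1 - f, n))) / D (Inr (1 - f, n)) = (-1) ^ N *
      res_lower N n (1 + a - f) (1 + b - f) (1 + c - f) (1 + d - f) (1 + e - f) (2 - f) (1 + g - f)" if "n \<le> N" for n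
  proof -
    have T': "T = {1 - f, 0, 1 - g}" by (auto simp: T_def)
    have 1: "1 + (1 - f) - 0 = 2 - f" "1 + (1 - f) - (1 - g) = 1 + g - f" by simp_all
    have 2: "x + (1 - f) = 1 + x - f" for x by simp
    show ?thesis using lower[OF that T' f1(1) f1(3) f1(2)[symmetric]] unfolding 1 unfolding 2 .
  qed
  have lg: "poly p (z (Inr (1 - g, n))) / D (Inr (1 - g, n)) = (-1) ^ N *
      res_lower N n (1 + a - g) (1 + b - g) (1 + c - g) (1 + d - g) (1 + e - g) (2 - g) (1 + f - g)" if "n \<le> N" for n
  proof -
    have T': "T = {1 - g, 0, 1 - f}" by (auto simp: T_def)
    have 1: "1 + (1 - g) - 0 = 2 - g" "1 + (1 - g) - (1 - f) = 1 + f - g" by simp_all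
    have 2: "x + (1 - g) = 1 + x - g" for x by simp
    show ?thesis using lower[OF that T' f1(2) f1(3)[symmetric] f1(1)[symmetric]] unfolding 1 unfolding 2 .
  qed
  have sumT: "(\<Sum>t\<in>T. F t) = F 0 + F (1 - f) + F (1 - g)" for F :: "complex \<Rightarrow> complex"
    using f1 by (simp add: T_def add.assoc)
  have "(\<Sum>n\<le>N. - ((-1) ^ N * res_upper N n a b c d e f g)) +
     ((\<Sum>n\<le>N. (-1) ^ N * res_lower N n a b c d e f g) +
     (\<Sum>n\<le>N. (-1) ^ N * res_lower N n (1 + a - f) (1 + b - f) (1 + c - f) (1 + d - f) (1 + e - f) (2 - f) (1 + g - f)) +
     (\<Sum>n\<le>N. (-1) ^ N * res_lower N n (1 + a - g) (1 + b - g) (1 + c - g) (1 + d - g) (1 + e - g) (2 - g) (1 + f - g))) = 0"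
    using total unfolding sumT using upper l0 lf lg by simp
  then have "(-1) ^ N * ((\<Sum>n\<le>N. res_lower N n a b c d e f g) +
     (\<Sum>n\<le>N. res_lower N n (1 + a - f) (1 + b - f) (1 + c - f) (1 + d - f) (1 + e - f) (2 - f) (1 + g - f)) +
     (\<Sum>n\<le>N. res_lower N n (1 + a - g) (1 + b - g) (1 + c - g) (1 + d - g) (1 + e - g) (2 - g) (1 + f - g))) =
     (-1) ^ N * (\<Sum>n\<le>N. res_upper N n a b c d e f g)"
    by (simp add: sum_negf sum_distrib_left[symmetric] distrib_left)
  then show ?thesis by simp
qed

text \<open>Each residue is a term of the limiting series times a kernel in \<open>N - n\<close> and
  \<open>N + n\<close>. The Gamma factors in \<open>N - n\<close> contribute the power
  \<open>\<sigma> = 1 + a - e\<close>, by the balance, and those in \<open>N + n\<close> the power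
  \<open>- \<sigma>\<close>. The bounds on \<open>Re (e - a)\<close> say exactly that
  \<open>\<bar>Re \<sigma>\<bar> < 1\<close>.\<close>

lemma res_lower_limit:
  fixes a b c d e f g :: complex
  assumes bal: "e + f + g - a - b - c - d = 1" and re: "0 < Re (e - a)" "Re (e - a) < 2"
    and a: "a \<notin> \<int>" and b: "b \<notin> \<int>" and c: "c \<notin> \<int>" and d: "d \<notin> \<int>"
    and e: "e \<notin> \<int>" and f: "f \<notin> \<int>" and g: "g \<notin> \<int>"
  shows "(\<lambda>N. \<Sum>n\<le>N. res_lower N n a b c d e f g) \<longlonglongrightarrow>
     sinpi b * sinpi c * sinpi d / (of_real pi * sinpi f * sinpi g) * Phi a b c d e f g"
proof -
  note N = not_Ints_not_nonpos_Ints
  define \<sigma> where "\<sigma> = 1 + a - e"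
  define H1 where "H1 M = Gamma_normal (1 - b) M * Gamma_normal (2 - c) M * Gamma_normal (2 - d) M / (Gamma_normal (2 - f) M * Gamma_normal (2 - g) M)" for M
  define H2 where "H2 K = Gamma_normal e K / Gamma_normal (1 + a) K" for K
  define C where "C = sinpi b * sinpi c * sinpi d / (of_real pi * sinpi f * sinpi g)"
  have nI: "1 - b \<notin> \<int>" "2 - c \<notin> \<int>" "2 - d \<notin> \<int>" "2 - f \<notin> \<int>" "2 - g \<notin> \<int>" "1 + a \<notin> \<int>"
    using diff_not_Ints[OF b, of 1] diff_not_Ints[OF c, of 2] diff_not_Ints[OF d, of 2]
      diff_not_Ints[OF f, of 2] diff_not_Ints[OF g, of 2] not_Ints_shift[OF a, of "1 + a" 1] by simp_all
  have H1: "H1 \<longlonglongrightarrow> 1"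
  proof -
    have "H1 \<longlonglongrightarrow> 1 * 1 * 1 / (1 * 1)" unfolding H1_def
      by (intro tendsto_divide tendsto_mult Gamma_normal_tendsto_1 N nI) simp
    then show ?thesis by simp
  qed
  have H2: "H2 \<longlonglongrightarrow> 1"
  proof -
    have "H2 \<longlonglongrightarrow> 1 / 1" unfolding H2_def
      by (intro tendsto_divide Gamma_normal_tendsto_1 N nI e) simp
    then show ?thesis by simp
  qed
  have re': "\<bar>Re \<sigma>\<bar> < 1" using re by (simp add: \<sigma>_def)
  have x: "(\<lambda>n. of_nat (Suc n) ^ 2 * Phi_term a b c d e f g n) \<longlonglongrightarrow> 1"
    by (rule Phi_term_asymp[OF bal]) (intro N a b c d e f g)+
  have eq: "res_lower N n a b c d e f g = C * (Phi_term a b c d e f g n * (H1 (N - n) * H2 (N + n) *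
     (of_nat (Suc (N - n)) powr \<sigma> / of_nat (Suc (N + n)) powr \<sigma>)))" if "n \<le> N" for N n
  proof -
    define M where "M = N - n"
    have NM: "N = n + M" "Suc N = n + Suc M" using that by (simp_all add: M_def)
    define u where "u = (of_nat (Suc M) :: complex)"
    define w where "w = (of_nat (Suc (N + n)) :: complex)"
    have uw: "u \<noteq> 0" "w \<noteq> 0" unfolding u_def w_def by (rule of_nat_neq_0)+
    have gs: "Gamma (1 - y + of_nat (Suc M)) = Gamma (2 - y + of_nat M)" for y :: complex
      by (rule arg_cong[where f = Gamma]) simp
    define s where "s = ((-1) ^ n :: complex)"
    have ss: "s * s = 1" by (simp add: s_def flip: power_add)
    have s0: "s \<noteq> 0" using ss by auto
    have pe: "pochhammer (e + of_nat n) N = Gamma (e + of_nat (N + n)) / Gamma (e + of_nat n)"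
      using pochhammer_Gamma[OF add_of_nat_not_nonpos_Ints(1)[OF N[OF e]], of n N] by (simp add: add_ac)
    have pa: "pochhammer (a + of_nat n) (Suc N) = Gamma (1 + a + of_nat (N + n)) / Gamma (a + of_nat n)"
      using pochhammer_Gamma[OF add_of_nat_not_nonpos_Ints(1)[OF N[OF a]], of n "Suc N"] by (simp add: add_ac)
    have pb: "pochhammer (1 - b - of_nat n) N = Gamma (1 - b + of_nat M) * Gamma (b + of_nat n) * (s * (sinpi b / of_real pi))"
      unfolding NM(1) pochhammer_cross[OF b] s_def ..
    have py: "pochhammer (1 - y - of_nat n) (Suc N) = Gamma (2 - y + of_nat M) * Gamma (y + of_nat n) * (s * (sinpi y / of_real pi))"
      if "y \<notin> \<int>" for y
      unfolding NM(2) pochhammer_cross[OF that] s_def gs ..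
    have k1: "Gamma (1 - b + of_nat M) * Gamma (2 - c + of_nat M) * Gamma (2 - d + of_nat M) /
       (fact M * Gamma (2 - f + of_nat M) * Gamma (2 - g + of_nat M)) = H1 M * u powr \<sigma>"
    proof -
      have "u powr (1 - b - 1) * u powr (2 - c - 1) * u powr (2 - d - 1) = u powr \<sigma> * (u powr (2 - f - 1) * u powr (2 - g - 1))"
        unfolding powr_add[symmetric] by (rule arg_cong) (use bal in \<open>simp add: \<sigma>_def algebra_simps\<close>)
      moreover have "(F * p1 * g1) * (F * p2 * g2) * (F * p3 * g3) / (F * (F * q1 * h1) * (F * q2 * h2)) =
         g1 * g2 * g3 / (h1 * h2) * S" if "p1 * p2 * p3 = S * (q1 * q2)" "F \<noteq> 0" "q1 \<noteq> 0" "q2 \<noteq> 0" for F p1 p2 p3 q1 q2 g1 g2 g3 h1 h2 S :: complex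
      proof -
        have "(F * p1 * g1) * (F * p2 * g2) * (F * p3 * g3) = F * F * F * (p1 * p2 * p3) * (g1 * g2 * g3)" by (simp only: mult_ac)
        also have "\<dots> / (F * (F * q1 * h1) * (F * q2 * h2)) = g1 * g2 * g3 / (h1 * h2) * S"
          unfolding that(1) using that(2-4) by simp
        finally show ?thesis .
      qed
      ultimately show ?thesis unfolding Gamma_eq_Gamma_normal u_def[symmetric] H1_def using uw by simp
    qed
    have k2: "Gamma (e + of_nat (N + n)) / Gamma (1 + a + of_nat (N + n)) = H2 (N + n) / w powr \<sigma>"
    proof -
      have *: "w powr (1 + a - 1) = w powr \<sigma> * w powr (e - 1)"
        unfolding powr_add[symmetric] by (rule arg_cong) (simp add: \<sigma>_def)
      show ?thesis unfolding Gamma_eq_Gamma_normal w_def[symmetric] H2_def * using uw by simp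
    qed
    have "res_lower N n a b c d e f g = C * (Phi_term a b c d e f g n *
      ((Gamma (1 - b + of_nat M) * Gamma (2 - c + of_nat M) * Gamma (2 - d + of_nat M) /
       (fact M * Gamma (2 - f + of_nat M) * Gamma (2 - g + of_nat M))) *
      (Gamma (e + of_nat (N + n)) / Gamma (1 + a + of_nat (N + n)))))"
      unfolding res_lower_def M_def[symmetric] s_def[symmetric] pe pa pb py[OF c] py[OF d] py[OF f] py[OF g] C_def Phi_term_def
      using ss s0 by (simp add: mult_ac)
    then show ?thesis unfolding k1 k2 unfolding u_def w_def M_def by simp
  qed
  have "(\<lambda>N. C * (\<Sum>n\<le>N. Phi_term a b c d e f g n * (H1 (N - n) * H2 (N + n) *
     (of_nat (Suc (N - n)) powr \<sigma> / of_nat (Suc (N + n)) powr \<sigma>)))) \<longlonglongrightarrow> C * suminf (Phi_term a b c d e f g)"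
    by (intro tendsto_mult tendsto_const kernel_sum_limit[OF x H1 H2 re'])
  moreover have "(\<Sum>n\<le>N. res_lower N n a b c d e f g) = C * (\<Sum>n\<le>N. Phi_term a b c d e f g n * (H1 (N - n) * H2 (N + n) *
     (of_nat (Suc (N - n)) powr \<sigma> / of_nat (Suc (N + n)) powr \<sigma>)))" for N
    unfolding sum_distrib_left by (rule sum.cong) (simp_all only: eq atMost_iff)
  ultimately show ?thesis unfolding C_def[symmetric] Phi_def by simp
qed

lemma res_upper_limit:
  fixes a b c d e f g :: complex
  assumes bal: "e + f + g - a - b - c - d = 1" and re: "0 < Re (e - a)" "Re (e - a) < 2"
    and a: "a \<notin> \<int>" and ab: "a - b \<notin> \<int>" and ac: "a - c \<notin> \<int>" and ad: "a - d \<notin> \<int>"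
    and ae: "e - a \<notin> \<int>" and af: "f - a \<notin> \<int>" and ag: "g - a \<notin> \<int>"
  shows "(\<lambda>N. \<Sum>n\<le>N. res_upper N n a b c d e f g) \<longlonglongrightarrow>
     sinpi (e - a) / of_real pi * Phi a (1 + a - e) (1 + a - f) (1 + a - g) (1 + a - b) (1 + a - c) (1 + a - d)"
proof -
  note N = not_Ints_not_nonpos_Ints
  \<comment> \<open>The negative of the exponent for the lower chains, so the same bounds on
    \<open>Re (e - a)\<close> control both kinds of residues.\<close>
  define \<tau> where "\<tau> = e - a - 1"
  define H1 where "H1 = Gamma_normal (e - a)"
  define H2 where "H2 K = Gamma_normal (1 + a - b) K * Gamma_normal (2 + a - c) K * Gamma_normal (2 + a - d) K /
    (Gamma_normal (1 + a) K * Gamma_normal (2 + a - f) K * Gamma_normal (2 + a - g) K)" for K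
  define C where "C = sinpi (e - a) / of_real pi"
  have nI: "1 + a - b \<notin> \<int>" "2 + a - c \<notin> \<int>" "2 + a - d \<notin> \<int>" "2 + a - f \<notin> \<int>" "2 + a - g \<notin> \<int>" "1 + a \<notin> \<int>"
    "1 + a - c \<notin> \<int>" "1 + a - d \<notin> \<int>" "1 + a - e \<notin> \<int>" "1 + a - f \<notin> \<int>" "1 + a - g \<notin> \<int>"
    using not_Ints_shift[OF ab, of "1 + a - b" 1] not_Ints_shift[OF ac, of "2 + a - c" 2] not_Ints_shift[OF ad, of "2 + a - d" 2]
      diff_not_Ints[OF af, of 2] diff_not_Ints[OF ag, of 2] not_Ints_shift[OF a, of "1 + a" 1]
      not_Ints_shift[OF ac, of "1 + a - c" 1] not_Ints_shift[OF ad, of "1 + a - d" 1]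
      one_plus_minus_not_Ints[OF ae] one_plus_minus_not_Ints[OF af] one_plus_minus_not_Ints[OF ag]
    by (simp_all add: algebra_simps)
  have H1: "H1 \<longlonglongrightarrow> 1" unfolding H1_def by (intro Gamma_normal_tendsto_1 N ae)
  have H2: "H2 \<longlonglongrightarrow> 1"
  proof -
    have "H2 \<longlonglongrightarrow> 1 * 1 * 1 / (1 * 1 * 1)" unfolding H2_def
      by (intro tendsto_divide tendsto_mult Gamma_normal_tendsto_1 N nI) simp
    then show ?thesis by simp
  qed
  have re': "\<bar>Re \<tau>\<bar> < 1" using re by (simp add: \<tau>_def)
  define y where "y = Phi_term a (1 + a - e) (1 + a - f) (1 + a - g) (1 + a - b) (1 + a - c) (1 + a - d)"
  have x: "(\<lambda>n. of_nat (Suc n) ^ 2 * y n) \<longlonglongrightarrow> 1"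
    unfolding y_def by (rule Phi_term_asymp) (use bal in \<open>simp add: algebra_simps\<close>, (intro N a nI)+)
  have eq: "res_upper N n a b c d e f g = C * (y n * (H1 (N - n) * H2 (N + n) *
     (of_nat (Suc (N - n)) powr \<tau> / of_nat (Suc (N + n)) powr \<tau>)))" if "n \<le> N" for N n
  proof -
    define M where "M = N - n"
    have NM: "N = n + M" using that by (simp add: M_def)
    define u where "u = (of_nat (Suc M) :: complex)"
    define w where "w = (of_nat (Suc (N + n)) :: complex)"
    have uw: "u \<noteq> 0" "w \<noteq> 0" unfolding u_def w_def by (rule of_nat_neq_0)+
    define s where "s = ((-1) ^ n :: complex)"
    have ss: "s * s = 1" by (simp add: s_def flip: power_add)
    have pe: "pochhammer (e - a - of_nat n) N = Gamma (e - a + of_nat M) * Gamma (1 + a - e + of_nat n) * (s * (sinpi (e - a) / of_real pi))"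
    proof -
      have 1: "e - a - of_nat n = 1 - (1 + a - e) - of_nat n" "1 - (1 + a - e) = e - a" by simp_all
      have 2: "sinpi (1 + a - e) = sinpi (e - a)"
      proof -
        have "of_real pi * (1 + a - e) = of_real pi - of_real pi * (e - a)" by (simp add: algebra_simps)
        then show ?thesis by (simp only: sin_diff) (simp add: sin_of_real cos_of_real)
      qed
      show ?thesis unfolding 1(1) NM pochhammer_cross[OF nI(9)] unfolding s_def 1(2) 2 ..
    qed
    have pN: "pochhammer (y + of_nat n) N = Gamma (y + of_nat (N + n)) / Gamma (y + of_nat n)" if "y \<notin> \<int>" for y :: complex
      using pochhammer_Gamma[OF add_of_nat_not_nonpos_Ints(1)[OF N[OF that]], of n N] by (simp add: add_ac)
    have pS: "pochhammer (y + of_nat n) (Suc N) = Gamma (1 + y + of_nat (N + n)) / Gamma (y + of_nat n)" if "y \<notin> \<int>" for y :: complex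
      using pochhammer_Gamma[OF add_of_nat_not_nonpos_Ints(1)[OF N[OF that]], of n "Suc N"] by (simp add: add_ac)
    have two: "1 + (1 + a - y) = 2 + a - y" for y by simp
    have k1: "Gamma (e - a + of_nat M) / fact M = H1 M * u powr \<tau>"
      unfolding Gamma_eq_Gamma_normal u_def H1_def \<tau>_def by simp
    have k2: "Gamma (1 + a - b + of_nat (N + n)) * Gamma (2 + a - c + of_nat (N + n)) * Gamma (2 + a - d + of_nat (N + n)) /
       (Gamma (1 + a + of_nat (N + n)) * Gamma (2 + a - f + of_nat (N + n)) * Gamma (2 + a - g + of_nat (N + n))) = H2 (N + n) / w powr \<tau>"
    proof -
      have "w powr \<tau> * (w powr (1 + a - b - 1) * w powr (2 + a - c - 1) * w powr (2 + a - d - 1)) =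
          w powr (1 + a - 1) * w powr (2 + a - f - 1) * w powr (2 + a - g - 1)"
        unfolding powr_add[symmetric] by (rule arg_cong) (use bal in \<open>simp add: \<tau>_def algebra_simps\<close>)
      moreover have "(F * p1 * g1) * (F * p2 * g2) * (F * p3 * g3) / ((F * q1 * h1) * (F * q2 * h2) * (F * q3 * h3)) =
         g1 * g2 * g3 / (h1 * h2 * h3) / S" if "S * (p1 * p2 * p3) = q1 * q2 * q3" "F \<noteq> 0" "S \<noteq> 0" "p1 \<noteq> 0" "p2 \<noteq> 0" "p3 \<noteq> 0" for F p1 p2 p3 q1 q2 q3 g1 g2 g3 h1 h2 h3 S :: complex
      proof -
        have "(F * q1 * h1) * (F * q2 * h2) * (F * q3 * h3) = F * F * F * (q1 * q2 * q3) * (h1 * h2 * h3)" by (simp only: mult_ac)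
        also have "(F * p1 * g1) * (F * p2 * g2) * (F * p3 * g3) / \<dots> = g1 * g2 * g3 / (h1 * h2 * h3) / S"
          unfolding that(1)[symmetric] using that(2-6) by (simp add: mult_ac)
        finally show ?thesis .
      qed
      ultimately show ?thesis unfolding Gamma_eq_Gamma_normal w_def[symmetric] H2_def using uw by simp
    qed
    have "res_upper N n a b c d e f g = C * (y n * ((Gamma (e - a + of_nat M) / fact M) *
      (Gamma (1 + a - b + of_nat (N + n)) * Gamma (2 + a - c + of_nat (N + n)) * Gamma (2 + a - d + of_nat (N + n)) /
       (Gamma (1 + a + of_nat (N + n)) * Gamma (2 + a - f + of_nat (N + n)) * Gamma (2 + a - g + of_nat (N + n))))))"
      unfolding res_upper_def M_def[symmetric] s_def[symmetric] pe pN[OF nI(1)] pS[OF a] pS[OF nI(7)] pS[OF nI(8)]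
        pS[OF nI(10)] pS[OF nI(11)] two C_def y_def Phi_term_def
      using ss by (simp add: mult_ac)
    then show ?thesis unfolding k1 k2 unfolding u_def w_def M_def by simp
  qed
  have "(\<lambda>N. C * (\<Sum>n\<le>N. y n * (H1 (N - n) * H2 (N + n) *
     (of_nat (Suc (N - n)) powr \<tau> / of_nat (Suc (N + n)) powr \<tau>)))) \<longlonglongrightarrow> C * suminf y"
    by (intro tendsto_mult tendsto_const kernel_sum_limit[OF x H1 H2 re'])
  moreover have "(\<Sum>n\<le>N. res_upper N n a b c d e f g) = C * (\<Sum>n\<le>N. y n * (H1 (N - n) * H2 (N + n) *
     (of_nat (Suc (N - n)) powr \<tau> / of_nat (Suc (N + n)) powr \<tau>)))" for N
    unfolding sum_distrib_left by (rule sum.cong) (simp_all only: eq atMost_iff)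
  ultimately show ?thesis unfolding C_def[symmetric] Phi_def y_def[symmetric] by simp
qed

section \<open>The regularised series as an entire function\<close>

text \<open>From \<open>Ln (1 + z) = z\<close> up to an error of at most
  \<open>2 * norm z ^ 2\<close>. Exponential bounds are convenient because the real parts of several
  factors simply add up.\<close>

lemma norm_one_plus_bounds:
  fixes z :: complex
  assumes "norm z \<le> 1 / 2"
  shows "norm (1 + z) \<le> exp (Re z + 2 * norm z ^ 2)" and "exp (Re z - 2 * norm z ^ 2) \<le> norm (1 + z)"
proof -
  have z1: "norm z < 1" using assms by simp
  then have nz: "1 + z \<noteq> 0" by (metis add.commute add_eq_0_iff less_irrefl norm_minus_cancel norm_one)
  have "norm (Ln (1 + z) - z) \<le> norm z ^ 2 / (1 - norm z)" by (rule Ln_approx_linear[OF z1])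
  also have "\<dots> \<le> norm z ^ 2 / (1 / 2)" using assms by (intro divide_left_mono) auto
  finally have b: "norm (Ln (1 + z) - z) \<le> 2 * norm z ^ 2" by simp
  have "\<bar>Re (Ln (1 + z)) - Re z\<bar> \<le> 2 * norm z ^ 2"
    using order_trans[OF abs_Re_le_cmod b] by simp
  moreover have "norm (1 + z) = exp (Re (Ln (1 + z)))"
    using nz by (metis exp_Ln norm_exp_eq_Re)
  ultimately show "norm (1 + z) \<le> exp (Re z + 2 * norm z ^ 2)" "exp (Re z - 2 * norm z ^ 2) \<le> norm (1 + z)"
    by (simp_all add: abs_le_iff)
qed

text \<open>
  Dividing by \<open>\<Gamma>(e) \<Gamma>(f) \<Gamma>(g)\<close> removes the poles at nonpositive integral lower parameters, so that the sum is
  an entire function on \<open>V\<close>.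
\<close>

definition hyp_reg_term :: "complex \<Rightarrow> complex \<Rightarrow> complex \<Rightarrow> complex \<Rightarrow> complex \<Rightarrow> complex \<Rightarrow> complex \<Rightarrow> nat \<Rightarrow> complex" where
  "hyp_reg_term a b c d e f g n = pochhammer a n * pochhammer b n * pochhammer c n * pochhammer d n / fact n *
     (rGamma (e + of_nat n) * rGamma (f + of_nat n) * rGamma (g + of_nat n))"

lemma norm_shift_bounds:
  fixes x :: complex and R :: real
  assumes x: "norm x \<le> R" and n: "2 * R \<le> real n" "0 < n"
  shows "norm (x + of_nat n) \<le> real n * exp (Re x / real n + 2 * (R / real n) ^ 2)"
    and "real n * exp (Re x / real n - 2 * (R / real n) ^ 2) \<le> norm (x + of_nat n)"
proof -
  define z where "z = x / of_nat n"
  have R0: "R \<ge> 0" using order_trans[OF norm_ge_zero x] .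
  have nz: "norm z \<le> R / real n" using x n by (simp add: z_def norm_divide divide_right_mono)
  also have "\<dots> \<le> 1 / 2" using n by (simp add: field_simps)
  finally have half: "norm z \<le> 1 / 2" .
  have rez: "Re z = Re x / real n" by (simp add: z_def Re_divide_of_nat)
  have sq: "norm z ^ 2 \<le> (R / real n) ^ 2" using nz by (intro power_mono) auto
  have "x + of_nat n = of_nat n * (1 + z)" using n by (simp add: z_def field_simps)
  then have eq: "norm (x + of_nat n) = real n * norm (1 + z)" by (simp add: norm_mult)
  have "norm (1 + z) \<le> exp (Re x / real n + 2 * (R / real n) ^ 2)"
    using norm_one_plus_bounds(1)[OF half] sq unfolding rez by (smt (verit) exp_le_cancel_iff)
  then show "norm (x + of_nat n) \<le> real n * exp (Re x / real n + 2 * (R / real n) ^ 2)"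
    unfolding eq by (intro mult_left_mono) auto
  have "exp (Re x / real n - 2 * (R / real n) ^ 2) \<le> norm (1 + z)"
    using norm_one_plus_bounds(2)[OF half] sq unfolding rez by (smt (verit) exp_le_cancel_iff)
  then show "real n * exp (Re x / real n - 2 * (R / real n) ^ 2) \<le> norm (x + of_nat n)"
    unfolding eq by (intro mult_left_mono) auto
qed

text \<open>By the balance, the ratio of consecutive terms is at most
  \<open>exp (-2 / n + 16 R^2 / n^2)\<close> in norm. The exponent \<open>3 / 2\<close> is large
  enough for summability and stays below 2; the margin \<open>1 / (2 n)\<close> absorbs the
  quadratic error as soon as \<open>n \<ge> 32 R^2\<close>. The bound is thereby uniform over all
  parameters of norm at most \<open>R\<close>.\<close>

lemma hyp_reg_term_Suc_bound:
  fixes a b c d e f g :: complex and R :: real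
  assumes bal: "e + f + g - a - b - c - d = 1" and R1: "1 \<le> R"
    and R: "norm a \<le> R" "norm b \<le> R" "norm c \<le> R" "norm d \<le> R" "norm e \<le> R" "norm f \<le> R" "norm g \<le> R"
    and n: "32 * R ^ 2 \<le> real n"
  shows "norm (hyp_reg_term a b c d e f g (Suc n)) * real (Suc n) powr (3 / 2) \<le> norm (hyp_reg_term a b c d e f g n) * real n powr (3 / 2)"
proof -
  have RR: "R \<le> R ^ 2" using R1 by (simp add: power2_eq_square)
  have n2: "2 * R \<le> real n" using n RR R1 by linarith
  have n0: "0 < n" using n2 R1 by (cases n) auto
  define u where "u = 2 * (R / real n) ^ 2"
  note up = norm_shift_bounds(1)[OF _ n2 n0, folded u_def]
  note lo = norm_shift_bounds(2)[OF _ n2 n0, folded u_def]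
  have nz: "x + of_nat n \<noteq> 0" if "norm x \<le> R" for x :: complex
  proof -
    have "0 < real n * exp (Re x / real n - u)" using n0 by simp
    also have "\<dots> \<le> norm (x + of_nat n)" by (rule lo[OF that])
    finally show ?thesis by auto
  qed
  define num where "num = norm (a + of_nat n) * norm (b + of_nat n) * norm (c + of_nat n) * norm (d + of_nat n)"
  define den where "den = norm (1 + of_nat n :: complex) * norm (e + of_nat n) * norm (f + of_nat n) * norm (g + of_nat n)"
  have R1': "norm (1 :: complex) \<le> R" using R1 by simp
  have den0: "den > 0" using nz[OF R1'] nz[OF R(5)] nz[OF R(6)] nz[OF R(7)] by (simp add: den_def)
  have rec: "norm (hyp_reg_term a b c d e f g (Suc n)) * den = norm (hyp_reg_term a b c d e f g n) * num"
  proof -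
    have rg: "rGamma (x + of_nat n) = (x + of_nat n) * rGamma (x + of_nat (Suc n))" for x :: complex
      using rGamma_plus1[of "x + of_nat n"] by (simp add: add_ac)
    have "hyp_reg_term a b c d e f g (Suc n) * ((1 + of_nat n) * (e + of_nat n) * (f + of_nat n) * (g + of_nat n)) =
      hyp_reg_term a b c d e f g n * ((a + of_nat n) * (b + of_nat n) * (c + of_nat n) * (d + of_nat n))"
      unfolding hyp_reg_term_def rg[of e] rg[of f] rg[of g] pochhammer_Suc fact_Suc
      using nz[OF R1'] by simp
    then show ?thesis unfolding num_def den_def norm_mult[symmetric] by simp
  qed
  have num_le: "num \<le> real n ^ 4 * exp ((Re a + Re b + Re c + Re d) / real n + 4 * u)"
  proof -
    have "num \<le> (real n * exp (Re a / real n + u)) * (real n * exp (Re b / real n + u)) *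
       (real n * exp (Re c / real n + u)) * (real n * exp (Re d / real n + u))"
      unfolding num_def by (intro mult_mono up R) auto
    also have "\<dots> = real n ^ 4 * (exp (Re a / real n + u) * exp (Re b / real n + u) * exp (Re c / real n + u) * exp (Re d / real n + u))"
      by (simp add: power4_eq_xxxx)
    also have "\<dots> = real n ^ 4 * exp ((Re a + Re b + Re c + Re d) / real n + 4 * u)"
      unfolding exp_add[symmetric] by (simp add: add_divide_distrib algebra_simps)
    finally show ?thesis .
  qed
  have den_ge: "real n ^ 4 * exp ((1 + Re e + Re f + Re g) / real n - 4 * u) \<le> den"
  proof -
    have "(real n * exp (Re 1 / real n - u)) * (real n * exp (Re e / real n - u)) *
       (real n * exp (Re f / real n - u)) * (real n * exp (Re g / real n - u)) \<le> den"
      unfolding den_def by (intro mult_mono lo R R1') auto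
    also have "(real n * exp (Re 1 / real n - u)) * (real n * exp (Re e / real n - u)) *
       (real n * exp (Re f / real n - u)) * (real n * exp (Re g / real n - u)) =
       real n ^ 4 * (exp (Re 1 / real n - u) * exp (Re e / real n - u) * exp (Re f / real n - u) * exp (Re g / real n - u))"
      by (simp add: power4_eq_xxxx)
    also have "\<dots> = real n ^ 4 * exp ((1 + Re e + Re f + Re g) / real n - 4 * u)"
      unfolding exp_add[symmetric] by (simp add: add_divide_distrib algebra_simps)
    finally show ?thesis .
  qed
  have small: "8 * u \<le> 1 / (2 * real n)"
  proof -
    have "8 * u = 16 * R ^ 2 / real n ^ 2" by (simp add: u_def power_divide)
    also have "\<dots> \<le> (real n / 2) / real n ^ 2" using n by (intro divide_right_mono) auto
    also have "\<dots> = 1 / (2 * real n)" using n0 by (simp add: power2_eq_square)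
    finally show ?thesis .
  qed
  have Re_bal: "1 + Re e + Re f + Re g = Re a + Re b + Re c + Re d + 2"
    using arg_cong[OF bal, of Re] by simp
  have "exp (- (3 / 2) / real n) * real (Suc n) powr (3 / 2) \<le> real n powr (3 / 2)"
  proof -
    have "ln (real (Suc n)) - ln (real n) \<le> 1 / real n"
    proof -
      have 1: "1 + 1 / real n = real (Suc n) / real n" using n0 by (simp add: field_simps)
      have "ln (real (Suc n) / real n) \<le> 1 / real n"
        using ln_add_one_self_le_self[of "1 / real n"] unfolding 1 by simp
      moreover have "ln (real (Suc n) / real n) = ln (real (Suc n)) - ln (real n)"
        using n0 by (simp add: ln_div del: of_nat_Suc)
      ultimately show ?thesis by simp
    qed
    then have "(3 / 2) * (ln (real (Suc n)) - ln (real n)) \<le> (3 / 2) * (1 / real n)" by (intro mult_left_mono) auto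
    then have "- (3 / 2) / real n + 3 / 2 * ln (real (Suc n)) \<le> 3 / 2 * ln (real n)" by (simp add: algebra_simps)
    then have "exp (- (3 / 2) / real n + 3 / 2 * ln (real (Suc n))) \<le> exp (3 / 2 * ln (real n))" by simp
    moreover have "real (Suc n) powr (3 / 2) = exp (3 / 2 * ln (real (Suc n)))" "real n powr (3 / 2) = exp (3 / 2 * ln (real n))"
      using n0 by (simp_all add: powr_def del: of_nat_Suc)
    ultimately show ?thesis by (simp only: exp_add)
  qed
  moreover have "num \<le> exp (- (3 / 2) / real n) * den"
  proof -
    have "(Re a + Re b + Re c + Re d) / real n + 4 * u \<le> - (3 / 2) / real n + ((1 + Re e + Re f + Re g) / real n - 4 * u)"
      unfolding Re_bal using small by (simp add: add_divide_distrib)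
    then have "real n ^ 4 * exp ((Re a + Re b + Re c + Re d) / real n + 4 * u) \<le>
       real n ^ 4 * exp (- (3 / 2) / real n + ((1 + Re e + Re f + Re g) / real n - 4 * u))"
      by (intro mult_left_mono) auto
    also have "\<dots> = exp (- (3 / 2) / real n) * (real n ^ 4 * exp ((1 + Re e + Re f + Re g) / real n - 4 * u))"
      by (simp only: exp_add mult_ac)
    also have "\<dots> \<le> exp (- (3 / 2) / real n) * den" using den_ge by (intro mult_left_mono) auto
    finally show ?thesis using num_le by linarith
  qed
  ultimately have "num * real (Suc n) powr (3 / 2) \<le> den * real n powr (3 / 2)"
  proof -
    assume 1: "exp (- (3 / 2) / real n) * real (Suc n) powr (3 / 2) \<le> real n powr (3 / 2)"
      and 2: "num \<le> exp (- (3 / 2) / real n) * den"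
    have "num * real (Suc n) powr (3 / 2) \<le> exp (- (3 / 2) / real n) * den * real (Suc n) powr (3 / 2)"
      using 2 by (intro mult_right_mono) auto
    also have "\<dots> = den * (exp (- (3 / 2) / real n) * real (Suc n) powr (3 / 2))" by (simp only: mult_ac)
    also have "\<dots> \<le> den * real n powr (3 / 2)" using 1 den0 by (intro mult_left_mono) auto
    finally show ?thesis .
  qed
  then have "norm (hyp_reg_term a b c d e f g n) * (num * real (Suc n) powr (3 / 2)) \<le> norm (hyp_reg_term a b c d e f g n) * (den * real n powr (3 / 2))"
    by (intro mult_left_mono) auto
  then have "den * (norm (hyp_reg_term a b c d e f g (Suc n)) * real (Suc n) powr (3 / 2)) \<le> den * (norm (hyp_reg_term a b c d e f g n) * real n powr (3 / 2))"
    using rec by (simp add: mult_ac) (metis mult.assoc mult.commute)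
  then show ?thesis using den0 by simp
qed

lemma hyp_reg_term_bound:
  fixes a b c d e f g :: complex and R :: real
  assumes bal: "e + f + g - a - b - c - d = 1" and R1: "1 \<le> R"
    and R: "norm a \<le> R" "norm b \<le> R" "norm c \<le> R" "norm d \<le> R" "norm e \<le> R" "norm f \<le> R" "norm g \<le> R"
    and n0: "32 * R ^ 2 \<le> real n0" and n: "n0 \<le> n"
  shows "norm (hyp_reg_term a b c d e f g n) \<le> norm (hyp_reg_term a b c d e f g n0) * real n0 powr (3 / 2) * real n powr (- 3 / 2)"
proof -
  have "norm (hyp_reg_term a b c d e f g n) * real n powr (3 / 2) \<le> norm (hyp_reg_term a b c d e f g n0) * real n0 powr (3 / 2)"
    using n
  proof (induction n rule: dec_induct)
    case (step m)
    have "norm (hyp_reg_term a b c d e f g (Suc m)) * real (Suc m) powr (3 / 2) \<le> norm (hyp_reg_term a b c d e f g m) * real m powr (3 / 2)"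
      by (rule hyp_reg_term_Suc_bound[OF bal R1 R]) (use n0 step.hyps in linarith)
    then show ?case using step.IH by linarith
  qed simp
  moreover have "real n > 0"
  proof -
    have "0 < 32 * R ^ 2" using R1 by simp
    then show ?thesis using n0 n by linarith
  qed
  ultimately show ?thesis by (simp add: powr_minus field_simps)
qed

definition hyp_reg :: complex_fun7 where
  "hyp_reg a b c d e f g = suminf (hyp_reg_term a b c d e f g)"

lemma summable_powr_three_halves: "summable (\<lambda>n. C * real n powr (- 3 / 2))"
  by (intro summable_mult) (simp add: summable_real_powr_iff)

lemma summable_hyp_reg_term:
  assumes bal: "e + f + g - a - b - c - d = 1"
  shows "summable (hyp_reg_term a b c d e f g)"
proof -
  define R where "R = 1 + norm a + norm b + norm c + norm d + norm e + norm f + norm g"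
  have R1: "1 \<le> R" and R: "norm a \<le> R" "norm b \<le> R" "norm c \<le> R" "norm d \<le> R" "norm e \<le> R" "norm f \<le> R" "norm g \<le> R"
    by (simp_all add: R_def)
  obtain n0 :: nat where n0: "32 * R ^ 2 \<le> real n0" using real_arch_simple by blast
  show ?thesis
    by (rule summable_comparison_test[OF _ summable_powr_three_halves])
      (use hyp_reg_term_bound[OF bal R1 R n0] in blast)
qed

lemma holomorphic_pochhammer:
  assumes "h holomorphic_on S"
  shows "(\<lambda>z. pochhammer (h z) n :: complex) holomorphic_on S"
  unfolding pochhammer_prod by (intro holomorphic_intros assms)

text \<open>Continuation only follows complex lines in \<open>V\<close>, so holomorphy in one
  variable suffices. On a closed ball of radius 1 the parameters have a common bound
  \<open>R\<close>, and the uniform term bound permits the Weierstrass test.\<close>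

lemma hyp_reg_holomorphic:
  fixes a b c d e f g :: "complex \<Rightarrow> complex"
  assumes hol: "a holomorphic_on UNIV" "b holomorphic_on UNIV" "c holomorphic_on UNIV" "d holomorphic_on UNIV"
      "e holomorphic_on UNIV" "f holomorphic_on UNIV" "g holomorphic_on UNIV"
    and bal: "\<And>t. e t + f t + g t - a t - b t - c t - d t = 1"
  shows "(\<lambda>t. hyp_reg (a t) (b t) (c t) (d t) (e t) (f t) (g t)) holomorphic_on UNIV"
proof (rule holomorphic_uniform_sequence[OF open_UNIV])
  fix n
  have trm: "(\<lambda>t. hyp_reg_term (a t) (b t) (c t) (d t) (e t) (f t) (g t) n) holomorphic_on S" for n S
    unfolding hyp_reg_term_def
    by (intro holomorphic_intros holomorphic_pochhammer holomorphic_on_subset[OF hol(1)] holomorphic_on_subset[OF hol(2)]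
       holomorphic_on_subset[OF hol(3)] holomorphic_on_subset[OF hol(4)] holomorphic_on_subset[OF hol(5)]
       holomorphic_on_subset[OF hol(6)] holomorphic_on_subset[OF hol(7)]) auto
  show "(\<lambda>t. \<Sum>k<n. hyp_reg_term (a t) (b t) (c t) (d t) (e t) (f t) (g t) k) holomorphic_on UNIV"
    by (intro holomorphic_on_sum trm)
  fix t0 :: complex
  define K where "K = cball t0 1"
  have bdd: "\<exists>B. \<forall>t\<in>K. norm (h t) \<le> B" if "h holomorphic_on K" for h :: "complex \<Rightarrow> complex"
  proof -
    have "compact (h ` K)"
      by (rule compact_continuous_image[OF holomorphic_on_imp_continuous_on[OF that]]) (simp add: K_def)
    then have "bounded (h ` K)" by (rule compact_imp_bounded)
    then show ?thesis unfolding bounded_iff by simp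
  qed
  have bd7: "\<exists>B. \<forall>t\<in>K. norm (h t) \<le> B" if "h holomorphic_on UNIV" for h :: "complex \<Rightarrow> complex"
    by (rule bdd, rule holomorphic_on_subset[OF that]) simp
  obtain Ba where Ba: "\<And>t. t \<in> K \<Longrightarrow> norm (a t) \<le> Ba" using bd7[OF hol(1)] by blast
  obtain Bb where Bb: "\<And>t. t \<in> K \<Longrightarrow> norm (b t) \<le> Bb" using bd7[OF hol(2)] by blast
  obtain Bc where Bc: "\<And>t. t \<in> K \<Longrightarrow> norm (c t) \<le> Bc" using bd7[OF hol(3)] by blast
  obtain Bd where Bd: "\<And>t. t \<in> K \<Longrightarrow> norm (d t) \<le> Bd" using bd7[OF hol(4)] by blast
  obtain Be where Be: "\<And>t. t \<in> K \<Longrightarrow> norm (e t) \<le> Be" using bd7[OF hol(5)] by blast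
  obtain Bf where Bf: "\<And>t. t \<in> K \<Longrightarrow> norm (f t) \<le> Bf" using bd7[OF hol(6)] by blast
  obtain Bg where Bg: "\<And>t. t \<in> K \<Longrightarrow> norm (g t) \<le> Bg" using bd7[OF hol(7)] by blast
  define R where "R = Max {1, Ba, Bb, Bc, Bd, Be, Bf, Bg}"
  have mx: "x \<le> R" if "x \<in> {1, Ba, Bb, Bc, Bd, Be, Bf, Bg}" for x
    unfolding R_def by (rule Max_ge[OF _ that]) (simp only: finite_insert finite.emptyI)
  have R1: "1 \<le> R" by (rule mx) blast
  have R: "norm (a t) \<le> R" "norm (b t) \<le> R" "norm (c t) \<le> R" "norm (d t) \<le> R" "norm (e t) \<le> R" "norm (f t) \<le> R" "norm (g t) \<le> R"
    if "t \<in> K" for t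
    subgoal by (rule order_trans[OF Ba[OF that] mx]) blast
    subgoal by (rule order_trans[OF Bb[OF that] mx]) blast
    subgoal by (rule order_trans[OF Bc[OF that] mx]) blast
    subgoal by (rule order_trans[OF Bd[OF that] mx]) blast
    subgoal by (rule order_trans[OF Be[OF that] mx]) blast
    subgoal by (rule order_trans[OF Bf[OF that] mx]) blast
    subgoal by (rule order_trans[OF Bg[OF that] mx]) blast
    done
  obtain n0 :: nat where n0: "32 * R ^ 2 \<le> real n0" using real_arch_simple by blast
  obtain C where C: "\<And>t. t \<in> K \<Longrightarrow> norm (hyp_reg_term (a t) (b t) (c t) (d t) (e t) (f t) (g t) n0) \<le> C"
    using bdd[OF trm] by blast
  have "\<forall>\<^sub>F n in sequentially. \<forall>t\<in>K. norm (hyp_reg_term (a t) (b t) (c t) (d t) (e t) (f t) (g t) n) \<le>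
      C * real n0 powr (3 / 2) * real n powr (- 3 / 2)"
    using eventually_ge_at_top[of n0]
  proof eventually_elim
    case (elim n)
    show ?case
    proof
      fix t assume t: "t \<in> K"
      have "norm (hyp_reg_term (a t) (b t) (c t) (d t) (e t) (f t) (g t) n) \<le>
        norm (hyp_reg_term (a t) (b t) (c t) (d t) (e t) (f t) (g t) n0) * real n0 powr (3 / 2) * real n powr (- 3 / 2)"
        by (rule hyp_reg_term_bound[OF bal R1 R[OF t] n0 elim])
      also have "\<dots> \<le> C * real n0 powr (3 / 2) * real n powr (- 3 / 2)"
        using C[OF t] by (intro mult_right_mono) auto
      finally show "norm (hyp_reg_term (a t) (b t) (c t) (d t) (e t) (f t) (g t) n) \<le>
        C * real n0 powr (3 / 2) * real n powr (- 3 / 2)" .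
    qed
  qed
  then have "uniform_limit K (\<lambda>n t. \<Sum>k<n. hyp_reg_term (a t) (b t) (c t) (d t) (e t) (f t) (g t) k)
     (\<lambda>t. suminf (hyp_reg_term (a t) (b t) (c t) (d t) (e t) (f t) (g t))) sequentially"
    by (rule Weierstrass_m_test_ev[OF _ summable_powr_three_halves])
  then show "\<exists>r>0. cball t0 r \<subseteq> UNIV \<and> uniform_limit (cball t0 r) (\<lambda>n t. \<Sum>k<n. hyp_reg_term (a t) (b t) (c t) (d t) (e t) (f t) (g t) k)
     (\<lambda>t. hyp_reg (a t) (b t) (c t) (d t) (e t) (f t) (g t)) sequentially"
    unfolding K_def hyp_reg_def by (intro exI[of _ 1]) simp
qed

section \<open>Sine relations and three-term relations\<close>

text \<open>The common source of the sums \<open>W4\<close>, \<open>W4s\<close> and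
  \<open>W2\<close> below: they appear on the right-hand side when all arguments are translated by
  0, \<open>e\<close> and \<open>a\<close>, and the balance simplifies
  \<open>B + C + D - F - G\<close>.\<close>

lemma sin_product_difference:
  fixes B C D F G :: complex
  shows "sin (B - F) * sin (C - F) * sin (D - F) * sin G - sin (B - G) * sin (C - G) * sin (D - G) * sin F =
    - sin (F - G) * (sin B * sin C * sin D - sin (B + C + D - F - G) * sin F * sin G)"
proof -
  have F: "sin F ^ 2 + cos F ^ 2 = 1" and G: "sin G ^ 2 + cos G ^ 2 = 1" by simp_all
  show ?thesis unfolding sin_diff cos_diff sin_add cos_add using F G by algebra
qed

lemma sin_three_term:
  fixes A E F :: complex
  shows "sin A * sin (E - F) - sin F * sin (E - A) + sin (F - A) * sin E = 0"
  unfolding sin_diff by algebra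

lemma sinpi_eqI:
  shows "x = y \<Longrightarrow> sinpi x = sinpi y"
    and sinpi_neg: "x = - y \<Longrightarrow> sinpi x = - sinpi y"
    and sinpi_1_minus: "x = 1 - y \<Longrightarrow> sinpi x = sinpi y"
    and sinpi_1_plus: "x = 1 + y \<Longrightarrow> sinpi x = - sinpi y"
    and sinpi_minus_1: "x = y - 1 \<Longrightarrow> sinpi x = - sinpi y"
    and sinpi_2_minus: "x = 2 - y \<Longrightarrow> sinpi x = - sinpi y"
proof -
  have pi: "sin (of_real pi :: complex) = 0" "cos (of_real pi :: complex) = - 1"
    by (simp_all add: sin_of_real cos_of_real)
  have pi2: "sin (of_real pi * 2 :: complex) = 0" "cos (of_real pi * 2 :: complex) = 1"
    using sin_of_real[of "pi * 2", where ?'a = complex] cos_of_real[of "pi * 2", where ?'a = complex] by simp_all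
  show "x = y \<Longrightarrow> sinpi x = sinpi y" "x = - y \<Longrightarrow> sinpi x = - sinpi y" by simp_all
  show "x = 1 - y \<Longrightarrow> sinpi x = sinpi y" "x = 1 + y \<Longrightarrow> sinpi x = - sinpi y" "x = y - 1 \<Longrightarrow> sinpi x = - sinpi y"
    by (simp_all add: distrib_left right_diff_distrib sin_diff sin_add pi)
  show "x = 2 - y \<Longrightarrow> sinpi x = - sinpi y"
    by (simp only: right_diff_distrib sin_diff pi2) simp
qed

lemma sinpi_nonzero: "z \<notin> \<int> \<Longrightarrow> sinpi z \<noteq> 0"
proof
  assume z: "z \<notin> \<int>" and "sinpi z = 0"
  then have "rGamma z * rGamma (1 - z) = 0" by (simp add: rGamma_reflection_complex)
  moreover have "1 - z \<notin> \<int>" using diff_not_Ints[OF z, of 1] by simp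
  ultimately show False using z not_Ints_not_nonpos_Ints by (auto simp: rGamma_eq_zero_iff)
qed

section \<open>Connection formulas and the expression of a \<open>K\<close> through two
  \<open>L\<close>'s\<close>

lemma Phi_term_swaps:
  "Phi_term a b c d e f g = Phi_term b a c d e f g" "Phi_term a b c d e f g = Phi_term a c b d e f g" "Phi_term a b c d e f g = Phi_term a b d c e f g"
  "Phi_term a b c d e f g = Phi_term a b c d f e g" "Phi_term a b c d e f g = Phi_term a b c d e g f"
  by (rule ext, simp add: Phi_term_def mult_ac)+

lemma Phi_swaps:
  "Phi a b c d e f g = Phi b a c d e f g" "Phi a b c d e f g = Phi a c b d e f g" "Phi a b c d e f g = Phi a b d c e f g"
  "Phi a b c d e f g = Phi a b c d f e g" "Phi a b c d e f g = Phi a b c d e g f"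
  unfolding Phi_def by (rule arg_cong[where f = suminf], rule Phi_term_swaps)+

text \<open>The limit of \<open>res_identity\<close>, multiplied by \<open>\<pi>\<close>. The
  translations belonging to \<open>f\<close> and \<open>g\<close> leave \<open>e - a\<close>
  unchanged, so one pair of bounds on real parts serves all three lower series.\<close>

lemma Phi_relation:
  fixes a b c d e f g :: complex
  assumes bal: "e + f + g - a - b - c - d = 1" and re: "0 < Re (e - a)" "Re (e - a) < 2"
    and n1: "a \<notin> \<int>" "b \<notin> \<int>" "c \<notin> \<int>" "d \<notin> \<int>" "e \<notin> \<int>" "f \<notin> \<int>" "g \<notin> \<int>"
    and n2: "a - b \<notin> \<int>" "a - c \<notin> \<int>" "a - d \<notin> \<int>" "e - a \<notin> \<int>"
    and n3: "f - a \<notin> \<int>" "f - b \<notin> \<int>" "f - c \<notin> \<int>" "f - d \<notin> \<int>"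
    and n4: "g - a \<notin> \<int>" "g - b \<notin> \<int>" "g - c \<notin> \<int>" "g - d \<notin> \<int>"
    and n5: "f - e \<notin> \<int>" "g - e \<notin> \<int>" "f - g \<notin> \<int>"
  shows "sinpi (e - a) * Phi a (1 + a - e) (1 + a - f) (1 + a - g) (1 + a - b) (1 + a - c) (1 + a - d) =
    sinpi b * sinpi c * sinpi d / (sinpi f * sinpi g) * Phi a b c d e f g +
    sinpi (b - f) * sinpi (c - f) * sinpi (d - f) / (sinpi f * sinpi (f - g)) *
      Phi (1 + a - f) (1 + b - f) (1 + c - f) (1 + d - f) (1 + e - f) (2 - f) (1 + g - f) -
    sinpi (b - g) * sinpi (c - g) * sinpi (d - g) / (sinpi g * sinpi (f - g)) *
      Phi (1 + a - g) (1 + b - g) (1 + c - g) (1 + d - g) (1 + e - g) (1 + f - g) (2 - g)"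
proof -
  have gf: "g - f \<notin> \<int>" using diff_not_Ints[OF n5(3), of 0] by simp
  have two: "2 - f \<notin> \<int>" "2 - g \<notin> \<int>"
    using diff_not_Ints[OF n1(6), of 2] diff_not_Ints[OF n1(7), of 2] by simp_all
  have sh: "1 + e - f \<notin> \<int>" "1 + e - g \<notin> \<int>" "1 + g - f \<notin> \<int>" "1 + f - g \<notin> \<int>"
    using one_plus_minus_not_Ints[OF n5(1)] one_plus_minus_not_Ints[OF n5(2)]
      one_plus_minus_not_Ints[OF n5(3)] one_plus_minus_not_Ints[OF gf] by simp_all
  define P0 where "P0 = Phi a b c d e f g"
  define Pf where "Pf = Phi (1 + a - f) (1 + b - f) (1 + c - f) (1 + d - f) (1 + e - f) (2 - f) (1 + g - f)"
  define Pg where "Pg = Phi (1 + a - g) (1 + b - g) (1 + c - g) (1 + d - g) (1 + e - g) (1 + f - g) (2 - g)"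
  define Pa where "Pa = Phi a (1 + a - e) (1 + a - f) (1 + a - g) (1 + a - b) (1 + a - c) (1 + a - d)"
  have L0: "(\<lambda>N. \<Sum>n\<le>N. res_lower N n a b c d e f g) \<longlonglongrightarrow> sinpi b * sinpi c * sinpi d / (of_real pi * sinpi f * sinpi g) * P0"
    unfolding P0_def by (rule res_lower_limit[OF bal re n1])
  have Lf: "(\<lambda>N. \<Sum>n\<le>N. res_lower N n (1 + a - f) (1 + b - f) (1 + c - f) (1 + d - f) (1 + e - f) (2 - f) (1 + g - f)) \<longlonglongrightarrow>
     sinpi (1 + b - f) * sinpi (1 + c - f) * sinpi (1 + d - f) / (of_real pi * sinpi (2 - f) * sinpi (1 + g - f)) * Pf"
    unfolding Pf_def
    by (rule res_lower_limit[OF _ _ _ one_plus_minus_not_Ints[OF n3(1)] one_plus_minus_not_Ints[OF n3(2)]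
        one_plus_minus_not_Ints[OF n3(3)] one_plus_minus_not_Ints[OF n3(4)] sh(1) two(1) sh(3)])
      (use bal re in \<open>simp_all add: algebra_simps\<close>)
  have Pg_swap: "Pg = Phi (1 + a - g) (1 + b - g) (1 + c - g) (1 + d - g) (1 + e - g) (2 - g) (1 + f - g)"
    unfolding Pg_def by (rule Phi_swaps(5))
  have Lg: "(\<lambda>N. \<Sum>n\<le>N. res_lower N n (1 + a - g) (1 + b - g) (1 + c - g) (1 + d - g) (1 + e - g) (2 - g) (1 + f - g)) \<longlonglongrightarrow>
     sinpi (1 + b - g) * sinpi (1 + c - g) * sinpi (1 + d - g) / (of_real pi * sinpi (2 - g) * sinpi (1 + f - g)) * Pg"
    unfolding Pg_swap
    by (rule res_lower_limit[OF _ _ _ one_plus_minus_not_Ints[OF n4(1)] one_plus_minus_not_Ints[OF n4(2)]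
        one_plus_minus_not_Ints[OF n4(3)] one_plus_minus_not_Ints[OF n4(4)] sh(2) two(2) sh(4)])
      (use bal re in \<open>simp_all add: algebra_simps\<close>)
  have La: "(\<lambda>N. \<Sum>n\<le>N. res_upper N n a b c d e f g) \<longlonglongrightarrow> sinpi (e - a) / of_real pi * Pa"
    unfolding Pa_def by (rule res_upper_limit[OF bal re n1(1) n2 n3(1) n4(1)])
  have "(\<lambda>N. \<Sum>n\<le>N. res_upper N n a b c d e f g) \<longlonglongrightarrow>
     sinpi b * sinpi c * sinpi d / (of_real pi * sinpi f * sinpi g) * P0 +
     sinpi (1 + b - f) * sinpi (1 + c - f) * sinpi (1 + d - f) / (of_real pi * sinpi (2 - f) * sinpi (1 + g - f)) * Pf +
     sinpi (1 + b - g) * sinpi (1 + c - g) * sinpi (1 + d - g) / (of_real pi * sinpi (2 - g) * sinpi (1 + f - g)) * Pg"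
    unfolding res_identity[OF n1(1) n1(6) n1(7) n3(1) n4(1) n5(3)]
    by (intro tendsto_add L0 Lf Lg)
  from LIMSEQ_unique[OF La this]
  have main: "sinpi (e - a) / of_real pi * Pa = sinpi b * sinpi c * sinpi d / (of_real pi * sinpi f * sinpi g) * P0 +
     sinpi (1 + b - f) * sinpi (1 + c - f) * sinpi (1 + d - f) / (of_real pi * sinpi (2 - f) * sinpi (1 + g - f)) * Pf +
     sinpi (1 + b - g) * sinpi (1 + c - g) * sinpi (1 + d - g) / (of_real pi * sinpi (2 - g) * sinpi (1 + f - g)) * Pg" .
  have s1: "sinpi (1 + x - y) = - sinpi (x - y)" for x y by (rule sinpi_1_plus) simp
  have s2: "sinpi (2 - x) = - sinpi x" for x by (rule sinpi_2_minus) simp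
  have s3: "sinpi (g - f) = - sinpi (f - g)" by (rule sinpi_neg) simp
  have sc: "u / (of_real pi * y * w) * P = (u / (y * w) * P) / of_real pi" "u / of_real pi * P = (u * P) / of_real pi"
    for u y w P :: complex by (simp_all add: mult_ac)
  have "sinpi (e - a) * Pa = sinpi b * sinpi c * sinpi d / (sinpi f * sinpi g) * P0 +
     sinpi (1 + b - f) * sinpi (1 + c - f) * sinpi (1 + d - f) / (sinpi (2 - f) * sinpi (1 + g - f)) * Pf +
     sinpi (1 + b - g) * sinpi (1 + c - g) * sinpi (1 + d - g) / (sinpi (2 - g) * sinpi (1 + f - g)) * Pg"
    using main unfolding sc add_divide_distrib[symmetric] by simp
  then show ?thesis
    unfolding P0_def[symmetric] Pf_def[symmetric] Pg_def[symmetric] Pa_def[symmetric] s1 s2 s3 by simp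
qed

text \<open>\<open>Qe\<close> and \<open>Qf\<close> are connection formulas for the same series
  \<open>Pa\<close>, with \<open>e\<close> and with \<open>f\<close> distinguished. In the
  combination \<open>Ug * sf * Qe - eg * W4 * Qf\<close> the coefficients of \<open>Pf\<close> and
  \<open>Pg\<close> become opposite, and those of \<open>P0\<close> and \<open>Pe\<close> do so once
  the multiple of \<open>P0\<close> that matches the one of \<open>Pa\<close> is moved to the left.
  Thus \<open>P0 + Pa\<close>, which is a \<open>K\<close>, is expressed by two differences, which
  are \<open>L\<close>'s.\<close>

lemma Phi_three_term_algebra:
  fixes U0 Ue Uf Ug sa se sf sg fg eg ef ea fa P0 Pa Pe Pf Pg W4 W4s :: complex
  assumes Qe: "ea * Pa = U0 / (sf * sg) * P0 + Uf / (sf * fg) * Pf - Ug / (sg * fg) * Pg"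
    and Qf: "fa * Pa = U0 / (se * sg) * P0 + Ue / (se * eg) * Pe - Ug / (sg * eg) * Pg"
    and nz: "se \<noteq> 0" "sf \<noteq> 0" "sg \<noteq> 0" "fg \<noteq> 0" "eg \<noteq> 0"
    and U0: "U0 = W4 - ea * sf * sg" and Ue: "Ue = sa * ef * eg - W4s"
    and t1: "W4 * fg = Ug * sf - Uf * sg" and t2: "Ug * se + sg * W4s = eg * W4"
    and t3: "sa * ef - sf * ea + fa * se = 0"
  shows "(Ug * sf * ea - eg * fa * W4) * (P0 + Pa) = W4 * Ue / se * (P0 - Pe) + Uf * Ug / fg * (Pf - Pg)"
proof -
  have t0: "U0 * (Ug * se - eg * W4) = W4 * Ue * sg - Ug * sf * ea * se * sg + eg * fa * W4 * se * sg"
    unfolding U0 Ue using t2 t3 by algebra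
  have c0: "Ug * sf * (U0 / (sf * sg)) - eg * W4 * (U0 / (se * sg)) = W4 * Ue / se - (Ug * sf * ea - eg * fa * W4)"
  proof -
    have "Ug * sf * (U0 / (sf * sg)) - eg * W4 * (U0 / (se * sg)) = U0 * (Ug * se - eg * W4) / (se * sg)"
      using nz by (simp add: diff_divide_distrib right_diff_distrib mult_ac)
    also have "\<dots> = W4 * Ue / se - (Ug * sf * ea - eg * fa * W4)"
      unfolding t0 using nz by (simp add: diff_divide_distrib add_divide_distrib mult_ac)
    finally show ?thesis .
  qed
  have cg: "eg * W4 * (Ug / (sg * eg)) - Ug * sf * (Ug / (sg * fg)) = - (Uf * Ug / fg)"
  proof -
    have "eg * W4 * (Ug / (sg * eg)) - Ug * sf * (Ug / (sg * fg)) = Ug * (W4 * fg - Ug * sf) / (sg * fg)"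
      using nz by (simp add: diff_divide_distrib right_diff_distrib mult_ac)
    also have "\<dots> = - (Uf * Ug / fg)" unfolding t1 using nz by (simp add: mult_ac)
    finally show ?thesis .
  qed
  have "(Ug * sf * ea - eg * fa * W4) * Pa = Ug * sf * (ea * Pa) - eg * W4 * (fa * Pa)"
    by (simp add: algebra_simps)
  also have "\<dots> = (Ug * sf * (U0 / (sf * sg)) - eg * W4 * (U0 / (se * sg))) * P0 + (Ug * sf * (Uf / (sf * fg))) * Pf
     - (eg * W4 * (Ue / (se * eg))) * Pe + (eg * W4 * (Ug / (sg * eg)) - Ug * sf * (Ug / (sg * fg))) * Pg"
    unfolding Qe Qf by (simp only: ring_distribs mult_ac) (simp only: algebra_simps)
  also have "\<dots> = (W4 * Ue / se - (Ug * sf * ea - eg * fa * W4)) * P0 + (Uf * Ug / fg) * Pf - (W4 * Ue / se) * Pe - (Uf * Ug / fg) * Pg"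
    unfolding c0 cg using nz by (simp add: mult_ac)
  finally have "(Ug * sf * ea - eg * fa * W4) * Pa = (W4 * Ue / se - (Ug * sf * ea - eg * fa * W4)) * P0 + (Uf * Ug / fg) * Pf - (W4 * Ue / se) * Pe - (Uf * Ug / fg) * Pg" .
  then show ?thesis by (simp only: ring_distribs) (simp add: algebra_simps)
qed

lemma Phi_pair_eq:
  "Phi_pair a b c d e f g = of_real pi * (rGamma a * rGamma b * rGamma c * rGamma d) *
     (rGamma (1 + a - e) * rGamma (1 + b - e) * rGamma (1 + c - e) * rGamma (1 + d - e)) *
     ((Phi a b c d e f g - Phi (1 + a - e) (1 + b - e) (1 + c - e) (1 + d - e) (2 - e) (1 + f - e) (1 + g - e)) / sinpi e)"
  unfolding Phi_pair_def Gamma_reflection_complex rGamma_inverse_Gamma by (simp add: divide_inverse mult_ac)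

lemma Phi_pair_perms:
  "Phi_pair a b c d e f g = Phi_pair c d a b e f g" "Phi_pair a b c d e f g = Phi_pair d c b a e f g"
proof -
  have 1: "Phi a b c d e f g = Phi c d a b e f g" for a b c d e f g
    by (metis Phi_swaps(1,2,3))
  have 2: "Phi a b c d e f g = Phi d c b a e f g" for a b c d e f g
    by (metis Phi_swaps(1,2,3))
  show "Phi_pair a b c d e f g = Phi_pair c d a b e f g"
    unfolding Phi_pair_def 1[of a b c d] 1[of "1 + a - e" "1 + b - e" "1 + c - e" "1 + d - e"] by (simp only: mult_ac)
  show "Phi_pair a b c d e f g = Phi_pair d c b a e f g"
    unfolding Phi_pair_def 2[of a b c d] 2[of "1 + a - e" "1 + b - e" "1 + c - e" "1 + d - e"] by (simp only: mult_ac)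
qed

text \<open>
  Applying the transformation with respect to \<open>a, b\<close> and then \<open>c, d\<close> leads to the equation with dual parameters.
\<close>

lemma Phi_pair_dual:
  fixes a b c d e f g :: complex
  assumes bal: "e + f + g - a - b - c - d = 1"
    and n1: "a \<notin> \<int>" "b \<notin> \<int>" "c \<notin> \<int>" "d \<notin> \<int>" "e \<notin> \<int>" "f \<notin> \<int>" "g \<notin> \<int>"
    and ne: "e - a \<notin> \<int>" "e - b \<notin> \<int>" "e - c \<notin> \<int>" "e - d \<notin> \<int>"
    and nf: "f - a \<notin> \<int>" "f - b \<notin> \<int>" "f - c \<notin> \<int>" "f - d \<notin> \<int>"
    and ng: "g - a \<notin> \<int>" "g - b \<notin> \<int>" "g - c \<notin> \<int>" "g - d \<notin> \<int>"
    and nef: "f - e \<notin> \<int>" "g - e \<notin> \<int>" "f - g \<notin> \<int>"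
    and ns: "e + f - a - b \<notin> \<int>" "f + g - a - b \<notin> \<int>" "f - a - b \<notin> \<int>" "f - c - d \<notin> \<int>" "e - a - b \<notin> \<int>"
  shows "Phi_pair a b c d e f g = Phi_pair (f - a) (f - b) (f - c) (f - d) (1 + f - g) f (1 + f - e)"
proof -
  define e' where "e' = e + f - a - b"
  define g' where "g' = f + g - a - b"
  have fe': "f - e' \<notin> \<int>" using diff_not_Ints[OF ns(5), of 0] by (simp add: e'_def algebra_simps)
  have e'c: "e' - c \<notin> \<int>"
  proof -
    have "e' - c = of_int 1 - (g - d)" using bal by (simp add: e'_def algebra_simps)
    then show ?thesis using diff_not_Ints[OF ng(4), of 1] by simp
  qed
  have e'd: "e' - d \<notin> \<int>"
  proof -
    have "e' - d = of_int 1 - (g - c)" using bal by (simp add: e'_def algebra_simps)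
    then show ?thesis using diff_not_Ints[OF ng(3), of 1] by simp
  qed
  have e'g': "e' \<notin> \<int>" "g' \<notin> \<int>" using ns by (simp_all add: e'_def g'_def)
  have "Phi_pair a b c d e f g = Phi_pair (f - b) (f - a) c d e' f g'"
    unfolding e'_def g'_def
    by (rule Phi_pair_transform[OF bal n1(5-7) n1(1-4) ne nef(1,2) ns(1,2) nf(1,2) ns(3)
          fe'[unfolded e'_def] e'c[unfolded e'_def] e'd[unfolded e'_def]])
  also have "\<dots> = Phi_pair c d (f - b) (f - a) e' f g'" by (rule Phi_pair_perms)
  also have "\<dots> = Phi_pair (f - d) (f - c) (f - b) (f - a) (e' + f - c - d) f (f + g' - c - d)"
  proof (rule Phi_pair_transform)
    show "e' + f + g' - c - d - (f - b) - (f - a) = 1" using bal by (simp add: e'_def g'_def algebra_simps)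
    show "e' \<notin> \<int>" "f \<notin> \<int>" "g' \<notin> \<int>" "c \<notin> \<int>" "d \<notin> \<int>" "f - b \<notin> \<int>" "f - a \<notin> \<int>" "e' - c \<notin> \<int>" "e' - d \<notin> \<int>"
      "f - e' \<notin> \<int>" "f - c \<notin> \<int>" "f - d \<notin> \<int>" "f - c - d \<notin> \<int>" by (fact e'g' n1 nf e'c e'd fe' ns)+
    show "e' - (f - b) \<notin> \<int>" "e' - (f - a) \<notin> \<int>" "g' - e' \<notin> \<int>"
      using ne(1,2) nef(2) by (simp_all add: e'_def g'_def algebra_simps)
    have *: "e' + f - c - d = 1 + f - g" "f + g' - c - d = 1 + f - e" using bal by (simp_all add: e'_def g'_def algebra_simps)
    have gf: "g - f \<notin> \<int>" using diff_not_Ints[OF nef(3), of 0] by simp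
    show "e' + f - c - d \<notin> \<int>" unfolding * by (rule one_plus_minus_not_Ints[OF gf])
    show "f + g' - c - d \<notin> \<int>" unfolding * by (rule not_Ints_shift[OF nef(1), of _ 1]) simp
    show "f - (e' + f - c - d) \<notin> \<int>" unfolding * by (rule not_Ints_shift[OF n1(7), of _ "-1"]) simp
    show "e' + f - c - d - (f - b) \<notin> \<int>" unfolding *
      using one_plus_minus_not_Ints[OF ng(2)] by (simp add: algebra_simps)
    show "e' + f - c - d - (f - a) \<notin> \<int>" unfolding *
      using one_plus_minus_not_Ints[OF ng(1)] by (simp add: algebra_simps)
  qed
  also have "\<dots> = Phi_pair (f - a) (f - b) (f - c) (f - d) (e' + f - c - d) f (f + g' - c - d)" by (rule Phi_pair_perms)
  also have "e' + f - c - d = 1 + f - g" using bal by (simp add: e'_def algebra_simps)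
  also have "f + g' - c - d = 1 + f - e" using bal by (simp add: g'_def algebra_simps)
  finally show ?thesis .
qed

lemma sinpi_product_difference:
  "sinpi (b - f) * sinpi (c - f) * sinpi (d - f) * sinpi g - sinpi (b - g) * sinpi (c - g) * sinpi (d - g) * sinpi f =
    - sinpi (f - g) * (sinpi b * sinpi c * sinpi d - sinpi (b + c + d - f - g) * sinpi f * sinpi g)"
proof -
  have s: "of_real pi * (b + c + d - f - g) = of_real pi * b + of_real pi * c + of_real pi * d - of_real pi * f - of_real pi * g"
    by (simp only: distrib_left right_diff_distrib)
  have d: "of_real pi * (x - y) = of_real pi * x - of_real pi * y" for x y :: complex
    by (rule right_diff_distrib)
  show ?thesis unfolding s unfolding d by (rule sin_product_difference)
qed

text \<open>The hypotheses \<open>t1\<close>, \<open>t2\<close>, \<open>t3\<close> of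
  \<open>Phi_three_term_algebra\<close>. The first two come from the product difference for the
  pairs \<open>f, g\<close> and \<open>e, g\<close>; the third is the three-term relation for sines
  of differences.\<close>

lemma sine_relations_basic:
  fixes a b c d e f g :: complex
  defines "U x \<equiv> sinpi (b - x) * sinpi (c - x) * sinpi (d - x)"
  defines "W \<equiv> sinpi b * sinpi c * sinpi d + sinpi (e - a) * sinpi f * sinpi g"
    and "W' \<equiv> sinpi a * sinpi (e - f) * sinpi (e - g) - sinpi (b - e) * sinpi (c - e) * sinpi (d - e)"
  assumes bal: "e + f + g - a - b - c - d = 1"
  shows "W * sinpi (f - g) = U g * sinpi f - U f * sinpi g"
    and "U g * sinpi e + sinpi g * W' = sinpi (e - g) * W"
    and "sinpi a * sinpi (e - f) - sinpi f * sinpi (e - a) + sinpi (f - a) * sinpi e = 0"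
proof -
  have h: "b + c + d - f - g = (e - a) - 1" "b + c + d - e - g = (f - a) - 1" using bal by (simp_all add: algebra_simps)
  show "W * sinpi (f - g) = U g * sinpi f - U f * sinpi g"
    using sinpi_product_difference[of b f c d g] unfolding h(1) sinpi_minus_1[OF refl] W_def U_def by (simp add: algebra_simps)
  show t3: "sinpi a * sinpi (e - f) - sinpi f * sinpi (e - a) + sinpi (f - a) * sinpi e = 0"
    unfolding right_diff_distrib by (rule sin_three_term)
  have 1: "sinpi (b - e) * sinpi (c - e) * sinpi (d - e) * sinpi g - U g * sinpi e = - sinpi (e - g) * (sinpi b * sinpi c * sinpi d + sinpi (f - a) * sinpi e * sinpi g)"
    using sinpi_product_difference[of b e c d g] unfolding h(2) sinpi_minus_1[OF refl] U_def by (simp add: algebra_simps)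
  show "U g * sinpi e + sinpi g * W' = sinpi (e - g) * W" unfolding W'_def W_def using 1 t3 by algebra
qed

text \<open>The connection formula is used with \<open>e\<close> and with \<open>f\<close>
  distinguished, whence the bounds on the real parts of both \<open>e - a\<close> and
  \<open>f - a\<close>.\<close>

lemma Phi_three_term:
  fixes a b c d e f g :: complex
  defines "U x \<equiv> sinpi (b - x) * sinpi (c - x) * sinpi (d - x)"
  defines "W \<equiv> sinpi b * sinpi c * sinpi d + sinpi (e - a) * sinpi f * sinpi g"
  assumes bal: "e + f + g - a - b - c - d = 1"
    and re: "0 < Re (e - a)" "Re (e - a) < 2" "0 < Re (f - a)" "Re (f - a) < 2"
    and n1: "a \<notin> \<int>" "b \<notin> \<int>" "c \<notin> \<int>" "d \<notin> \<int>" "e \<notin> \<int>" "f \<notin> \<int>" "g \<notin> \<int>"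
    and n2: "a - b \<notin> \<int>" "a - c \<notin> \<int>" "a - d \<notin> \<int>"
    and ne: "e - a \<notin> \<int>" "e - b \<notin> \<int>" "e - c \<notin> \<int>" "e - d \<notin> \<int>"
    and nf: "f - a \<notin> \<int>" "f - b \<notin> \<int>" "f - c \<notin> \<int>" "f - d \<notin> \<int>"
    and ng: "g - a \<notin> \<int>" "g - b \<notin> \<int>" "g - c \<notin> \<int>" "g - d \<notin> \<int>"
    and nef: "f - e \<notin> \<int>" "g - e \<notin> \<int>" "f - g \<notin> \<int>"
  shows "(U g * sinpi f * sinpi (e - a) - sinpi (e - g) * sinpi (f - a) * W) *
      (Phi a b c d e f g + Phi a (1 + a - e) (1 + a - f) (1 + a - g) (1 + a - b) (1 + a - c) (1 + a - d)) =
    W * U e / sinpi e * (Phi a b c d e f g -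
        Phi (1 + a - e) (1 + b - e) (1 + c - e) (1 + d - e) (2 - e) (1 + f - e) (1 + g - e)) +
    U f * U g / sinpi (f - g) *
      (Phi (1 + a - f) (1 + b - f) (1 + c - f) (1 + d - f) (1 + e - f) (2 - f) (1 + g - f) -
       Phi (1 + a - g) (1 + b - g) (1 + c - g) (1 + d - g) (1 + e - g) (1 + f - g) (2 - g))"
proof -
  have n': "e - f \<notin> \<int>" "g - f \<notin> \<int>" "e - g \<notin> \<int>"
    using diff_not_Ints[OF nef(1), of 0] diff_not_Ints[OF nef(3), of 0] diff_not_Ints[OF nef(2), of 0] by simp_all
  define Ws where "Ws = sinpi a * sinpi (e - f) * sinpi (e - g) - U e"
  have Qe: "sinpi (e - a) * Phi a (1 + a - e) (1 + a - f) (1 + a - g) (1 + a - b) (1 + a - c) (1 + a - d) =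
      U 0 / (sinpi f * sinpi g) * Phi a b c d e f g +
      U f / (sinpi f * sinpi (f - g)) * Phi (1 + a - f) (1 + b - f) (1 + c - f) (1 + d - f) (1 + e - f) (2 - f) (1 + g - f) -
      U g / (sinpi g * sinpi (f - g)) * Phi (1 + a - g) (1 + b - g) (1 + c - g) (1 + d - g) (1 + e - g) (1 + f - g) (2 - g)"
    using Phi_relation[OF bal re(1,2) n1 n2 ne(1) nf ng nef] by (simp add: U_def)
  have bal2: "f + e + g - a - b - c - d = 1" using bal by (simp add: algebra_simps)
  have Qf: "sinpi (f - a) * Phi a (1 + a - e) (1 + a - f) (1 + a - g) (1 + a - b) (1 + a - c) (1 + a - d) =
      U 0 / (sinpi e * sinpi g) * Phi a b c d e f g +
      U e / (sinpi e * sinpi (e - g)) * Phi (1 + a - e) (1 + b - e) (1 + c - e) (1 + d - e) (2 - e) (1 + f - e) (1 + g - e) -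
      U g / (sinpi g * sinpi (e - g)) * Phi (1 + a - g) (1 + b - g) (1 + c - g) (1 + d - g) (1 + e - g) (1 + f - g) (2 - g)"
    using Phi_relation[OF bal2 re(3,4) n1(1-4) n1(6) n1(5) n1(7) n2 nf(1) ne ng n'(1,2,3)]
    unfolding Phi_swaps(2)[of a "1 + a - f" "1 + a - e"] Phi_swaps(4)[of a b c d f e g]
      Phi_swaps(4)[of "1 + a - e" "1 + b - e" "1 + c - e" "1 + d - e" "1 + f - e" "2 - e"]
      Phi_swaps(4)[of "1 + a - g" "1 + b - g" "1 + c - g" "1 + d - g" "1 + f - g" "1 + e - g"]
    by (simp add: U_def)
  note t = sine_relations_basic[OF bal, folded W_def U_def, folded Ws_def]
  have "U 0 = W - sinpi (e - a) * sinpi f * sinpi g" by (simp add: U_def W_def)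
  moreover have "U e = sinpi a * sinpi (e - f) * sinpi (e - g) - Ws" by (simp add: Ws_def)
  ultimately show ?thesis
    using Phi_three_term_algebra[OF Qe Qf sinpi_nonzero[OF n1(5)] sinpi_nonzero[OF n1(6)] sinpi_nonzero[OF n1(7)] sinpi_nonzero[OF nef(3)]
      sinpi_nonzero[OF n'(3)] _ _ t] by simp
qed

text \<open>
  Here \<open>RA, RE, RF, RG\<close> and \<open>QA, QE, QF, QG\<close> stand for the Gamma products \<open>A(1+a-x, \<dots>)\<close> and \<open>A(x-a, \<dots>)\<close> with
  \<open>x = 1, e, f, g\<close>, and \<open>p = \<pi>\<^sup>4\<close>. The hypotheses \<open>KL\<close>, \<open>KLs\<close> are the relations between a \<open>K\<close> and two \<open>L\<close>'s for the
  equation and its dual, and \<open>LA\<close>, \<open>LB\<close> identify the \<open>L\<close>'s of the two equations.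
\<close>

lemma elimination_algebra:
  fixes k X0 X1 X2 Y Y1 Y2 W2 W4 W4s U0 Ue Uf Ug RA RE RF RG QA QE QF QG J J' p sa se ea fa ga :: complex
  assumes KL: "k * X0 = - (W4 * Ue * X1 + Uf * Ug * X2)"
    and KLs: "k * Y = - (W4s * U0 * Y1) + Uf * Ug * Y2"
    and LA: "RA * RE * X1 = QF * QG * Y2" and LB: "RF * RG * X2 = QA * QE * Y1"
    and RQ: "RA * QA * p = sa * U0" "RE * QE * p = - (ea * Ue)" "RF * QF * p = - (fa * Uf)" "RG * QG * p = - (ga * Ug)"
    and JJ: "J * J' * p = sa * ea * fa * ga"
    and t5: "W4 * W4s * fa * ga = W2 * k + sa * ea * Uf * Ug"
    and nz: "p \<noteq> 0" "sa \<noteq> 0" "fa \<noteq> 0" "ga \<noteq> 0" "U0 \<noteq> 0" "Uf \<noteq> 0" "Ug \<noteq> 0"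
  shows "k * (sa * RF * RG * J' * (RA * J * X0) * ea * (- se) -
      J * (fa * ga * W4 / p) * (QE * J' * Y) * sa * (- se) -
      RA * (fa * ga * W2 / p) * (QA * QE * (- (se * Y1))) * sa * ea) = 0"
proof -
  have QA: "QA \<noteq> 0" "RA \<noteq> 0" "QF \<noteq> 0" "QG \<noteq> 0" using RQ nz by auto
  define R where "R = RA * RF * RG"
  \<comment> \<open>The identifications \<open>LA\<close>, \<open>LB\<close> and the reflection
    formulas \<open>RQ\<close> turn the dual quantities \<open>Y1\<close>, \<open>Y2\<close> into
    \<open>X2\<close>, \<open>X1\<close>; both acquire the same Gamma product
    \<open>R\<close>.\<close>
  have E1: "sa * (QE * (U0 * Y1)) = p * R * X2"
  proof -
    have "sa * (QE * (U0 * Y1)) = (sa * U0) * (QE * Y1)" by (simp only: mult_ac)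
    also have "\<dots> = p * RA * (QA * QE * Y1)" unfolding RQ(1)[symmetric] by (simp only: mult_ac)
    finally show ?thesis unfolding LB[symmetric] R_def by (simp only: mult_ac)
  qed
  have E2: "fa * ga * (QE * (Uf * Ug * Y2)) = - (p * R * ea * Ue * X1)"
  proof -
    have "fa * ga * (QE * (Uf * Ug * Y2)) = (- (fa * Uf)) * (- (ga * Ug)) * (QE * Y2)" by (simp add: mult_ac)
    also have "\<dots> = p * p * RF * RG * QE * (QF * QG * Y2)" unfolding RQ(3,4)[symmetric] by (simp only: mult_ac)
    also have "\<dots> = p * RF * RG * RA * X1 * (RE * QE * p)" unfolding LA[symmetric] by (simp only: mult_ac)
    finally show ?thesis unfolding RQ(2) R_def by (simp add: mult_ac)
  qed
  have E3: "sa * fa * ga * (QE * (k * Y)) = - (p * R * (fa * ga * W4s * X2 + sa * ea * Ue * X1))"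
  proof -
    have "sa * fa * ga * (QE * (k * Y)) = - (fa * ga * W4s * (sa * (QE * (U0 * Y1)))) + sa * (fa * ga * (QE * (Uf * Ug * Y2)))"
      unfolding KLs by (simp add: algebra_simps)
    then show ?thesis unfolding E1 E2 by (simp add: algebra_simps)
  qed
  have T3: "RA * (QA * QE * Y1) = R * X2" unfolding LB[symmetric] R_def by (simp only: mult_ac)
  have "p * p * (k * (sa * RF * RG * J' * (RA * J * X0) * ea * (- se) -
      J * (fa * ga * W4 / p) * (QE * J' * Y) * sa * (- se) -
      RA * (fa * ga * W2 / p) * (QA * QE * (- (se * Y1))) * sa * ea)) =
    sa * se * (- (p * ea * R * (J * J' * p) * (k * X0)) + (J * J' * p) * fa * ga * W4 * (QE * (k * Y)) + p * fa * ga * ea * W2 * k * (RA * (QA * QE * Y1)))"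
    using nz(1) by (simp add: R_def right_diff_distrib distrib_left)
  also have "\<dots> = sa * se * (- (p * ea * R * (sa * ea * fa * ga) * (k * X0)) + ea * fa * ga * W4 * (sa * fa * ga * (QE * (k * Y))) + p * fa * ga * ea * W2 * k * (R * X2))"
    unfolding JJ T3 by (simp only: mult_ac)
  also have "\<dots> = sa * se * (p * R * ea * fa * ga) * (sa * ea * (W4 * Ue * X1 + Uf * Ug * X2) - W4 * (fa * ga * W4s * X2 + sa * ea * Ue * X1) + W2 * k * X2)"
    unfolding KL E3 by (simp add: algebra_simps)
  \<comment> \<open>The coefficients of \<open>X1\<close> cancel identically, and those of
    \<open>X2\<close> by \<open>t5\<close>.\<close>
  also have "sa * ea * (W4 * Ue * X1 + Uf * Ug * X2) - W4 * (fa * ga * W4s * X2 + sa * ea * Ue * X1) + W2 * k * X2 = 0"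
    using t5 by algebra
  finally show ?thesis using nz(1) by simp
qed

text \<open>This becomes \<open>t5\<close> of the elimination for \<open>u = Uf\<close> and
  \<open>v = Ug\<close>, multiplied by the square of the sine of \<open>F - G\<close>. It holds for
  arbitrary \<open>u\<close>, \<open>v\<close> as a consequence of two three-term relations, each of
  which produces a factor \<open>sin (F - G)\<close>.\<close>

lemma sin_quadratic_identity:
  fixes A E F G u v :: complex
  shows "(v * sin F - u * sin G) * (u * sin (G - E) - v * sin (F - E)) * sin (F - A) * sin (G - A) =
    (v * sin (F - A) - u * sin (G - A)) * (v * sin (F - E) * sin A * sin (F - G) + sin G * sin (F - A) * (u * sin (G - E) - v * sin (F - E))) +
    sin A * sin (E - A) * u * v * sin (F - G) ^ 2"
proof -
  have 1: "sin F * sin (G - A) - sin G * sin (F - A) = - sin A * sin (F - G)"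
    unfolding sin_diff by algebra
  have 2: "sin (G - A) * sin (F - E) - sin (F - A) * sin (G - E) = sin (E - A) * sin (F - G)"
  proof -
    have "sin (G - A) = sin ((G - E) + (E - A))" "sin (F - A) = sin ((F - E) + (E - A))" "sin (F - G) = sin ((F - E) - (G - E))"
      by simp_all
    then show ?thesis unfolding sin_add sin_diff[of "F - E" "G - E"] by algebra
  qed
  show ?thesis using 1 2 by algebra
qed

section \<open>The relation for generic parameters\<close>

lemma hyp_reg_eq_Phi:
  assumes bal: "e + f + g - a - b - c - d = 1"
    and n: "a \<notin> \<int>" "b \<notin> \<int>" "c \<notin> \<int>" "d \<notin> \<int>" "e \<notin> \<int>" "f \<notin> \<int>" "g \<notin> \<int>"
  shows "hyp_reg a b c d e f g = Phi a b c d e f g * (rGamma a * rGamma b * rGamma c * rGamma d)"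
proof -
  note N = not_Ints_not_nonpos_Ints
  have "summable (Phi_term a b c d e f g)"
    by (rule square_decay_summable[OF Phi_term_asymp[OF bal]]) (intro N n)+
  moreover have "hyp_reg_term a b c d e f g = (\<lambda>k. Phi_term a b c d e f g k * (rGamma a * rGamma b * rGamma c * rGamma d))"
    by (rule ext) (simp add: hyp_reg_term_def Phi_term_def pochhammer_Gamma[OF N[OF n(1)]] pochhammer_Gamma[OF N[OF n(2)]]
      pochhammer_Gamma[OF N[OF n(3)]] pochhammer_Gamma[OF N[OF n(4)]] rGamma_inverse_Gamma divide_inverse mult_ac)
  ultimately show ?thesis unfolding hyp_reg_def Phi_def by (simp only: suminf_mult2)
qed

lemma hyp4F3_eq_hyp_reg:
  assumes bal: "e + f + g - a - b - c - d = 1"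
    and n: "e \<notin> \<int>\<^sub>\<le>\<^sub>0" "f \<notin> \<int>\<^sub>\<le>\<^sub>0" "g \<notin> \<int>\<^sub>\<le>\<^sub>0"
  shows "hyp4F3 a b c d e f g * (rGamma e * rGamma f * rGamma g) = hyp_reg a b c d e f g"
proof -
  define C where "C = rGamma e * rGamma f * rGamma g"
  have C: "C \<noteq> 0" using n by (simp add: C_def rGamma_eq_zero_iff)
  have "(pochhammer a k * pochhammer b k * pochhammer c k * pochhammer d k) /
           (fact k * pochhammer e k * pochhammer f k * pochhammer g k) = hyp_reg_term a b c d e f g k / C" for k
  proof -
    have "C = (pochhammer e k * pochhammer f k * pochhammer g k) * (rGamma (e + of_nat k) * rGamma (f + of_nat k) * rGamma (g + of_nat k))"
      unfolding C_def pochhammer_rGamma[of e k] pochhammer_rGamma[of f k] pochhammer_rGamma[of g k] by (simp only: mult_ac)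
    moreover from this C have "rGamma (e + of_nat k) * rGamma (f + of_nat k) * rGamma (g + of_nat k) \<noteq> 0" by auto
    ultimately show ?thesis unfolding hyp_reg_term_def by (simp add: mult_ac)
  qed
  then have "hyp4F3 a b c d e f g = suminf (\<lambda>k. hyp_reg_term a b c d e f g k / C)" by (simp add: hyp4F3_def)
  also have "\<dots> = hyp_reg a b c d e f g / C"
    unfolding hyp_reg_def by (rule suminf_divide[OF summable_hyp_reg_term[OF bal]])
  finally show ?thesis using C by (simp add: C_def)
qed

text \<open>\<open>K_fun\<close> times the sine in its denominators. The reciprocal Gamma values of
  the lower parameters are absorbed into \<open>hyp_reg\<close>, so that the expression is entire
  along every line in \<open>V\<close>.\<close>

definition K_num :: complex_fun7 where
  "K_num a b c d e f g = hyp_reg a b c d e f g * A_fun a (1 + a - e) (1 + a - f) (1 + a - g) +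
     hyp_reg a (1 + a - e) (1 + a - f) (1 + a - g) (1 + a - b) (1 + a - c) (1 + a - d) * A_fun a b c d"

definition L_num :: complex_fun7 where
  "L_num a b c d e f g = hyp_reg a b c d e f g * A_fun (1 + a - e) (1 + b - e) (1 + c - e) (1 + d - e) -
     hyp_reg (1 + a - e) (1 + b - e) (1 + c - e) (1 + d - e) (2 - e) (1 + f - e) (1 + g - e) * A_fun a b c d"

lemma K_fun_eq:
  assumes bal: "e + f + g - a - b - c - d = 1" and K: "K_defined a b c d e f g"
  shows "K_fun a b c d e f g = K_num a b c d e f g / sinpi a"
proof -
  have bal': "(1 + a - b) + (1 + a - c) + (1 + a - d) - a - (1 + a - e) - (1 + a - f) - (1 + a - g) = 1"
    using bal by (simp add: algebra_simps)
  have n: "e \<notin> \<int>\<^sub>\<le>\<^sub>0" "f \<notin> \<int>\<^sub>\<le>\<^sub>0" "g \<notin> \<int>\<^sub>\<le>\<^sub>0" "1 + a - b \<notin> \<int>\<^sub>\<le>\<^sub>0" "1 + a - c \<notin> \<int>\<^sub>\<le>\<^sub>0" "1 + a - d \<notin> \<int>\<^sub>\<le>\<^sub>0"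
    using K by (simp_all add: K_defined_def)
  show ?thesis
    unfolding K_num_def hyp4F3_eq_hyp_reg[OF bal n(1-3), symmetric] hyp4F3_eq_hyp_reg[OF bal' n(4-6), symmetric] K_fun_def A_fun_def
    by (simp add: add_divide_distrib mult_ac)
qed

lemma L_fun_eq:
  assumes bal: "e + f + g - a - b - c - d = 1" and L: "L_defined a b c d e f g"
  shows "L_fun a b c d e f g = L_num a b c d e f g / sinpi e"
proof -
  have bal': "(2 - e) + (1 + f - e) + (1 + g - e) - (1 + a - e) - (1 + b - e) - (1 + c - e) - (1 + d - e) = 1"
    using bal by (simp add: algebra_simps)
  have n: "e \<notin> \<int>\<^sub>\<le>\<^sub>0" "f \<notin> \<int>\<^sub>\<le>\<^sub>0" "g \<notin> \<int>\<^sub>\<le>\<^sub>0" "2 - e \<notin> \<int>\<^sub>\<le>\<^sub>0" "1 + f - e \<notin> \<int>\<^sub>\<le>\<^sub>0" "1 + g - e \<notin> \<int>\<^sub>\<le>\<^sub>0"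
    using L by (simp_all add: L_defined_def)
  show ?thesis
    unfolding L_num_def hyp4F3_eq_hyp_reg[OF bal n(1-3), symmetric] hyp4F3_eq_hyp_reg[OF bal' n(4-6), symmetric] L_fun_def A_fun_def
    by (simp add: diff_divide_distrib mult_ac)
qed

text \<open>
  The left-hand side of the theorem, multiplied by the sines in the denominators.
\<close>

definition cleared_lhs :: complex_fun7 where
  "cleared_lhs a b c d e f g =
     sinpi a * A_fun (1 + a - f) (1 + b - f) (1 + c - f) (1 + d - f) * A_fun (1 + a - g) (1 + b - g) (1 + c - g) (1 + d - g) *
       A_fun (1 - a) (e - a) (f - a) (g - a) * K_num a b c d e f g * sinpi (e - a) * sinpi (2 - e) -
     A_fun a (1 + a - e) (1 + a - f) (1 + a - g) * B4 a b c d e f g *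
       K_num (e - a) (e - b) (e - c) (e - d) (1 + e - f) (1 + e - g) e * sinpi a * sinpi (2 - e) -
     A_fun a b c d * B2 a b c d e f g * L_num (1 - a) (1 - b) (1 - c) (1 - d) (2 - e) (2 - f) (2 - g) * sinpi a * sinpi (e - a)"

text \<open>
  The coefficient of \<open>K\<close> in its expression through two \<open>L\<close>'s, up to sign the same for the equation and its dual.
\<close>

definition kappa :: complex_fun7 where
  "kappa a b c d e f g = sinpi g * sinpi (f - a) * (sinpi a * sinpi (e - f) * sinpi (e - g) - sinpi (b - e) * sinpi (c - e) * sinpi (d - e)) -
     sinpi (b - g) * sinpi (c - g) * sinpi (d - g) * sinpi (e - f) * sinpi a"

text \<open>\<open>kappa\<close> is written in the form in which the dual equation yields it; the
  first relation gives its form for the original equation. The second relation shows that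
  \<open>kappa\<close> divides the determinant of the elimination, with cofactor \<open>W2\<close>.
  Multiplication by \<open>sinpi (f - g) ^ 2\<close> reduces it to the quadratic identity, because
  each of \<open>W4\<close>, \<open>W4s\<close>, \<open>W2\<close> times
  \<open>sinpi (f - g)\<close> is a linear form in \<open>U f\<close> and
  \<open>U g\<close>.\<close>

lemma sine_relations:
  fixes a b c d e f g :: complex
  defines "U x \<equiv> sinpi (b - x) * sinpi (c - x) * sinpi (d - x)"
  defines "W4 \<equiv> sinpi b * sinpi c * sinpi d + sinpi (e - a) * sinpi f * sinpi g"
    and "W4s \<equiv> sinpi a * sinpi (e - f) * sinpi (e - g) - sinpi (b - e) * sinpi (c - e) * sinpi (d - e)"
    and "W2 \<equiv> sinpi (b - a) * sinpi (c - a) * sinpi (d - a) + sinpi (e - 2 * a) * sinpi (f - a) * sinpi (g - a)"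
  assumes bal: "e + f + g - a - b - c - d = 1" and fg: "sinpi (f - g) \<noteq> 0"
  shows "kappa a b c d e f g = - (U g * sinpi f * sinpi (e - a) - sinpi (e - g) * sinpi (f - a) * W4)"
    and "W4 * W4s * sinpi (f - a) * sinpi (g - a) = W2 * kappa a b c d e f g + sinpi a * sinpi (e - a) * U f * U g"
proof -
  have h: "(b - e) + (c - e) + (d - e) - (f - e) - (g - e) = - a - 1"
    "(b - a) + (c - a) + (d - a) - (f - a) - (g - a) = (e - 2 * a) - 1" using bal by (simp_all add: algebra_simps)
  have dd: "(x - z) - (y - z) = x - y" for x y z :: complex by simp
  have neg: "sinpi (- x) = - sinpi x" for x by (rule sinpi_neg) simp
  have fe: "sinpi (f - e) = - sinpi (e - f)" "sinpi (g - e) = - sinpi (e - g)" by (rule sinpi_neg, simp)+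
  note t1 = sine_relations_basic(1)[OF bal, folded W4_def U_def]
  note t2 = sine_relations_basic(2)[OF bal, folded W4_def W4s_def U_def]
  note t3 = sine_relations_basic(3)[OF bal]
  have t6: "W4s * sinpi (f - g) = U f * sinpi (g - e) - U g * sinpi (f - e)"
    using sinpi_product_difference[of "b - e" "f - e" "c - e" "d - e" "g - e"]
    unfolding h(1) dd sinpi_minus_1[OF refl] neg unfolding W4s_def U_def fe by algebra
  have t4: "W2 * sinpi (f - g) = U g * sinpi (f - a) - U f * sinpi (g - a)"
    using sinpi_product_difference[of "b - a" "f - a" "c - a" "d - a" "g - a"]
    unfolding h(2) dd sinpi_minus_1[OF refl] unfolding W2_def U_def by algebra
  have kappa: "kappa a b c d e f g = sinpi g * sinpi (f - a) * W4s - U g * sinpi (e - f) * sinpi a"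
    by (simp add: kappa_def W4s_def U_def)
  show "kappa a b c d e f g = - (U g * sinpi f * sinpi (e - a) - sinpi (e - g) * sinpi (f - a) * W4)"
    unfolding kappa using t2 t3 by algebra
  have q: "(U g * sinpi f - U f * sinpi g) * (U f * sinpi (g - e) - U g * sinpi (f - e)) * sinpi (f - a) * sinpi (g - a) =
    (U g * sinpi (f - a) - U f * sinpi (g - a)) * (U g * sinpi (f - e) * sinpi a * sinpi (f - g) + sinpi g * sinpi (f - a) * (U f * sinpi (g - e) - U g * sinpi (f - e))) +
    sinpi a * sinpi (e - a) * U f * U g * sinpi (f - g) ^ 2"
  proof -
    have d: "of_real pi * (x - y) = of_real pi * x - of_real pi * y" for x y :: complex by (rule right_diff_distrib)
    define u v where "u = U f" and "v = U g"
    show ?thesis unfolding u_def[symmetric] v_def[symmetric] unfolding d by (rule sin_quadratic_identity)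
  qed
  have "sinpi (f - g) ^ 2 * (W4 * W4s * sinpi (f - a) * sinpi (g - a)) = (W4 * sinpi (f - g)) * (W4s * sinpi (f - g)) * sinpi (f - a) * sinpi (g - a)"
    by (simp add: power2_eq_square mult_ac)
  also have "\<dots> = (W2 * sinpi (f - g)) * (U g * sinpi (f - e) * sinpi a * sinpi (f - g) + sinpi g * sinpi (f - a) * (W4s * sinpi (f - g))) +
     sinpi a * sinpi (e - a) * U f * U g * sinpi (f - g) ^ 2"
    unfolding t1 t4 t6 by (rule q)
  also have "\<dots> = sinpi (f - g) ^ 2 * (W2 * kappa a b c d e f g + sinpi a * sinpi (e - a) * U f * U g)"
    unfolding kappa fe by (simp add: power2_eq_square algebra_simps)
  finally show "W4 * W4s * sinpi (f - a) * sinpi (g - a) = W2 * kappa a b c d e f g + sinpi a * sinpi (e - a) * U f * U g"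
    using fg by simp
qed

lemma not_Ints_Im: "Im z \<noteq> 0 \<Longrightarrow> z \<notin> \<int>" for z :: complex
  by (auto elim!: Ints_cases)

lemma rGamma_reflect: "rGamma (1 + x - y) * rGamma (y - x) = sinpi (y - x) / of_real pi" for x y :: complex
  using rGamma_reflection_complex[of "y - x"] by (simp add: algebra_simps)

text \<open>
  The chain of inequalities between the imaginary parts gives every linear form in the parameters that has to avoid
  the integers a nonzero imaginary part. The bounds on the real parts ensure dominated convergence of the residue sums.
\<close>

lemma cleared_lhs_generic:
  fixes a b c d e f g :: complex
  assumes bal: "e + f + g - a - b - c - d = 1"
    and re: "0 < Re (e - a)" "Re (e - a) < 2" "0 < Re (f - a)" "Re (f - a) < 2" "0 < Re a" "Re a < 2" "0 < Re (1 + a - f)" "Re (1 + a - f) < 2"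
    and im: "0 < Im a" "Im a < Im b" "Im b < Im c" "Im c < Im d" "2 * Im d < Im e" "2 * Im e < Im f"
  shows "kappa a b c d e f g * cleared_lhs a b c d e f g = 0"
proof -
  have imbal: "Im e + Im f + Im g = Im a + Im b + Im c + Im d"
    using arg_cong[OF bal, of Im] by simp
  note H = im imbal
  define P0 where "P0 = Phi a b c d e f g"
  define Pe where "Pe = Phi (1 + a - e) (1 + b - e) (1 + c - e) (1 + d - e) (2 - e) (1 + f - e) (1 + g - e)"
  define Pf where "Pf = Phi (1 + a - f) (1 + b - f) (1 + c - f) (1 + d - f) (1 + e - f) (2 - f) (1 + g - f)"
  define Pg where "Pg = Phi (1 + a - g) (1 + b - g) (1 + c - g) (1 + d - g) (1 + e - g) (1 + f - g) (2 - g)"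
  define Pa where "Pa = Phi a (1 + a - e) (1 + a - f) (1 + a - g) (1 + a - b) (1 + a - c) (1 + a - d)"
  define Y0 where "Y0 = Phi (e - a) (e - b) (e - c) (e - d) e (1 + e - f) (1 + e - g)"
  define Ye where "Ye = Phi (1 - a) (1 - b) (1 - c) (1 - d) (2 - e) (2 - f) (2 - g)"
  define Yf where "Yf = Phi (f - a) (f - b) (f - c) (f - d) f (1 + f - e) (1 + f - g)"
  define Yg where "Yg = Phi (g - a) (g - b) (g - c) (g - d) g (1 + g - f) (1 + g - e)"
  define Ya where "Ya = Phi (e - a) (1 - a) (f - a) (g - a) (1 + b - a) (1 + c - a) (1 + d - a)"
  define U0 where "U0 = sinpi b * sinpi c * sinpi d"
  define Ue where "Ue = sinpi (b - e) * sinpi (c - e) * sinpi (d - e)"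
  define Uf where "Uf = sinpi (b - f) * sinpi (c - f) * sinpi (d - f)"
  define Ug where "Ug = sinpi (b - g) * sinpi (c - g) * sinpi (d - g)"
  define W4 where "W4 = sinpi b * sinpi c * sinpi d + sinpi (e - a) * sinpi f * sinpi g"
  define W4s where "W4s = sinpi a * sinpi (e - f) * sinpi (e - g) - sinpi (b - e) * sinpi (c - e) * sinpi (d - e)"
  define W2 where "W2 = sinpi (b - a) * sinpi (c - a) * sinpi (d - a) + sinpi (e - 2 * a) * sinpi (f - a) * sinpi (g - a)"
  define k where "k = kappa a b c d e f g"
  have neg: "sinpi (x - y) = - sinpi (y - x)" for x y by (rule sinpi_neg) simp
  have nz: "sinpi a \<noteq> 0" "sinpi (f - a) \<noteq> 0" "sinpi (g - a) \<noteq> 0" "sinpi (f - g) \<noteq> 0" "sinpi b \<noteq> 0" "sinpi c \<noteq> 0" "sinpi d \<noteq> 0"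
    "sinpi (b - f) \<noteq> 0" "sinpi (c - f) \<noteq> 0" "sinpi (d - f) \<noteq> 0" "sinpi (b - g) \<noteq> 0" "sinpi (c - g) \<noteq> 0" "sinpi (d - g) \<noteq> 0"
    using H by - (rule sinpi_nonzero; rule not_Ints_Im; (simp only: minus_complex.sel)?; linarith)+
  note sines = sine_relations[OF bal nz(4)]
  have kk: "k = - (Ug * sinpi f * sinpi (e - a) - sinpi (e - g) * sinpi (f - a) * W4)"
    unfolding k_def Ug_def W4_def by (rule sines(1))
  have t5: "W4 * W4s * sinpi (f - a) * sinpi (g - a) = W2 * k + sinpi a * sinpi (e - a) * Uf * Ug"
    unfolding k_def Uf_def Ug_def W4_def W4s_def W2_def by (rule sines(2))
  have KL0: "(Ug * sinpi f * sinpi (e - a) - sinpi (e - g) * sinpi (f - a) * W4) * (P0 + Pa) =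
      W4 * Ue / sinpi e * (P0 - Pe) + Uf * Ug / sinpi (f - g) * (Pf - Pg)"
    unfolding Ue_def Uf_def Ug_def W4_def P0_def Pe_def Pf_def Pg_def Pa_def
    using H by - (rule Phi_three_term[OF bal re(1-4)]; rule not_Ints_Im; (simp only: minus_complex.sel)?; linarith)
  have KL: "k * (P0 + Pa) = - (W4 * Ue * ((P0 - Pe) / sinpi e) + Uf * Ug * ((Pf - Pg) / sinpi (f - g)))"
    unfolding kk mult_minus_left KL0 by simp
  have args: "1 + (e - x) - e = 1 - x" "1 + (e - x) - (1 + e - y) = y - x" "1 + (e - x) - (e - y) = 1 + y - x"
    "1 + e - (1 + e - y) = y" "1 + (1 + e - y) - (1 + e - z) = 1 + z - y" "2 - (1 + e - y) = 1 + y - e"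
    "1 + (1 + e - y) - e = 2 - y" for x y z by simp_all
  have dsines: "sinpi (e - x - (1 + e - y)) = sinpi (x - y)" "sinpi (e - x - e) = - sinpi x" "sinpi (e - (e - x)) = sinpi x"
    "sinpi (e - (1 + e - y)) = - sinpi y" "sinpi (1 + e - y) = - sinpi (e - y)" "sinpi (1 + e - y - (e - x)) = sinpi (y - x)"
    "sinpi (1 + e - y - (1 + e - x)) = sinpi (x - y)" for x y
  proof -
    show "sinpi (e - x - (1 + e - y)) = sinpi (x - y)"
      using sinpi_minus_1[of "e - x - (1 + e - y)" "y - x"] neg[of y x] by simp
    show "sinpi (e - x - e) = - sinpi x" by (rule sinpi_neg) simp
    show "sinpi (e - (e - x)) = sinpi x" by simp
    show "sinpi (e - (1 + e - y)) = - sinpi y" by (rule sinpi_minus_1) simp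
    show "sinpi (1 + e - y) = - sinpi (e - y)" by (rule sinpi_1_plus) simp
    show "sinpi (1 + e - y - (e - x)) = sinpi (y - x)" by (rule sinpi_1_minus) simp
    show "sinpi (1 + e - y - (1 + e - x)) = sinpi (x - y)" by (rule sinpi_eqI) simp
  qed
  have KLs0: "(Ug * (- sinpi (e - f)) * sinpi a - (- sinpi g) * sinpi (f - a) * (sinpi (e - b) * sinpi (e - c) * sinpi (e - d) + sinpi a * (- sinpi (e - f)) * (- sinpi (e - g)))) *
      (Y0 + Ya) = (sinpi (e - b) * sinpi (e - c) * sinpi (e - d) + sinpi a * (- sinpi (e - f)) * (- sinpi (e - g))) * ((- sinpi b) * (- sinpi c) * (- sinpi d)) / sinpi e * (Y0 - Ye) +
      Uf * Ug / sinpi (g - f) * (Yf - Yg)"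
  proof -
    have bal': "e + (1 + e - f) + (1 + e - g) - (e - a) - (e - b) - (e - c) - (e - d) = 1"
      using bal by (simp add: algebra_simps)
    \<comment> \<open>For the dual parameters the two controlled differences are \<open>a\<close>
      and \<open>1 + a - f\<close>; this is why real parts of these are bounded in the
      hypotheses.\<close>
    have re': "0 < Re (e - (e - a))" "Re (e - (e - a)) < 2" "0 < Re (1 + e - f - (e - a))" "Re (1 + e - f - (e - a)) < 2"
      using re(5-8) by simp_all
    show ?thesis
      unfolding Uf_def Ug_def Y0_def Ye_def Yf_def Yg_def Ya_def
      using H by - (rule Phi_three_term[OF bal' re', unfolded dsines args]; rule not_Ints_Im;
        (simp only: minus_complex.sel plus_complex.sel one_complex.sel)?; linarith)
  qed
  have KLs: "k * (Y0 + Ya) = - (W4s * U0 * ((Y0 - Ye) / sinpi e)) + Uf * Ug * ((Yf - Yg) / sinpi (g - f))"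
  proof -
    have "sinpi (e - b) * sinpi (e - c) * sinpi (e - d) + sinpi a * (- sinpi (e - f)) * (- sinpi (e - g)) = W4s"
      unfolding W4s_def neg[of e b] neg[of e c] neg[of e d] by simp
    note KLs1 = KLs0[unfolded this]
    have "Ug * (- sinpi (e - f)) * sinpi a - (- sinpi g) * sinpi (f - a) * W4s = k"
      unfolding k_def kappa_def W4s_def Ug_def by (simp add: algebra_simps)
    note KLs2 = KLs1[unfolded this]
    show ?thesis unfolding KLs2 U0_def by simp
  qed
  define RA where "RA = A_fun a b c d"
  define RE where "RE = A_fun (1 + a - e) (1 + b - e) (1 + c - e) (1 + d - e)"
  define RF where "RF = A_fun (1 + a - f) (1 + b - f) (1 + c - f) (1 + d - f)"
  define RG where "RG = A_fun (1 + a - g) (1 + b - g) (1 + c - g) (1 + d - g)"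
  define QA where "QA = A_fun (1 - a) (1 - b) (1 - c) (1 - d)"
  define QE where "QE = A_fun (e - a) (e - b) (e - c) (e - d)"
  define QF where "QF = A_fun (f - a) (f - b) (f - c) (f - d)"
  define QG where "QG = A_fun (g - a) (g - b) (g - c) (g - d)"
  define J where "J = A_fun a (1 + a - e) (1 + a - f) (1 + a - g)"
  define J' where "J' = A_fun (1 - a) (e - a) (f - a) (g - a)"
  define p where "p = (of_real pi ^ 4 :: complex)"
  have p0: "p \<noteq> 0" by (simp add: p_def)
  \<comment> \<open>The dual of the pair for the lower parameter \<open>e\<close> has base
    \<open>1 + f - g\<close> and consists of the dual series with upper parameters
    \<open>f - a, ...\<close> and \<open>g - a, ...\<close>. So the pair of \<open>e\<close>
    corresponds to the dual pair of \<open>f\<close> and \<open>g\<close>.\<close>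
  have LA: "RA * RE * ((P0 - Pe) / sinpi e) = QF * QG * ((Yf - Yg) / sinpi (g - f))"
  proof -
    have L: "Phi_pair a b c d e f g = Phi_pair (f - a) (f - b) (f - c) (f - d) (1 + f - g) f (1 + f - e)"
      using H by - (rule Phi_pair_dual[OF bal]; rule not_Ints_Im; (simp only: minus_complex.sel plus_complex.sel)?; linarith)
    have eqs: "1 + (f - x) - (1 + f - g) = g - x" "2 - (1 + f - g) = 1 + g - f" "1 + f - (1 + f - g) = g"
      "1 + (1 + f - e) - (1 + f - g) = 1 + g - e" for x by simp_all
    have s: "sinpi (1 + f - g) = sinpi (g - f)" by (rule sinpi_1_minus) simp
    have Y: "Phi (f - a) (f - b) (f - c) (f - d) (1 + f - g) f (1 + f - e) = Yf"
      "Phi (g - a) (g - b) (g - c) (g - d) (1 + g - f) g (1 + g - e) = Yg"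
      unfolding Yf_def Yg_def by (metis Phi_swaps(4,5))+
    have "of_real pi * RA * RE * ((P0 - Pe) / sinpi e) = of_real pi * QF * QG * ((Yf - Yg) / sinpi (g - f))"
      using L unfolding Phi_pair_eq eqs s Y RA_def RE_def QF_def QG_def P0_def Pe_def A_fun_def .
    then show ?thesis by (simp only: mult.assoc mult_cancel_left of_real_eq_0_iff pi_neq_zero simp_thms)
  qed
  \<comment> \<open>The same duality for the parameters translated by \<open>1 - f\<close>, with
    base \<open>1 + g - f\<close>. The dual base is now \<open>2 - e\<close>, so the pair of
    \<open>f\<close> and \<open>g\<close> corresponds to the dual pair of \<open>e\<close>; both the
    difference and the sine of the base change sign.\<close>
  have LB: "RF * RG * ((Pf - Pg) / sinpi (f - g)) = QA * QE * ((Y0 - Ye) / sinpi e)"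
  proof -
    have bal': "(1 + g - f) + (2 - f) + (1 + e - f) - (1 + a - f) - (1 + b - f) - (1 + c - f) - (1 + d - f) = 1"
      using bal by (simp add: algebra_simps)
    have L: "Phi_pair (1 + a - f) (1 + b - f) (1 + c - f) (1 + d - f) (1 + g - f) (2 - f) (1 + e - f) =
      Phi_pair ((2 - f) - (1 + a - f)) ((2 - f) - (1 + b - f)) ((2 - f) - (1 + c - f)) ((2 - f) - (1 + d - f))
        (1 + (2 - f) - (1 + e - f)) (2 - f) (1 + (2 - f) - (1 + g - f))"
      using H by - (rule Phi_pair_dual[OF bal']; rule not_Ints_Im;
        (simp only: minus_complex.sel plus_complex.sel one_complex.sel complex_Im_numeral)?; linarith)
    have eqs: "(2 - f) - (1 + x - f) = 1 - x" "1 + (2 - f) - (1 + x - f) = 2 - x" "1 + (1 + x - f) - (1 + y - f) = 1 + x - y"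
      "2 - (1 + x - f) = 1 + f - x" "1 + (1 - x) - (2 - e) = e - x" "2 - (2 - e) = e" "1 + (2 - x) - (2 - e) = 1 + e - x" for x y
      by simp_all
    have s: "sinpi (1 + g - f) = sinpi (f - g)" "sinpi (2 - e) = - sinpi e"
      by (rule sinpi_1_minus, simp) (rule sinpi_2_minus, simp)
    have P: "Phi (1 + a - f) (1 + b - f) (1 + c - f) (1 + d - f) (1 + g - f) (2 - f) (1 + e - f) = Pf"
      "Phi (1 + a - g) (1 + b - g) (1 + c - g) (1 + d - g) (1 + f - g) (2 - g) (1 + e - g) = Pg"
      unfolding Pf_def Pg_def by (metis Phi_swaps(4,5))+
    have "of_real pi * RF * RG * ((Pf - Pg) / sinpi (f - g)) = of_real pi * QA * QE * ((Ye - Y0) / (- sinpi e))"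
      using L unfolding Phi_pair_eq eqs s P RF_def RG_def QA_def QE_def Ye_def Y0_def A_fun_def .
    moreover have "(Ye - Y0) / (- sinpi e) = (Y0 - Ye) / sinpi e" by (metis minus_diff_eq minus_divide_divide)
    ultimately show ?thesis by (simp only: mult.assoc mult_cancel_left of_real_eq_0_iff pi_neq_zero simp_thms)
  qed
  have quad: "(x1 * x2 * x3 * x4) * (y1 * y2 * y3 * y4) * p = z1 * z2 * z3 * z4"
    if "x1 * y1 = z1 / of_real pi" "x2 * y2 = z2 / of_real pi" "x3 * y3 = z3 / of_real pi" "x4 * y4 = z4 / of_real pi"
    for x1 x2 x3 x4 y1 y2 y3 y4 z1 z2 z3 z4 :: complex
  proof -
    have "(x1 * x2 * x3 * x4) * (y1 * y2 * y3 * y4) = (x1 * y1) * (x2 * y2) * (x3 * y3) * (x4 * y4)" by (simp only: mult_ac)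
    then show ?thesis unfolding that p_def by (simp add: power4_eq_xxxx)
  qed
  have RQ: "RA * QA * p = sinpi a * U0" "RE * QE * p = - (sinpi (e - a) * Ue)" "RF * QF * p = - (sinpi (f - a) * Uf)" "RG * QG * p = - (sinpi (g - a) * Ug)"
  proof -
    show "RA * QA * p = sinpi a * U0"
      unfolding RA_def QA_def A_fun_def U0_def
      by (subst quad[OF rGamma_reflection_complex rGamma_reflection_complex rGamma_reflection_complex rGamma_reflection_complex])
        (simp only: mult.assoc)
    have U: "A_fun (1 + a - x) (1 + b - x) (1 + c - x) (1 + d - x) * A_fun (x - a) (x - b) (x - c) (x - d) * p =
       - (sinpi (x - a) * (sinpi (b - x) * sinpi (c - x) * sinpi (d - x)))" for x
      unfolding A_fun_def neg[of b x] neg[of c x] neg[of d x]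
      by (subst quad[OF rGamma_reflect rGamma_reflect rGamma_reflect rGamma_reflect]) simp
    show "RE * QE * p = - (sinpi (e - a) * Ue)" "RF * QF * p = - (sinpi (f - a) * Uf)" "RG * QG * p = - (sinpi (g - a) * Ug)"
      unfolding RE_def QE_def RF_def QF_def RG_def QG_def Ue_def Uf_def Ug_def by (rule U)+
  qed
  have JJ: "J * J' * p = sinpi a * sinpi (e - a) * sinpi (f - a) * sinpi (g - a)"
    unfolding J_def J'_def A_fun_def by (rule quad[OF rGamma_reflection_complex rGamma_reflect rGamma_reflect rGamma_reflect])
  have Kn1: "K_num a b c d e f g = RA * J * (P0 + Pa)"
  proof -
    have bal': "(1 + a - b) + (1 + a - c) + (1 + a - d) - a - (1 + a - e) - (1 + a - f) - (1 + a - g) = 1"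
      using bal by (simp add: algebra_simps)
    have 1: "hyp_reg a b c d e f g = P0 * (rGamma a * rGamma b * rGamma c * rGamma d)"
      unfolding P0_def using H by - (rule hyp_reg_eq_Phi[OF bal]; rule not_Ints_Im; linarith)
    have 2: "hyp_reg a (1 + a - e) (1 + a - f) (1 + a - g) (1 + a - b) (1 + a - c) (1 + a - d) =
        Pa * (rGamma a * rGamma (1 + a - e) * rGamma (1 + a - f) * rGamma (1 + a - g))"
      unfolding Pa_def using H by - (rule hyp_reg_eq_Phi[OF bal']; rule not_Ints_Im;
        (simp only: minus_complex.sel plus_complex.sel one_complex.sel)?; linarith)
    show ?thesis unfolding K_num_def 1 2 RA_def J_def A_fun_def by (simp add: algebra_simps)
  qed
  have Kn2: "K_num (e - a) (e - b) (e - c) (e - d) (1 + e - f) (1 + e - g) e = QE * J' * (Y0 + Ya)"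
  proof -
    have bal1: "(1 + e - f) + (1 + e - g) + e - (e - a) - (e - b) - (e - c) - (e - d) = 1"
      and bal2: "(1 + b - a) + (1 + c - a) + (1 + d - a) - (e - a) - (f - a) - (g - a) - (1 - a) = 1"
      using bal by (simp_all add: algebra_simps)
    have Y0: "Phi (e - a) (e - b) (e - c) (e - d) (1 + e - f) (1 + e - g) e = Y0"
      unfolding Y0_def by (metis Phi_swaps(4,5))
    have Ya: "Phi (e - a) (f - a) (g - a) (1 - a) (1 + b - a) (1 + c - a) (1 + d - a) = Ya"
      unfolding Ya_def by (metis Phi_swaps(2,3))
    have 1: "hyp_reg (e - a) (e - b) (e - c) (e - d) (1 + e - f) (1 + e - g) e = Y0 * (rGamma (e - a) * rGamma (e - b) * rGamma (e - c) * rGamma (e - d))"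
      unfolding Y0[symmetric] using H by - (rule hyp_reg_eq_Phi[OF bal1]; rule not_Ints_Im;
        (simp only: minus_complex.sel plus_complex.sel one_complex.sel)?; linarith)
    have 2: "hyp_reg (e - a) (f - a) (g - a) (1 - a) (1 + b - a) (1 + c - a) (1 + d - a) =
        Ya * (rGamma (e - a) * rGamma (f - a) * rGamma (g - a) * rGamma (1 - a))"
      unfolding Ya[symmetric] using H by - (rule hyp_reg_eq_Phi[OF bal2]; rule not_Ints_Im;
        (simp only: minus_complex.sel plus_complex.sel one_complex.sel)?; linarith)
    show ?thesis unfolding K_num_def args 1 2 QE_def J'_def A_fun_def by (simp add: algebra_simps)
  qed
  have Ln1: "L_num (1 - a) (1 - b) (1 - c) (1 - d) (2 - e) (2 - f) (2 - g) = QA * QE * (- (sinpi e * ((Y0 - Ye) / sinpi e)))"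
  proof -
    have bal1: "(2 - e) + (2 - f) + (2 - g) - (1 - a) - (1 - b) - (1 - c) - (1 - d) = 1"
      and bal2: "e + (1 + e - f) + (1 + e - g) - (e - a) - (e - b) - (e - c) - (e - d) = 1"
      using bal by (simp_all add: algebra_simps)
    have eqs: "1 + (1 - x) - (2 - e) = e - x" "2 - (2 - e) = e" "1 + (2 - x) - (2 - e) = 1 + e - x" for x by simp_all
    have 1: "hyp_reg (1 - a) (1 - b) (1 - c) (1 - d) (2 - e) (2 - f) (2 - g) = Ye * (rGamma (1 - a) * rGamma (1 - b) * rGamma (1 - c) * rGamma (1 - d))"
      unfolding Ye_def using H by - (rule hyp_reg_eq_Phi[OF bal1]; rule not_Ints_Im;
        (simp only: minus_complex.sel plus_complex.sel one_complex.sel complex_Im_numeral)?; linarith)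
    have 2: "hyp_reg (e - a) (e - b) (e - c) (e - d) e (1 + e - f) (1 + e - g) = Y0 * (rGamma (e - a) * rGamma (e - b) * rGamma (e - c) * rGamma (e - d))"
      unfolding Y0_def using H by - (rule hyp_reg_eq_Phi[OF bal2]; rule not_Ints_Im;
        (simp only: minus_complex.sel plus_complex.sel one_complex.sel)?; linarith)
    have "e \<notin> \<int>" using H by - (rule not_Ints_Im; linarith)
    then have "sinpi e \<noteq> 0" by (rule sinpi_nonzero)
    then have X: "sinpi e * ((Y0 - Ye) / sinpi e) = Y0 - Ye" by simp
    show ?thesis unfolding X L_num_def eqs 1 2 QA_def QE_def A_fun_def by (simp add: algebra_simps)
  qed
  have B: "B4 a b c d e f g = sinpi (f - a) * sinpi (g - a) * W4 / p" "B2 a b c d e f g = sinpi (f - a) * sinpi (g - a) * W2 / p"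
    unfolding B4_def B2_def S_fun_def W4_def W2_def p_def by (simp_all add: mult_ac)
  have s2: "sinpi (2 - e) = - sinpi e" by (rule sinpi_2_minus) simp
  have "k * (sinpi a * RF * RG * J' * (RA * J * (P0 + Pa)) * sinpi (e - a) * (- sinpi e) -
      J * (sinpi (f - a) * sinpi (g - a) * W4 / p) * (QE * J' * (Y0 + Ya)) * sinpi a * (- sinpi e) -
      RA * (sinpi (f - a) * sinpi (g - a) * W2 / p) * (QA * QE * (- (sinpi e * ((Y0 - Ye) / sinpi e)))) * sinpi a * sinpi (e - a)) = 0"
    by (rule elimination_algebra[OF KL KLs LA LB RQ JJ t5 p0 nz(1,2,3)]) (use nz in \<open>simp_all add: U0_def Uf_def Ug_def\<close>)
  then show ?thesis
    unfolding cleared_lhs_def k_def[symmetric] Kn1 Kn2 Ln1 B s2 RF_def[symmetric] RG_def[symmetric] J_def[symmetric] J'_def[symmetric] RA_def[symmetric] .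
qed

section \<open>Analytic continuation\<close>

lemma holomorphic_A_fun:
  assumes "x holomorphic_on UNIV" "y holomorphic_on UNIV" "z holomorphic_on UNIV" "w holomorphic_on UNIV"
  shows "(\<lambda>t. A_fun (x t) (y t) (z t) (w t)) holomorphic_on UNIV"
  unfolding A_fun_def by (intro holomorphic_intros assms)

lemma holomorphic_K_num:
  assumes hol: "a holomorphic_on UNIV" "b holomorphic_on UNIV" "c holomorphic_on UNIV" "d holomorphic_on UNIV"
      "e holomorphic_on UNIV" "f holomorphic_on UNIV" "g holomorphic_on UNIV"
    and bal: "\<And>t. e t + f t + g t - a t - b t - c t - d t = 1"
  shows "(\<lambda>t. K_num (a t) (b t) (c t) (d t) (e t) (f t) (g t)) holomorphic_on UNIV"
proof -
  have bal': "(1 + a t - b t) + (1 + a t - c t) + (1 + a t - d t) - a t - (1 + a t - e t) - (1 + a t - f t) - (1 + a t - g t) = 1" for t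
    using bal[of t] by (simp add: algebra_simps)
  show ?thesis unfolding K_num_def
    by (intro holomorphic_on_add holomorphic_on_mult holomorphic_A_fun hyp_reg_holomorphic holomorphic_on_diff
        holomorphic_on_const hol bal bal')
qed

lemma holomorphic_L_num:
  assumes hol: "a holomorphic_on UNIV" "b holomorphic_on UNIV" "c holomorphic_on UNIV" "d holomorphic_on UNIV"
      "e holomorphic_on UNIV" "f holomorphic_on UNIV" "g holomorphic_on UNIV"
    and bal: "\<And>t. e t + f t + g t - a t - b t - c t - d t = 1"
  shows "(\<lambda>t. L_num (a t) (b t) (c t) (d t) (e t) (f t) (g t)) holomorphic_on UNIV"
proof -
  have bal': "(2 - e t) + (1 + f t - e t) + (1 + g t - e t) - (1 + a t - e t) - (1 + b t - e t) - (1 + c t - e t) - (1 + d t - e t) = 1" for t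
    using bal[of t] by (simp add: algebra_simps)
  show ?thesis unfolding L_num_def
    by (intro holomorphic_on_add holomorphic_on_mult holomorphic_A_fun hyp_reg_holomorphic holomorphic_on_diff
        holomorphic_on_const hol bal bal')
qed

lemma holomorphic_cleared_lhs:
  assumes hol: "a holomorphic_on UNIV" "b holomorphic_on UNIV" "c holomorphic_on UNIV" "d holomorphic_on UNIV"
      "e holomorphic_on UNIV" "f holomorphic_on UNIV" "g holomorphic_on UNIV"
    and bal: "\<And>t. e t + f t + g t - a t - b t - c t - d t = 1"
  shows "(\<lambda>t. cleared_lhs (a t) (b t) (c t) (d t) (e t) (f t) (g t)) holomorphic_on UNIV"
proof -
  have bal1: "(1 + e t - f t) + (1 + e t - g t) + e t - (e t - a t) - (e t - b t) - (e t - c t) - (e t - d t) = 1"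
    and bal2: "(2 - e t) + (2 - f t) + (2 - g t) - (1 - a t) - (1 - b t) - (1 - c t) - (1 - d t) = 1" for t
    using bal[of t] by (simp_all add: algebra_simps)
  have sinpi: "(\<lambda>t. sinpi (h t)) holomorphic_on UNIV" if "h holomorphic_on UNIV" for h
    by (intro holomorphic_intros that)
  have B4: "(\<lambda>t. B4 (a t) (b t) (c t) (d t) (e t) (f t) (g t)) holomorphic_on UNIV"
    unfolding B4_def S_fun_def list.map prod_list.Cons prod_list.Nil
    by (intro holomorphic_on_mult holomorphic_on_add holomorphic_on_diff sinpi holomorphic_on_const hol)
  have B2: "(\<lambda>t. B2 (a t) (b t) (c t) (d t) (e t) (f t) (g t)) holomorphic_on UNIV"
    unfolding B2_def S_fun_def list.map prod_list.Cons prod_list.Nil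
    by (intro holomorphic_on_mult holomorphic_on_add holomorphic_on_diff sinpi holomorphic_on_const hol)
  show ?thesis unfolding cleared_lhs_def
    by (intro holomorphic_on_diff holomorphic_on_mult holomorphic_A_fun B4 B2 holomorphic_K_num holomorphic_L_num
        sinpi holomorphic_on_add holomorphic_on_const hol bal bal1 bal2)
qed

lemma holomorphic_kappa:
  assumes hol: "a holomorphic_on UNIV" "b holomorphic_on UNIV" "c holomorphic_on UNIV" "d holomorphic_on UNIV"
      "e holomorphic_on UNIV" "f holomorphic_on UNIV" "g holomorphic_on UNIV"
  shows "(\<lambda>t. kappa (a t) (b t) (c t) (d t) (e t) (f t) (g t)) holomorphic_on UNIV"
  unfolding kappa_def by (intro holomorphic_intros hol)

section \<open>Continuation along complex lines\<close>

lemma holomorphic_vanish: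
  fixes h :: "complex \<Rightarrow> complex"
  assumes hol: "h holomorphic_on UNIV" and ev: "\<forall>\<^sub>F t in nhds 1. h t = 0"
  shows "h z = 0"
proof -
  obtain S where S: "open S" "1 \<in> S" "\<And>t. t \<in> S \<Longrightarrow> h t = 0"
    using ev unfolding eventually_nhds by blast
  show ?thesis
    by (rule analytic_continuation_open[OF S(1) open_UNIV _ connected_UNIV subset_UNIV hol holomorphic_on_const[of 0 UNIV]])
      (use S in auto)
qed

lemma eventually_nhds_less:
  fixes u v :: "complex \<Rightarrow> real"
  assumes "isCont u z" "isCont v z" "u z < v z"
  shows "\<forall>\<^sub>F t in nhds z. u t < v t"
proof -
  have "((\<lambda>t. v t - u t) \<longlongrightarrow> v z - u z) (nhds z)"
    using assms(1,2) by (intro tendsto_diff) (simp_all add: isCont_def tendsto_at_iff_tendsto_nhds)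
  from order_tendstoD(1)[OF this, of 0] show ?thesis using assms(3) by simp
qed

text \<open>The full complex line through two points. In the continuations \<open>t = 0\<close> is
  the point of interest and \<open>t = 1\<close> the point near which vanishing is known; since the
  balance condition is affine, the line stays in \<open>V\<close>.\<close>

definition seg :: "complex \<Rightarrow> complex \<Rightarrow> complex \<Rightarrow> complex" where
  "seg x y t = x + t * (y - x)"

lemma seg_0 [simp]: "seg x y 0 = x" and seg_1 [simp]: "seg x y 1 = y"
  by (simp_all add: seg_def)

lemma holomorphic_seg: "seg x y holomorphic_on S"
  unfolding seg_def[abs_def] by (intro holomorphic_intros)

lemma isCont_seg: "isCont (\<lambda>t. Re (seg x y t)) z" "isCont (\<lambda>t. Im (seg x y t)) z"
  by (auto intro!: continuous_intros simp: seg_def)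

lemma seg_balanced:
  assumes "e + f + g - a - b - c - d = 1" "e' + f' + g' - a' - b' - c' - d' = 1"
  shows "seg e e' t + seg f f' t + seg g g' t - seg a a' t - seg b b' t - seg c c' t - seg d d' t = 1"
proof -
  have "seg e e' t + seg f f' t + seg g g' t - seg a a' t - seg b b' t - seg c c' t - seg d d' t =
    (e + f + g - a - b - c - d) + t * ((e' + f' + g' - a' - b' - c' - d') - (e + f + g - a - b - c - d))"
    by (simp add: seg_def algebra_simps)
  then show ?thesis unfolding assms by simp
qed

text \<open>The factor \<open>kappa\<close> is kept at this stage and only the conditions of the
  generic case are removed. Once the product vanishes on all of \<open>V\<close>, the point at which
  to divide by \<open>kappa\<close> can be chosen freely.\<close>

lemma kappa_cleared_lhs:
  assumes bal: "e + f + g - a - b - c - d = 1"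
  shows "kappa a b c d e f g * cleared_lhs a b c d e f g = 0"
proof -
  \<comment> \<open>A point satisfying all conditions of \<open>cleared_lhs_generic\<close>
    strictly: the four real parts that have to lie between 0 and 2 all equal \<open>1 / 2\<close>,
    and the imaginary parts satisfy \<open>0 < 1 < 2 < 3 < 4\<close>, \<open>8 < 9\<close> and
    \<open>18 < 19\<close>. Strictness extends the conditions to nearby points of the line.\<close>
  define a1 b1 c1 d1 e1 f1 where "a1 = Complex (1 / 2) 1" and "b1 = Complex 0 2" and "c1 = Complex 0 3" and "d1 = Complex 0 4"
    and "e1 = Complex 1 9" and "f1 = Complex 1 19"
  define g1 where "g1 = 1 + a1 + b1 + c1 + d1 - e1 - f1"
  note pts = a1_def b1_def c1_def d1_def e1_def f1_def
  have bal1: "e1 + f1 + g1 - a1 - b1 - c1 - d1 = 1" by (simp add: g1_def)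
  define h where "h t = kappa (seg a a1 t) (seg b b1 t) (seg c c1 t) (seg d d1 t) (seg e e1 t) (seg f f1 t) (seg g g1 t) *
    cleared_lhs (seg a a1 t) (seg b b1 t) (seg c c1 t) (seg d d1 t) (seg e e1 t) (seg f f1 t) (seg g g1 t)" for t
  note pb = seg_balanced[OF bal bal1]
  have "h holomorphic_on UNIV"
    unfolding h_def by (intro holomorphic_on_mult holomorphic_kappa holomorphic_cleared_lhs holomorphic_seg pb)
  moreover have "\<forall>\<^sub>F t in nhds 1. h t = 0"
  proof -
    have "\<forall>\<^sub>F t in nhds 1. (0 < Re (seg e e1 t - seg a a1 t) \<and> Re (seg e e1 t - seg a a1 t) < 2 \<and>
        0 < Re (seg f f1 t - seg a a1 t) \<and> Re (seg f f1 t - seg a a1 t) < 2 \<and>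
        0 < Re (seg a a1 t) \<and> Re (seg a a1 t) < 2 \<and>
        0 < Re (1 + seg a a1 t - seg f f1 t) \<and> Re (1 + seg a a1 t - seg f f1 t) < 2) \<and>
        (0 < Im (seg a a1 t) \<and> Im (seg a a1 t) < Im (seg b b1 t) \<and> Im (seg b b1 t) < Im (seg c c1 t) \<and>
        Im (seg c c1 t) < Im (seg d d1 t) \<and> 2 * Im (seg d d1 t) < Im (seg e e1 t) \<and> 2 * Im (seg e e1 t) < Im (seg f f1 t))"
      by (intro eventually_conj eventually_nhds_less; simp add: pts; intro continuous_intros isCont_seg)
    then show ?thesis
    proof eventually_elim
      case (elim t)
      then show ?case unfolding h_def using cleared_lhs_generic[OF pb[of t]] by blast
    qed
  qed
  ultimately have "h 0 = 0" by (rule holomorphic_vanish)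
  then show ?thesis by (simp add: h_def)
qed

text \<open>
  The factor \<open>kappa\<close> equals 1 at \<open>a = b = c = d = 1/2\<close>, \<open>e = 5/4\<close>, \<open>f = 7/4\<close>, \<open>g = 0\<close>, so it can be cancelled on a line to that point.
\<close>

lemma cleared_lhs_eq_0:
  assumes bal: "e + f + g - a - b - c - d = 1"
  shows "cleared_lhs a b c d e f g = 0"
proof -
  define a1 :: complex where "a1 = 1 / 2"
  define e1 :: complex where "e1 = 5 / 4"
  define f1 :: complex where "f1 = 7 / 4"
  have bal1: "e1 + f1 + 0 - a1 - a1 - a1 - a1 = 1" by (simp add: a1_def e1_def f1_def)
  define h where "h t = cleared_lhs (seg a a1 t) (seg b a1 t) (seg c a1 t) (seg d a1 t) (seg e e1 t) (seg f f1 t) (seg g 0 t)" for t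
  define k where "k t = kappa (seg a a1 t) (seg b a1 t) (seg c a1 t) (seg d a1 t) (seg e e1 t) (seg f f1 t) (seg g 0 t)" for t
  note pb = seg_balanced[OF bal bal1]
  have "h holomorphic_on UNIV"
    unfolding h_def by (intro holomorphic_cleared_lhs holomorphic_seg pb)
  moreover have "\<forall>\<^sub>F t in nhds 1. h t = 0"
  proof -
    have "k holomorphic_on UNIV"
      unfolding k_def by (intro holomorphic_kappa holomorphic_seg)
    then have "isCont k 1"
      using holomorphic_on_imp_continuous_on continuous_on_eq_continuous_at open_UNIV by blast
    moreover have "k 1 \<noteq> 0"
    proof -
      have half: "sinpi (1 / 2) = 1"
        using sin_of_real[of "pi / 2", where ?'a = complex] by simp
      have "sinpi (- (1 / 2)) = - 1" using half by simp
      moreover have "5 / 4 - 7 / 4 = (- (1 / 2) :: complex)" by simp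
      ultimately show ?thesis by (simp add: k_def kappa_def a1_def e1_def f1_def half)
    qed
    ultimately have "\<forall>\<^sub>F t in nhds 1. k t \<noteq> 0"
      by (intro tendsto_imp_eventually_ne) (simp_all add: isCont_def tendsto_at_iff_tendsto_nhds)
    then show ?thesis
    proof eventually_elim
      case (elim t)
      then show ?case using kappa_cleared_lhs[OF pb[of t]] by (simp add: h_def k_def)
    qed
  qed
  ultimately have "h 0 = 0" by (rule holomorphic_vanish)
  then show ?thesis by (simp add: h_def)
qed

theorem proposition6p13:
  fixes a b c d e f g :: complex
  assumes "(a, b, c, d, e, f, g) \<in> V"
    and "K_defined a b c d e f g"
    and "K_defined (e - a) (e - b) (e - c) (e - d) (1 + e - f) (1 + e - g) e"
    and "L_defined (1 - a) (1 - b) (1 - c) (1 - d) (2 - e) (2 - f) (2 - g)"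
  shows "S_fun [a] *
           A_fun (1 + a - f) (1 + b - f) (1 + c - f) (1 + d - f) *
           A_fun (1 + a - g) (1 + b - g) (1 + c - g) (1 + d - g) *
           A_fun (1 - a) (e - a) (f - a) (g - a) *
           K_p0 a b c d e f g
         - A_fun a (1 + a - e) (1 + a - f) (1 + a - g) * B4 a b c d e f g * K_n4 a b c d e f g
         - A_fun a b c d * B2 a b c d e f g * L_bar6 a b c d e f g = 0" (is "?lhs = 0")
proof -
  have bal: "e + f + g - a - b - c - d = 1" using assms(1) by (simp add: V_def)
  have bal1: "(1 + e - f) + (1 + e - g) + e - (e - a) - (e - b) - (e - c) - (e - d) = 1"
    and bal2: "(2 - e) + (2 - f) + (2 - g) - (1 - a) - (1 - b) - (1 - c) - (1 - d) = 1"
    using bal by (simp_all add: algebra_simps)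
  have nz: "sinpi a \<noteq> 0" "sinpi (e - a) \<noteq> 0" "sinpi (2 - e) \<noteq> 0"
    using assms(2-4) by (simp_all add: K_defined_def L_defined_def)
  have "?lhs * (sinpi a * sinpi (e - a) * sinpi (2 - e)) = cleared_lhs a b c d e f g"
  proof -
    have "K_num a b c d e f g = K_p0 a b c d e f g * sinpi a"
      "K_num (e - a) (e - b) (e - c) (e - d) (1 + e - f) (1 + e - g) e = K_n4 a b c d e f g * sinpi (e - a)"
      "L_num (1 - a) (1 - b) (1 - c) (1 - d) (2 - e) (2 - f) (2 - g) = L_bar6 a b c d e f g * sinpi (2 - e)"
      unfolding K_p0_def K_n4_def L_bar6_def K_fun_eq[OF bal assms(2)] K_fun_eq[OF bal1 assms(3)] L_fun_eq[OF bal2 assms(4)]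
      using nz by simp_all
    then show ?thesis unfolding cleared_lhs_def by (simp add: S_fun_def algebra_simps)
  qed
  then show ?thesis unfolding cleared_lhs_eq_0[OF bal] using nz by simp
qed

end
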